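(* Let $\alpha$ be a positive integer and $F(z)=1+\sum_{\lambda\ge1}f_\lambda z^\lambda$. Then there is a polynomial $P_\alpha(z)\in\mathbb{Z}[z]$ such that $F(z)\equiv P_\alpha(z)/\big((1-2z)(1+5z)\big)^\alpha$ coefficientwise modulo $13^\alpha$. Moreover, the sequence $(f_\lambda)_{\lambda\ge1}$ reduced modulo $13^\alpha$ is ultimately periodic, with minimal period length equal to $12\cdot13^{\alpha-1}$.
   Context: $f_\lambda$ denotes the number of free subgroups of index $6\lambda$ in the modular group $\mathrm{PSL}_2(\mathbb{Z})\cong C_2*C_3$. "$F\equiv P/Q^\alpha$ modulo $13^\alpha$" (with $Q(0)=1$) means that the coefficients of $F(z)$ and of the power series $P(z)Q(z)^{-\alpha}$ agree modulo $13^\alpha$. *)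

theory Defs
  imports
    "HOL-Algebra.Coset"
    "HOL-Analysis.Determinants"
    "HOL-Computational_Algebra.Polynomial_FPS"
    "HOL-Number_Theory.Cong"
begin

section \<open>The modular group\<close>

definition SL2Z :: "(int ^ 2 ^ 2) monoid" where
  "SL2Z = \<lparr>carrier = {A. det A = 1}, monoid.mult = (**), one = mat 1\<rparr>"

definition PSL2Z :: "(int ^ 2 ^ 2) set monoid" where
  "PSL2Z = SL2Z Mod {mat 1, - mat 1}"

lemma group_SL2Z: "group SL2Z"
proof (rule groupI)
  fix A :: "int ^ 2 ^ 2"
  assume "A \<in> carrier SL2Z"
  then have d: "det A = 1" by (simp add: SL2Z_def)
  define B :: "int ^ 2 ^ 2" where
    "B = vector [vector [A $ 2 $ 2, - A $ 1 $ 2], vector [- A $ 2 $ 1, A $ 1 $ 1]]"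
  have "det B = 1"
    using d by (simp add: B_def det_2 algebra_simps)
  moreover have "B ** A = mat 1"
    using d by (simp add: B_def det_2 vec_eq_iff forall_2 matrix_matrix_mult_def sum_2 mat_def
        algebra_simps)
  ultimately show "\<exists>B\<in>carrier SL2Z. B \<otimes>\<^bsub>SL2Z\<^esub> A = \<one>\<^bsub>SL2Z\<^esub>"
    by (auto simp: SL2Z_def)
qed (auto simp: SL2Z_def det_mul matrix_mul_assoc)

lemma mult_uminus_mat:
  fixes A :: "int ^ 2 ^ 2"
  shows "A ** - mat 1 = - A" "- mat 1 ** A = - A"
  by (simp_all add: vec_eq_iff forall_2 matrix_matrix_mult_def sum_2 mat_def)

lemma normal_center_SL2Z: "{mat 1, - mat 1} \<lhd> SL2Z"
proof -
  interpret group SL2Z by (rule group_SL2Z)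
  have c: "{mat 1, - mat 1} \<subseteq> carrier SL2Z"
    by (auto simp: SL2Z_def det_2 mat_def)
  have m: "(- mat 1) \<otimes>\<^bsub>SL2Z\<^esub> (- mat 1) = \<one>\<^bsub>SL2Z\<^esub>"
    by (simp add: SL2Z_def mult_uminus_mat)
  have i: "inv\<^bsub>SL2Z\<^esub> (- mat 1) = - mat 1"
    using m c by (intro inv_equality) auto
  have i1: "inv\<^bsub>SL2Z\<^esub> (mat 1) = mat 1"
    using inv_one by (simp add: SL2Z_def)
  have s: "subgroup {mat 1, - mat 1} SL2Z"
  proof (rule subgroupI)
    fix a b assume "a \<in> {mat 1, - mat 1 :: int ^ 2 ^ 2}" "b \<in> {mat 1, - mat 1 :: int ^ 2 ^ 2}"
    then show "a \<otimes>\<^bsub>SL2Z\<^esub> b \<in> {mat 1, - mat 1}"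
      by (auto simp: SL2Z_def mult_uminus_mat)
  next
    fix a assume "a \<in> {mat 1, - mat 1 :: int ^ 2 ^ 2}"
    then show "inv\<^bsub>SL2Z\<^esub> a \<in> {mat 1, - mat 1}"
      using i i1 by auto
  qed (use c in auto)
  show ?thesis
    by (rule normalI[OF s], unfold r_coset_def l_coset_def)
      (auto simp: SL2Z_def mult_uminus_mat)
qed

lemma group_PSL2Z: "group PSL2Z"
  unfolding PSL2Z_def by (rule normal.factorgroup_is_group[OF normal_center_SL2Z])


section \<open>Free groups\<close>

text \<open>
  Words over an alphabet \<open>B\<close> and its formal inverses are lists of pairs \<open>(x, e)\<close>, where
  \<open>(x, True)\<close> stands for the letter \<open>x\<close> and \<open>(x, False)\<close> for its formal inverse.
\<close>

definition reduced_words :: "'a set \<Rightarrow> ('a \<times> bool) list set" where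
  "reduced_words B =
    {w. fst ` set w \<subseteq> B \<and> successively (\<lambda>(x, d) (y, e). \<not> (x = y \<and> d \<noteq> e)) w}"

definition eval_word :: "('a, 'm) monoid_scheme \<Rightarrow> ('a \<times> bool) list \<Rightarrow> 'a" where
  "eval_word G w =
    foldr (\<lambda>(x, e) g. (if e then x else inv\<^bsub>G\<^esub> x) \<otimes>\<^bsub>G\<^esub> g) w \<one>\<^bsub>G\<^esub>"

text \<open>
  \<open>G\<close> is free on \<open>B\<close> iff every element of \<open>G\<close> is the value of exactly one reduced word over
  \<open>B\<close>, that is, iff evaluation is an isomorphism from the free group on \<open>B\<close> onto \<open>G\<close>.
\<close>

definition is_free_group :: "('a, 'm) monoid_scheme \<Rightarrow> bool" where
  "is_free_group G \<longleftrightarrow>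
    group G \<and> (\<exists>B \<subseteq> carrier G. bij_betw (eval_word G) (reduced_words B) (carrier G))"


section \<open>Free subgroup numbers\<close>

text \<open>
  The values at positive arguments are the intended ones; there the cardinality of the set of
  cosets being \<open>6 * l > 0\<close> forces the index to be finite.  Since \<open>card\<close> is \<open>0\<close> on infinite
  sets, \<open>free_subgroup_number 0\<close> has no meaning and is never used.
\<close>

definition free_subgroup_number :: "nat \<Rightarrow> nat" where
  "free_subgroup_number l =
    card {H. subgroup H PSL2Z \<and> is_free_group (PSL2Z\<lparr>carrier := H\<rparr>) \<and>
             card (rcosets\<^bsub>PSL2Z\<^esub> H) = 6 * l}"

definition free_subgroup_gf :: "int fps" where
  "free_subgroup_gf = Abs_fps (\<lambda>l. if l = 0 then 1 else int (free_subgroup_number l))"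


section \<open>Coefficientwise congruence and ultimate periodicity\<close>

definition fps_cong :: "int fps \<Rightarrow> int fps \<Rightarrow> int \<Rightarrow> bool" where
  "fps_cong F G m \<longleftrightarrow> (\<forall>n. [fps_nth F n = fps_nth G n] (mod m))"

text \<open>
  The series \<open>P(z) Q(z)\<^sup>-\<^sup>a\<close> in \<open>\<int>[[z]]\<close> for \<open>Q(0) = 1\<close>.  The second argument of
  \<^const>\<open>fps_right_inverse\<close> is the inverse of the constant coefficient.
\<close>

definition fps_poly_quotient :: "int poly \<Rightarrow> int poly \<Rightarrow> nat \<Rightarrow> int fps" where
  "fps_poly_quotient P Q a = fps_of_poly P * fps_right_inverse (fps_of_poly Q) 1 ^ a"

lemma fps_poly_quotient_mult:
  assumes "coeff Q 0 = 1"
  shows "fps_poly_quotient P Q a * fps_of_poly Q ^ a = fps_of_poly P"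
proof -
  have "fps_of_poly Q * fps_right_inverse (fps_of_poly Q) 1 = 1"
    using assms by (intro fps_right_inverse) simp
  then show ?thesis
    by (simp add: fps_poly_quotient_def mult.assoc mult.commute flip: power_mult_distrib)
qed

definition eventual_period :: "(nat \<Rightarrow> 'a) \<Rightarrow> nat \<Rightarrow> bool" where
  "eventual_period u p \<longleftrightarrow> 0 < p \<and> (\<exists>N. \<forall>n\<ge>N. u (n + p) = u n)"

definition ultimately_periodic :: "(nat \<Rightarrow> 'a) \<Rightarrow> bool" where
  "ultimately_periodic u \<longleftrightarrow> (\<exists>p. eventual_period u p)"

definition minimal_period :: "(nat \<Rightarrow> 'a) \<Rightarrow> nat" where
  "minimal_period u = (LEAST p. eventual_period u p)"

end

(*
Counting the free subgroups H of index 6k through the action on the cosets of H: PSL(2,Z) is the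
free product of a group of order 2 and one of order 3, a subgroup of finite index is free iff both
generators (and the inverse of the second) act without fixed points on its cosets, and so free
subgroups of index n correspond, (n-1)! to one, to transitive pairs of fixed-point free
permutations of orders 2 and 3.  Decomposing all such pairs by the orbit of a point gives
F - 1 = 6 z E'/E, where E has coefficients e_k / 72^k with e_k = (6k)!/((3k)!(2k)!).

As k! divides e_k, E is a polynomial modulo every power of 13, and E = (1-2z)(1+5z) modulo 13.  This
gives the rational form.  Hensel's lemma splits off two factors 1-rz and 1-sz lifting 1-2z and 1+5z;
the remaining factor is 1 modulo 13 and contributes only finitely many terms to the logarithmic
derivative, so f_k = -6 (r^k + s^k) modulo 13^a for large k.  The period is the order of r
modulo 13^a, since s has no larger one; it is 12 * 13^(a-1) because r = 15 modulo 169 is a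
primitive root.
*)
theory Submission
  imports Defs "HOL-Number_Theory.Residue_Primitive_Roots"
begin

section \<open>Words in the generators of the modular group\<close>

text \<open>Two facts must be extracted from the concrete matrices. A pair of permutations with s^2
  = t^3 = 1 has to define an action of the matrix group: this holds once no nonempty normal word
  evaluates to plus or minus the identity, which follows from the growth of entries of constant
  sign. And point stabilisers have to be free: a spanning tree of the graph whose vertices are the
  t-orbits yields Schreier generators, and a lift of the action to reduced words shows that they
  satisfy no relation. The coefficients e_k / 72^k are not integers, so 1 / 72 is replaced by an
  inverse \<open>u\<close> of 72 modulo 13^a. Truncation makes E a polynomial whose degree is not
  under control, so factors 1 - r z are found as simple roots r of the reversed polynomial, where a
  one-variable Hensel lemma is enough. The order of r is decided modulo 169 for all a at once: a
  primitive root modulo 13 is one modulo every power of 13 as soon as its 12th power is not 1 modulo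
  169. Modulo 169 only e_0, ..., e_15 survive, so this is a finite computation.\<close>

definition mat2 :: "int \<Rightarrow> int \<Rightarrow> int \<Rightarrow> int \<Rightarrow> int ^ 2 ^ 2" where
  "mat2 a b c d = vector [vector [a, b], vector [c, d]]"

lemma mat2_eq_iff: "mat2 a b c d = mat2 a' b' c' d' \<longleftrightarrow> a = a' \<and> b = b' \<and> c = c' \<and> d = d'"
  by (auto simp: mat2_def vec_eq_iff forall_2)

lemma mat2_mult:
  "mat2 a b c d ** mat2 a' b' c' d' = mat2 (a*a' + b*c') (a*b' + b*d') (c*a' + d*c') (c*b' + d*d')"
  by (simp add: mat2_def vec_eq_iff forall_2 matrix_matrix_mult_def sum_2)

lemma mat_1_eq_mat2: "mat 1 = mat2 1 0 0 1"
  by (simp add: mat2_def vec_eq_iff forall_2 mat_def)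

lemma uminus_mat2: "- mat2 a b c d = mat2 (-a) (-b) (-c) (-d)"
  by (simp add: mat2_def vec_eq_iff forall_2)

lemma det_mat2: "det (mat2 a b c d) = a * d - b * c"
  by (simp add: mat2_def det_2)

lemma mat2_cases:
  obtains a b c d where "A = mat2 a b c d"
proof
  show "A = mat2 (A $ 1 $ 1) (A $ 1 $ 2) (A $ 2 $ 1) (A $ 2 $ 2)"
    by (simp add: mat2_def vec_eq_iff forall_2)
qed

text \<open>In SL(2,Z) both S^2 and U^3 equal minus the identity; the orders 4 and 6 become 2 and 3
  only after passing to the quotient by signs.\<close>

abbreviation matS :: "int ^ 2 ^ 2" where "matS \<equiv> mat2 0 (-1) 1 0"
abbreviation matU :: "int ^ 2 ^ 2" where "matU \<equiv> mat2 0 (-1) 1 1"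

text \<open>In a word, \<^const>\<open>True\<close> stands for the generator of order 2 and \<^const>\<open>False\<close> for the one of order 3.\<close>

definition eval_mat :: "bool list \<Rightarrow> int ^ 2 ^ 2" where
  "eval_mat w = foldr (\<lambda>b A. (if b then matS else matU) ** A) w (mat 1)"

lemma eval_mat_Nil [simp]: "eval_mat [] = mat 1"
  and eval_mat_Cons: "eval_mat (b # w) = (if b then matS else matU) ** eval_mat w"
  by (simp_all add: eval_mat_def)

lemma eval_mat_append: "eval_mat (v @ w) = eval_mat v ** eval_mat w"
  by (induction v) (simp_all add: eval_mat_Cons matrix_mul_assoc)

lemma det_eval_mat: "det (eval_mat w) = 1"
  by (induction w) (simp_all add: eval_mat_Cons det_mul det_mat2)

text \<open>Normal forms of the free product C_2 * C_3. No inverse letters occur: S is its own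
  inverse modulo sign, and the inverse of U is written U U.\<close>

fun normal_word :: "bool list \<Rightarrow> bool" where
  "normal_word (True # True # w) = False"
| "normal_word (False # False # False # w) = False"
| "normal_word (b # w) = normal_word w"
| "normal_word [] = True"

text \<open>
  \<open>S U\<close> and \<open>S U U\<close> are, up to sign, the two elementary matrices with nonnegative entries, so
  multiplying by them from the left keeps the entries of each column of one sign and does not
  decrease the sum of the absolute values (which is 2 for the identity).
\<close>

definition no_mixed_column :: "int ^ 2 ^ 2 \<Rightarrow> bool" where
  "no_mixed_column A \<longleftrightarrow> A $ 1 $ 1 * A $ 2 $ 1 \<ge> 0 \<and> A $ 1 $ 2 * A $ 2 $ 2 \<ge> 0 \<and>
      \<bar>A $ 1 $ 1\<bar> + \<bar>A $ 1 $ 2\<bar> + \<bar>A $ 2 $ 1\<bar> + \<bar>A $ 2 $ 2\<bar> \<ge> 3"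

lemma no_mixed_column_mat2:
  "no_mixed_column (mat2 a b c d) \<longleftrightarrow>
     a * c \<ge> 0 \<and> b * d \<ge> 0 \<and> \<bar>a\<bar> + \<bar>b\<bar> + \<bar>c\<bar> + \<bar>d\<bar> \<ge> 3"
  by (simp add: no_mixed_column_def mat2_def)

lemma no_mixed_column_mult:
  assumes "no_mixed_column A"
  shows "no_mixed_column (matS ** (matU ** A))" "no_mixed_column (matS ** (matU ** (matU ** A)))"
proof -
  obtain a b c d where A: "A = mat2 a b c d"
    by (rule mat2_cases)
  have h: "a * c \<ge> 0" "b * d \<ge> 0" "\<bar>a\<bar> + \<bar>b\<bar> + \<bar>c\<bar> + \<bar>d\<bar> \<ge> 3"
    using assms by (auto simp: A no_mixed_column_mat2)
  have 1: "\<bar>a + c\<bar> = \<bar>a\<bar> + \<bar>c\<bar>" "\<bar>b + d\<bar> = \<bar>b\<bar> + \<bar>d\<bar>"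
    using h by (auto simp: zero_le_mult_iff)
  have 2: "(a + c) * c \<ge> 0" "(b + d) * d \<ge> 0" "a * (a + c) \<ge> 0" "b * (b + d) \<ge> 0"
    using h by (simp_all add: distrib_left distrib_right)
  have "matS ** (matU ** A) = mat2 (- (a + c)) (- (b + d)) (- c) (- d)"
       "matS ** (matU ** (matU ** A)) = mat2 (- a) (- b) (- (a + c)) (- (b + d))"
    by (simp_all add: A mat2_mult mat2_eq_iff)
  then show "no_mixed_column (matS ** (matU ** A))"
       "no_mixed_column (matS ** (matU ** (matU ** A)))"
    using h 1 2 by (simp_all only: no_mixed_column_mat2 abs_minus_cancel minus_mult_minus simp_thms) linarith+
qed

text \<open>A normal word starting with S is a chain of blocks S U and S U U, possibly closed by a
  single S; strong induction strips the first block. The word S alone is excluded because its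
  entries have absolute sum 2 only.\<close>

lemma normal_word_no_mixed_column:
  "normal_word (True # w) \<Longrightarrow> w \<noteq> [] \<Longrightarrow> no_mixed_column (eval_mat (True # w))"
proof (induction w rule: length_induct)
  case (1 w)
  obtain w1 where w1: "w = False # w1"
    using 1(2,3) by (cases w; cases "hd w") auto
  consider "w1 = []" | "w1 = [True]" | w2 where "w1 = True # w2" "w2 \<noteq> []" "normal_word (True # w2)"
    | "w1 = [False]" | "w1 = [False, True]"
    | w3 where "w1 = False # True # w3" "w3 \<noteq> []" "normal_word (True # w3)"
  proof (cases w1)
    case (Cons b w2)
    show ?thesis
    proof (cases b)
      case True
      then show ?thesis using that(2,3) 1(2) w1 Cons by (cases "w2 = []") auto
    next
      case b: False
      show ?thesis
      proof (cases w2)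
        case Nil
        then show ?thesis using that(4) Cons b by simp
      next
        case (Cons c w3)
        then have "c" using 1(2) w1 \<open>w1 = b # w2\<close> b by (cases c) auto
        then show ?thesis using that(5,6) 1(2) w1 \<open>w1 = b # w2\<close> b Cons by (cases "w3 = []") auto
      qed
    qed
  qed (rule that(1))
  then show ?case
  proof cases
    case (3 w2)
    then have "no_mixed_column (eval_mat (True # w2))"
      using 1(1) w1 by auto
    then show ?thesis
      using no_mixed_column_mult(1) by (simp add: w1 3 eval_mat_Cons)
  next
    case (6 w3)
    then have "no_mixed_column (eval_mat (True # w3))"
      using 1(1) w1 by auto
    then show ?thesis
      using no_mixed_column_mult(2) by (simp add: w1 6 eval_mat_Cons)
  qed (simp_all add: w1 no_mixed_column_mat2 eval_mat_Cons mat_1_eq_mat2 mat2_mult)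
qed

text \<open>Otherwise A would be the inverse of B up to sign. For B = 1 its entries have absolute
  sum 2; the inverses of U and U U have a column with entries of opposite signs.\<close>

lemma no_mixed_column_neq:
  assumes "no_mixed_column A" "B \<in> {mat 1, matU, matU ** matU}"
  shows "B ** A \<noteq> mat 1" "B ** A \<noteq> - mat 1"
proof -
  obtain a b c d where A: "A = mat2 a b c d"
    by (rule mat2_cases)
  have h: "a * c \<ge> 0" "b * d \<ge> 0" "\<bar>a\<bar> + \<bar>b\<bar> + \<bar>c\<bar> + \<bar>d\<bar> \<ge> 3"
    using assms by (auto simp: A no_mixed_column_mat2)
  have 1: "\<bar>a + c\<bar> = \<bar>a\<bar> + \<bar>c\<bar>" "\<bar>b + d\<bar> = \<bar>b\<bar> + \<bar>d\<bar>"
    using h by (auto simp: zero_le_mult_iff)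
  consider "B = mat 1" | "B = matU" | "B = matU ** matU" using assms(2) by blast
  then have "B ** A \<noteq> mat 1 \<and> B ** A \<noteq> - mat 1"
    using h(3) 1 by cases (simp_all add: A mat_1_eq_mat2 uminus_mat2 mat2_mult mat2_eq_iff, linarith+)
  then show "B ** A \<noteq> mat 1" "B ** A \<noteq> - mat 1" by blast+
qed

text \<open>A normal word is at most two letters U followed by a normal word that is empty or begins
  with S, and the sign invariant applies to the second part.\<close>

lemma normal_word_eval_mat:
  assumes "normal_word w" "eval_mat w = mat 1 \<or> eval_mat w = - mat 1"
  shows "w = []"
proof (rule ccontr)
  assume "w \<noteq> []"
  have main: False if w: "w = u @ v" and u: "u \<in> {[], [False], [False, False]}"
    and v: "v = [] \<or> v = [True] \<or> (\<exists>v'. v' \<noteq> [] \<and> v = True # v' \<and> normal_word v)" for u v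
  proof -
    have B: "eval_mat u \<in> {mat 1, matU, matU ** matU}"
      using u by (auto simp: eval_mat_Cons)
    show False
    proof (cases "v = [] \<or> v = [True]")
      case True
      then show ?thesis
        using u assms(2) \<open>w \<noteq> []\<close>
        by (auto simp: w eval_mat_Cons mat_1_eq_mat2 mat2_mult uminus_mat2 mat2_eq_iff)
    next
      case False
      then have "no_mixed_column (eval_mat v)"
        using v normal_word_no_mixed_column by blast
      then show ?thesis
        using no_mixed_column_neq[OF _ B, of "eval_mat v"] assms(2) by (auto simp: w eval_mat_append)
    qed
  qed
  have "\<exists>u v. w = u @ v \<and> u \<in> {[], [False], [False, False]} \<and> (v = [] \<or> hd v) \<and> normal_word v"
  proof (cases w)
    case (Cons b w1)
    show ?thesis
    proof (cases b)
      case True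
      then have "w = [] @ w \<and> (w = [] \<or> hd w) \<and> normal_word w"
        using Cons assms by auto
      then show ?thesis by blast
    next
      case b: False
      show ?thesis
      proof (cases "w1 = [] \<or> hd w1")
        case True
        then have "w = [False] @ w1 \<and> (w1 = [] \<or> hd w1) \<and> normal_word w1"
          using Cons b assms by (cases w1; auto)
        then show ?thesis by blast
      next
        case False
        then obtain w2 where w2: "w1 = False # w2" by (cases w1) auto
        then have "w = [False, False] @ w2 \<and> (w2 = [] \<or> hd w2) \<and> normal_word w2"
          using Cons b assms by (cases w2; cases "hd w2"; auto)
        then show ?thesis by blast
      qed
    qed
  qed (use \<open>w \<noteq> []\<close> in simp)
  then obtain u v where uv: "w = u @ v" "u \<in> {[], [False], [False, False]}" "v = [] \<or> hd v"
      "normal_word v" by blast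
  then show False
    by (intro main[of u v]) (cases v; auto)+
qed

section \<open>The modular group as matrices up to sign, generated by S and U\<close>

definition pm :: "int ^ 2 ^ 2 \<Rightarrow> (int ^ 2 ^ 2) set" where
  "pm A = {A, - A}"

lemma pm_eq_iff: "pm A = pm B \<longleftrightarrow> A = B \<or> A = - B"
  by (auto simp: pm_def doubleton_eq_iff)

lemma matrix_mult_minus_int:
  fixes A B :: "int ^ 2 ^ 2"
  shows "A ** (- B) = - (A ** B)" "(- A) ** B = - (A ** B)"
  by (simp_all add: vec_eq_iff forall_2 matrix_matrix_mult_def sum_2)

lemma r_coset_eq_pm: "{mat 1, - mat 1} #>\<^bsub>SL2Z\<^esub> A = pm A"
  by (simp add: r_coset_def SL2Z_def pm_def matrix_mult_minus_int insert_commute)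

lemma carrier_PSL2Z: "carrier PSL2Z = pm ` {A. det A = 1}"
  unfolding PSL2Z_def carrier_FactGroup r_coset_eq_pm by (simp add: SL2Z_def)

lemma one_PSL2Z: "\<one>\<^bsub>PSL2Z\<^esub> = pm (mat 1)"
  by (simp add: PSL2Z_def pm_def)

lemma mult_PSL2Z: "pm A \<otimes>\<^bsub>PSL2Z\<^esub> pm B = pm (A ** B)"
  by (auto simp: PSL2Z_def set_mult_def pm_def SL2Z_def matrix_mult_minus_int)

interpretation PSL2Z: group PSL2Z by (rule group_PSL2Z)

definition word_elem :: "bool list \<Rightarrow> (int ^ 2 ^ 2) set" where
  "word_elem w = pm (eval_mat w)"

lemma word_elem_closed [simp]: "word_elem w \<in> carrier PSL2Z"
  by (auto simp: word_elem_def carrier_PSL2Z det_eval_mat)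

lemma word_elem_append: "word_elem (v @ w) = word_elem v \<otimes>\<^bsub>PSL2Z\<^esub> word_elem w"
  by (simp add: word_elem_def eval_mat_append mult_PSL2Z)

lemma word_elem_Cons: "word_elem (b # w) = word_elem [b] \<otimes>\<^bsub>PSL2Z\<^esub> word_elem w"
  using word_elem_append[of "[b]" w] by simp

lemma word_elem_Nil [simp]: "word_elem [] = \<one>\<^bsub>PSL2Z\<^esub>"
  by (simp add: word_elem_def one_PSL2Z)

lemma word_elem_SS: "word_elem [True, True] = \<one>\<^bsub>PSL2Z\<^esub>"
  by (simp add: word_elem_def one_PSL2Z pm_eq_iff eval_mat_Cons mat_1_eq_mat2 mat2_mult uminus_mat2)

lemma word_elem_UUU: "word_elem [False, False, False] = \<one>\<^bsub>PSL2Z\<^esub>"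
  by (simp add: word_elem_def one_PSL2Z pm_eq_iff eval_mat_Cons mat_1_eq_mat2 mat2_mult uminus_mat2)

lemma word_elem_neq_one: "word_elem [True] \<noteq> \<one>\<^bsub>PSL2Z\<^esub>" "word_elem [False] \<noteq> \<one>\<^bsub>PSL2Z\<^esub>"
  by (simp_all add: word_elem_def one_PSL2Z pm_eq_iff eval_mat_Cons mat_1_eq_mat2 mat2_mult
      uminus_mat2 mat2_eq_iff)

lemma normal_word_elem_eq_one: "normal_word w \<Longrightarrow> word_elem w = \<one>\<^bsub>PSL2Z\<^esub> \<Longrightarrow> w = []"
  using normal_word_eval_mat by (auto simp: word_elem_def one_PSL2Z pm_eq_iff)

lemma pm_mult_in_range:
  assumes "pm A \<in> range word_elem" "pm B \<in> range word_elem"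
  shows "pm (A ** B) \<in> range word_elem"
  using assms by (auto simp flip: mult_PSL2Z word_elem_append)

text \<open>Up to sign, S U is the unit shear and U U S its inverse; induction runs in both
  directions from 0.\<close>

lemma shear_in_range: "pm (mat2 1 k 0 1) \<in> range word_elem"
proof -
  have 1: "pm (mat2 1 1 0 1) = word_elem [True, False]"
    by (simp add: word_elem_def pm_eq_iff eval_mat_Cons mat_1_eq_mat2 mat2_mult uminus_mat2 mat2_eq_iff)
  have 2: "pm (mat2 1 (-1) 0 1) = word_elem [False, False, True]"
    by (simp add: word_elem_def pm_eq_iff eval_mat_Cons mat_1_eq_mat2 mat2_mult uminus_mat2 mat2_eq_iff)
  show ?thesis
  proof (induction k rule: int_induct[where k = 0])
    case base
    have "pm (mat2 1 0 0 1) = word_elem []" by (simp add: word_elem_def mat_1_eq_mat2)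
    then show ?case by (metis rangeI)
  next
    case (step1 i)
    have "mat2 1 (i + 1) 0 1 = mat2 1 i 0 1 ** mat2 1 1 0 1" by (simp add: mat2_mult add.commute)
    then show ?case using pm_mult_in_range step1 1 by (metis rangeI)
  next
    case (step2 i)
    have "mat2 1 (i - 1) 0 1 = mat2 1 i 0 1 ** mat2 1 (-1) 0 1" by (simp add: mat2_mult)
    then show ?case using pm_mult_in_range step2 2 by (metis rangeI)
  qed
qed

text \<open>Euclid's algorithm on the first column: the inverse shear by q = a div c followed by S
  moves a mod c into the lower left corner, until that entry is 0 and a shear remains.\<close>

lemma pm_in_range: "a * d - b * c = 1 \<Longrightarrow> pm (mat2 a b c d) \<in> range word_elem"
proof (induction "nat \<bar>c\<bar>" arbitrary: a b c d rule: less_induct)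
  case less
  show ?case
  proof (cases "c = 0")
    case True
    then have "a = 1 \<and> d = 1 \<or> a = -1 \<and> d = -1"
      using less.prems zmult_eq_1_iff by auto
    then have "pm (mat2 a b c d) = pm (mat2 1 b 0 1) \<or> pm (mat2 a b c d) = pm (mat2 1 (-b) 0 1)"
      using True by (auto simp: pm_eq_iff uminus_mat2 mat2_eq_iff)
    then show ?thesis using shear_in_range by metis
  next
    case False
    define q where "q = a div c"
    have 1: "\<bar>a mod c\<bar> < \<bar>c\<bar>" using False by (simp add: abs_mod_less)
    have 2: "a - q * c = a mod c" by (simp add: q_def minus_div_mult_eq_mod)
    have "pm (mat2 (-c) (-d) (a - q * c) (b - q * d)) \<in> range word_elem"
      using less.prems 1 2 by (intro less.hyps) (auto simp: algebra_simps)
    moreover have "pm matS \<in> range word_elem"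
      by (rule range_eqI[of _ _ "[True]"]) (simp add: word_elem_def eval_mat_Cons)
    ultimately have *: "pm (mat2 1 q 0 1 ** (matS ** mat2 (-c) (-d) (a - q * c) (b - q * d)))
        \<in> range word_elem"
      by (intro pm_mult_in_range shear_in_range)
    have "mat2 1 q 0 1 ** (matS ** mat2 (-c) (-d) (a - q * c) (b - q * d)) = - mat2 a b c d"
      by (simp add: mat2_mult uminus_mat2 mat2_eq_iff algebra_simps)
    then have "pm (mat2 a b c d) =
        pm (mat2 1 q 0 1 ** (matS ** mat2 (-c) (-d) (a - q * c) (b - q * d)))"
      by (simp add: pm_eq_iff)
    with * show ?thesis by simp
  qed
qed

lemma carrier_eq_range_word_elem: "carrier PSL2Z = range word_elem"
proof (intro equalityI subsetI)
  fix g assume "g \<in> carrier PSL2Z"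
  then obtain A where "g = pm A" "det A = 1" by (auto simp: carrier_PSL2Z)
  then show "g \<in> range word_elem"
    by (cases A rule: mat2_cases) (auto simp: det_mat2 intro!: pm_in_range)
qed auto


section \<open>Actions of the modular group\<close>

text \<open>Words are read from left to right, so they act from the right; this fits the action on
  right cosets and explains the order of factors in \<open>act_mult\<close>.\<close>

definition word_act :: "('z \<Rightarrow> 'z) \<Rightarrow> ('z \<Rightarrow> 'z) \<Rightarrow> bool list \<Rightarrow> 'z \<Rightarrow> 'z" where
  "word_act f g = fold (\<lambda>b. if b then f else g)"

lemma word_act_Nil [simp]: "word_act f g [] z = z"
  and word_act_Cons: "word_act f g (b # w) z = word_act f g w (if b then f z else g z)"
  and word_act_append: "word_act f g (v @ w) z = word_act f g w (word_act f g v z)"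
  by (simp_all add: word_act_def)

locale modular_action =
  fixes Z :: "'z set" and f g :: "'z \<Rightarrow> 'z"
  assumes f_closed: "z \<in> Z \<Longrightarrow> f z \<in> Z" and g_closed: "z \<in> Z \<Longrightarrow> g z \<in> Z"
    and f_f: "z \<in> Z \<Longrightarrow> f (f z) = z" and g_g_g: "z \<in> Z \<Longrightarrow> g (g (g z)) = z"
begin

lemma word_act_closed: "z \<in> Z \<Longrightarrow> word_act f g w z \<in> Z"
  by (induction w arbitrary: z) (auto simp: word_act_Cons f_closed g_closed)

text \<open>A letter put in front of a normal word can create only one forbidden block, at the very
  front, and deleting it leaves a normal word. Group element and action are followed together, since
  both satisfy the same two relations.\<close>

lemma normal_word_exists:
  "\<exists>v. normal_word v \<and> word_elem v = word_elem w \<and> (\<forall>z\<in>Z. word_act f g v z = word_act f g w z)"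
proof (induction w)
  case (Cons b w)
  then obtain v where v: "normal_word v" "word_elem v = word_elem w"
      "\<And>z. z \<in> Z \<Longrightarrow> word_act f g v z = word_act f g w z"
    by blast
  have *: "word_elem (b # v) = word_elem (b # w)"
      "\<And>z. z \<in> Z \<Longrightarrow> word_act f g (b # v) z = word_act f g (b # w) z"
    using v f_closed g_closed by (simp_all add: word_elem_Cons[of b v] word_elem_Cons[of b w] word_act_Cons)
  consider v' where "b" "v = True # v'" | v' where "\<not> b" "v = False # False # v'" | "normal_word (b # v)"
    using v(1) by (cases b; cases v; cases "hd v"; cases "tl v"; cases "hd (tl v)"; simp)
  then show ?case
  proof cases
    case (1 v')
    have "word_elem (b # v) = word_elem v'"
      using 1 word_elem_append[of "[True, True]" v'] by (simp add: word_elem_SS)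
    moreover have "normal_word v'" using v(1) 1 by (cases v'; cases "hd v'"; auto)
    moreover have "word_act f g (b # v) z = word_act f g v' z" if "z \<in> Z" for z
      using that 1 by (simp add: word_act_Cons f_f)
    ultimately show ?thesis using * by (intro exI[of _ v']) auto
  next
    case (2 v')
    have "word_elem (b # v) = word_elem v'"
      using 2 word_elem_append[of "[False, False, False]" v'] by (simp add: word_elem_UUU)
    moreover have "normal_word v'" using v(1) 2 by (cases v'; cases "hd v'"; auto)
    moreover have "word_act f g (b # v) z = word_act f g v' z" if "z \<in> Z" for z
      using that 2 by (simp add: word_act_Cons g_g_g)
    ultimately show ?thesis using * by (intro exI[of _ v']) auto
  next
    case 3
    then show ?thesis using * by blast
  qed
qed (rule exI[of _ "[]"], simp)

lemma inverse_word_exists: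
  "\<exists>v. word_elem w \<otimes>\<^bsub>PSL2Z\<^esub> word_elem v = \<one>\<^bsub>PSL2Z\<^esub> \<and>
       (\<forall>z\<in>Z. word_act f g v (word_act f g w z) = z)"
proof (induction w)
  case (Cons b w)
  then obtain v where v: "word_elem w \<otimes>\<^bsub>PSL2Z\<^esub> word_elem v = \<one>\<^bsub>PSL2Z\<^esub>"
      "\<And>z. z \<in> Z \<Longrightarrow> word_act f g v (word_act f g w z) = z" by blast
  define c where "c = (if b then [True] else [False, False])"
  have c: "word_elem [b] \<otimes>\<^bsub>PSL2Z\<^esub> word_elem c = \<one>\<^bsub>PSL2Z\<^esub>"
    by (cases b) (simp_all add: c_def word_elem_SS word_elem_UUU flip: word_elem_append)
  have "word_elem (b # w) \<otimes>\<^bsub>PSL2Z\<^esub> word_elem (v @ c) =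
      word_elem [b] \<otimes>\<^bsub>PSL2Z\<^esub> (word_elem w \<otimes>\<^bsub>PSL2Z\<^esub> word_elem v) \<otimes>\<^bsub>PSL2Z\<^esub> word_elem c"
    by (simp add: word_elem_Cons[of b w] word_elem_append PSL2Z.m_assoc)
  also have "\<dots> = \<one>\<^bsub>PSL2Z\<^esub>" by (simp add: v(1) c)
  finally have "word_elem (b # w) \<otimes>\<^bsub>PSL2Z\<^esub> word_elem (v @ c) = \<one>\<^bsub>PSL2Z\<^esub>" .
  moreover have "word_act f g (v @ c) (word_act f g (b # w) z) = z" if "z \<in> Z" for z
    using that v(2) by (simp add: word_act_append word_act_Cons f_closed g_closed c_def f_f g_g_g)
  ultimately show ?case by blast
qed (rule exI[of _ "[]"], simp)

text \<open>This is the presentation of the group as C_2 * C_3: with \<open>w'\<close> a word for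
  the inverse of \<open>w\<close>, both \<open>w' @ w\<close> and \<open>v @ w'\<close> represent 1,
  and a word representing 1 acts trivially because its normal form is empty.\<close>

theorem word_act_cong:
  assumes "word_elem v = word_elem w" "z \<in> Z"
  shows "word_act f g v z = word_act f g w z"
proof -
  obtain w' where w': "word_elem w \<otimes>\<^bsub>PSL2Z\<^esub> word_elem w' = \<one>\<^bsub>PSL2Z\<^esub>"
      "\<And>z. z \<in> Z \<Longrightarrow> word_act f g w' (word_act f g w z) = z"
    using inverse_word_exists[of w] by blast
  have triv: "word_act f g u y = y" if "word_elem u = \<one>\<^bsub>PSL2Z\<^esub>" "y \<in> Z" for u y
    using normal_word_exists[of u] normal_word_elem_eq_one that by fastforce
  have "word_elem (w' @ w) = \<one>\<^bsub>PSL2Z\<^esub>"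
    using w'(1) by (simp add: word_elem_append PSL2Z.inv_comm)
  then have "word_act f g v z = word_act f g (w' @ w) (word_act f g v z)"
    using triv word_act_closed assms(2) by simp
  also have "\<dots> = word_act f g w (word_act f g (v @ w') z)"
    by (simp add: word_act_append)
  also have "word_act f g (v @ w') z = z"
    using triv w'(1) assms by (simp add: word_elem_append)
  finally show ?thesis .
qed

definition act :: "(int ^ 2 ^ 2) set \<Rightarrow> 'z \<Rightarrow> 'z" where
  "act x = word_act f g (SOME w. word_elem w = x)"

lemma act_word_elem: "z \<in> Z \<Longrightarrow> act (word_elem w) z = word_act f g w z"
  unfolding act_def by (rule word_act_cong) (rule someI, auto)

lemma act_S: "z \<in> Z \<Longrightarrow> act (word_elem [True]) z = f z"
  and act_U: "z \<in> Z \<Longrightarrow> act (word_elem [False]) z = g z"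
  and act_one: "z \<in> Z \<Longrightarrow> act \<one>\<^bsub>PSL2Z\<^esub> z = z"
  using act_word_elem[of z "[]"] by (simp_all add: act_word_elem word_act_Cons)

lemma act_closed: "x \<in> carrier PSL2Z \<Longrightarrow> z \<in> Z \<Longrightarrow> act x z \<in> Z"
  unfolding carrier_eq_range_word_elem by (auto simp: act_word_elem word_act_closed)

lemma act_mult:
  assumes "x \<in> carrier PSL2Z" "y \<in> carrier PSL2Z" "z \<in> Z"
  shows "act (x \<otimes>\<^bsub>PSL2Z\<^esub> y) z = act y (act x z)"
  using assms unfolding carrier_eq_range_word_elem
  by (auto simp: act_word_elem word_act_closed word_act_append simp flip: word_elem_append)

lemma act_inv:
  assumes "x \<in> carrier PSL2Z" "y \<in> Z" "z \<in> Z" "act x y = z"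
  shows "act (inv\<^bsub>PSL2Z\<^esub> x) z = y"
  using assms act_mult[of x "inv\<^bsub>PSL2Z\<^esub> x" y] by (simp add: act_one)

end

section \<open>Free groups are torsion-free\<close>

abbreviation noncancelling :: "'a \<times> bool \<Rightarrow> 'a \<times> bool \<Rightarrow> bool" where
  "noncancelling \<equiv> \<lambda>(x, d) (y, e). \<not> (x = y \<and> d \<noteq> e)"

lemma eval_word_Nil [simp]: "eval_word G [] = \<one>\<^bsub>G\<^esub>"
  and eval_word_Cons:
    "eval_word G (l # w) = (if snd l then fst l else inv\<^bsub>G\<^esub> (fst l)) \<otimes>\<^bsub>G\<^esub> eval_word G w"
  by (simp_all add: eval_word_def case_prod_beta)

context group
begin

lemma eval_word_closed: "fst ` set w \<subseteq> carrier G \<Longrightarrow> eval_word G w \<in> carrier G"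
  by (induction w) (auto simp: eval_word_Cons)

lemma eval_word_append:
  "fst ` set v \<subseteq> carrier G \<Longrightarrow> fst ` set w \<subseteq> carrier G \<Longrightarrow>
   eval_word G (v @ w) = eval_word G v \<otimes> eval_word G w"
  by (induction v) (auto simp: eval_word_Cons eval_word_closed m_assoc)

lemma eval_word_concat_replicate:
  "fst ` set w \<subseteq> carrier G \<Longrightarrow>
    eval_word G (concat (replicate k w)) = eval_word G w [^] k"
proof (induction k)
  case (Suc k)
  have "fst ` set (concat (replicate k w)) \<subseteq> carrier G"
    using Suc.prems by (force split: if_splits)
  then show ?case
    using Suc by (subst nat_pow_Suc2) (simp_all add: eval_word_append eval_word_closed)
qed simp

lemma conj_nat_pow:
  "c \<in> carrier G \<Longrightarrow> x \<in> carrier G \<Longrightarrow> (c \<otimes> x \<otimes> inv c) [^] (k::nat) = c \<otimes> (x [^] k) \<otimes> inv c"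
proof (induction k)
  case (Suc k)
  have "c \<otimes> (x [^] k) \<otimes> inv c \<otimes> (c \<otimes> x \<otimes> inv c) = c \<otimes> (x [^] k) \<otimes> ((inv c \<otimes> c) \<otimes> (x \<otimes> inv c))"
    using Suc.prems by (simp only: m_assoc m_closed inv_closed nat_pow_closed)
  then show ?case using Suc by (simp add: m_assoc)
qed simp

text \<open>
  A shortest reduced word among the conjugates of \<open>x\<close> is cyclically reduced, so all its powers are
  reduced.
\<close>
lemma free_group_torsion_free:
  assumes free: "is_free_group G" and x: "x \<in> carrier G" "x [^] k = \<one>" and k: "k > (0::nat)"
  shows "x = \<one>"
proof -
  obtain B where B: "B \<subseteq> carrier G" "bij_betw (eval_word G) (reduced_words B) (carrier G)"
    using free by (auto simp: is_free_group_def)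
  define C where "C w \<longleftrightarrow> w \<in> reduced_words B \<and> (\<exists>c\<in>carrier G. eval_word G w = c \<otimes> x \<otimes> inv c)" for w
  have "\<exists>w. C w"
  proof -
    have "x \<in> eval_word G ` reduced_words B" using B(2) x(1) by (simp add: bij_betw_def)
    then show ?thesis unfolding C_def using x(1) by (auto intro!: bexI[of _ \<one>])
  qed
  then obtain w where w: "C w" and min: "\<And>v. C v \<Longrightarrow> length w \<le> length v"
    using ex_has_least_nat[of C _ length] by blast
  obtain c where c: "c \<in> carrier G" "eval_word G w = c \<otimes> x \<otimes> inv c"
    using w by (auto simp: C_def)
  have wB: "fst ` set w \<subseteq> B" "successively noncancelling w"
    using w by (auto simp: C_def reduced_words_def)
  have "w = []"
  proof (rule ccontr)
    assume "w \<noteq> []"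
    \<comment> \<open>If the last letter cancelled the first, conjugation by the first letter would
      give the shorter reduced word \<open>w2\<close> for another conjugate of
      \<open>x\<close>.\<close>
    have cyc: "noncancelling (last w) (hd w)"
    proof (rule ccontr)
      assume canc: "\<not> noncancelling (last w) (hd w)"
      obtain y e w1 where w1: "w = (y, e) # w1" using \<open>w \<noteq> []\<close> by (cases w) auto
      have "w1 \<noteq> []" using canc w1 by auto
      then obtain w2 l where w2: "w1 = w2 @ [l]" by (cases w1 rule: rev_cases) auto
      have l: "l = (y, \<not> e)" using canc w1 w2 by (cases l) auto
      have y: "y \<in> carrier G" and w2G: "fst ` set w2 \<subseteq> carrier G"
        using wB(1) B(1) w1 w2 by auto
      define z where "z = (if e then y else inv y)"
      have z: "z \<in> carrier G" using y by (simp add: z_def)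
      have "eval_word G w = z \<otimes> eval_word G w2 \<otimes> inv z"
        using y w2G by (simp add: w1 w2 l eval_word_Cons eval_word_append eval_word_closed m_assoc z_def)
      then have "eval_word G w2 = inv z \<otimes> eval_word G w \<otimes> inv (inv z)"
        using z eval_word_closed[OF w2G] by (simp add: m_assoc inv_solve_left inv_solve_right)
      also have "\<dots> = (inv z \<otimes> c) \<otimes> x \<otimes> inv (inv z \<otimes> c)"
        using z c x(1) by (simp add: inv_mult_group m_assoc)
      finally have "C w2"
        unfolding C_def using wB z c
        by (auto simp: w1 w2 reduced_words_def successively_Cons successively_append_iff)
      then show False using min[of w2] w1 w2 by simp
    qed
    have "concat (replicate n w) \<in> reduced_words B" for n
    proof (induction n)
      case (Suc n)
      have "concat (replicate n w) = [] \<or> hd (concat (replicate n w)) = hd w"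
        using \<open>w \<noteq> []\<close> by (cases n) auto
      then have "successively noncancelling (concat (replicate (Suc n) w))"
        using Suc wB(2) cyc by (auto simp: reduced_words_def successively_append_iff)
      moreover have "fst ` set (concat (replicate (Suc n) w)) \<subseteq> B"
        using wB(1) by (force split: if_splits)
      ultimately show ?case by (simp only: reduced_words_def mem_Collect_eq simp_thms)
    qed (simp add: reduced_words_def)
    moreover have "[] \<in> reduced_words B" by (simp add: reduced_words_def)
    moreover have "eval_word G (concat (replicate k w)) = eval_word G []"
      using wB(1) B(1) c x by (subst eval_word_concat_replicate) (auto simp: conj_nat_pow)
    ultimately have "concat (replicate k w) = []"
      using B(2) unfolding bij_betw_def by (meson inj_onD)
    then show False using \<open>w \<noteq> []\<close> k by (cases k) auto
  qed
  then have "c \<otimes> x \<otimes> inv c = \<one>"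
    using c(2) by simp
  then have "c \<otimes> x = \<one> \<otimes> c"
    using c(1) x(1) inv_solve_right'[of "\<one>" "c \<otimes> x" c] by simp
  then have "c \<otimes> x = c \<otimes> \<one>"
    using c(1) by simp
  then show ?thesis
    using c(1) x(1) by (metis Units_eq Units_l_cancel one_closed)
qed

end


section \<open>Point stabilisers of fixed-point free actions are free\<close>

text \<open>For n prime, all cycles on X have length n. The exception for n = 1 makes the identity
  the only element, so that pairs with second exponent 1 are single permutations and the orbit
  decomposition of pairs counts those as well.\<close>

definition fpf_perms :: "nat \<Rightarrow> 'a set \<Rightarrow> ('a \<Rightarrow> 'a) set" where
  "fpf_perms n X = {p. p permutes X \<and> (\<forall>x\<in>X. (p ^^ n) x = x \<and> (n \<noteq> 1 \<longrightarrow> p x \<noteq> x))}"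

text \<open>Steps by t are always allowed, steps by s only along tree edges. The induction rule is
  induction along the tree, which is how \<open>act_p\<close> is proved.\<close>

inductive_set reach :: "('x \<Rightarrow> 'x) \<Rightarrow> ('x \<Rightarrow> 'x) \<Rightarrow> 'x \<Rightarrow> 'x set \<Rightarrow> 'x set"
  for s t x0 T
  where
    reach_base: "x0 \<in> reach s t x0 T"
  | reach_t: "x \<in> reach s t x0 T \<Longrightarrow> t x \<in> reach s t x0 T"
  | reach_s: "x \<in> reach s t x0 T \<Longrightarrow> x \<in> T \<Longrightarrow> s x \<in> reach s t x0 T"

lemma reach_mono:
  assumes "T \<subseteq> T'"
  shows "reach s t x0 T \<subseteq> reach s t x0 T'"
proof
  fix x assume "x \<in> reach s t x0 T"
  then show "x \<in> reach s t x0 T'"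
    by induction (use assms in \<open>auto intro: reach.intros\<close>)
qed

locale transitive_pair =
  fixes K :: "'x :: linorder set" and s t :: "'x \<Rightarrow> 'x" and x0 :: 'x
  assumes finite_K: "finite K" and x0: "x0 \<in> K"
    and s: "s \<in> fpf_perms 2 K" and t: "t \<in> fpf_perms 3 K"
    and transitive: "x \<in> K \<Longrightarrow> \<exists>w. word_act s t w x0 = x"
begin

lemma s_closed: "x \<in> K \<Longrightarrow> s x \<in> K" and s_s: "x \<in> K \<Longrightarrow> s (s x) = x"
  and s_neq: "x \<in> K \<Longrightarrow> s x \<noteq> x"
  using s by (auto simp: fpf_perms_def permutes_in_image eval_nat_numeral)

lemma t_closed: "x \<in> K \<Longrightarrow> t x \<in> K" and t_t_t: "x \<in> K \<Longrightarrow> t (t (t x)) = x"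
  and t_neq: "x \<in> K \<Longrightarrow> t x \<noteq> x"
  using t by (auto simp: fpf_perms_def permutes_in_image eval_nat_numeral)

lemma t_t_neq: "x \<in> K \<Longrightarrow> t (t x) \<noteq> x"
  using t_t_t t_neq by metis

sublocale modular_action K s t
  by standard (auto simp: s_closed t_closed s_s t_t_t)

definition stab :: "(int ^ 2 ^ 2) set set" where
  "stab = {g \<in> carrier PSL2Z. act g x0 = x0}"

lemma subgroup_stab: "subgroup stab PSL2Z"
  by (rule PSL2Z.subgroupI) (auto simp: stab_def act_one act_mult act_inv x0 intro!: exI[of _ "\<one>\<^bsub>PSL2Z\<^esub>"])

text \<open>
  The graph has the orbits of \<open>t\<close> as vertices and the pairs \<open>{x, s x}\<close> as edges.  \<open>T\<close> is the set of
  points whose edge belongs to the tree, \<open>Y\<close> the union of the vertices reached so far, and \<open>p x\<close>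
  the element of the group that leads from \<open>x0\<close> to \<open>x\<close> inside the tree.
\<close>

definition partial_tree :: "'x set \<Rightarrow> 'x set \<Rightarrow> ('x \<Rightarrow> (int ^ 2 ^ 2) set) \<Rightarrow> bool" where
  "partial_tree Y T p \<longleftrightarrow> x0 \<in> Y \<and> Y \<subseteq> K \<and> t ` Y \<subseteq> Y \<and> T \<subseteq> Y \<and> s ` T \<subseteq> T \<and>
     p x0 = \<one>\<^bsub>PSL2Z\<^esub> \<and> p ` Y \<subseteq> carrier PSL2Z \<and>
     (\<forall>x\<in>Y. p (t x) = p x \<otimes>\<^bsub>PSL2Z\<^esub> word_elem [False]) \<and>
     (\<forall>x\<in>T. p (s x) = p x \<otimes>\<^bsub>PSL2Z\<^esub> word_elem [True]) \<and> Y \<subseteq> reach s t x0 T"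

lemma U_U_U: "x \<in> carrier PSL2Z \<Longrightarrow>
    x \<otimes>\<^bsub>PSL2Z\<^esub> word_elem [False] \<otimes>\<^bsub>PSL2Z\<^esub> word_elem [False] \<otimes>\<^bsub>PSL2Z\<^esub> word_elem [False] = x"
  using word_elem_UUU by (simp add: PSL2Z.m_assoc flip: word_elem_append)

lemma S_S: "x \<in> carrier PSL2Z \<Longrightarrow>
    x \<otimes>\<^bsub>PSL2Z\<^esub> word_elem [True] \<otimes>\<^bsub>PSL2Z\<^esub> word_elem [True] = x"
  using word_elem_SS by (simp add: PSL2Z.m_assoc flip: word_elem_append)

lemma partial_tree_start: "\<exists>Y T p. partial_tree Y T p"
proof -
  define p where "p x = (if x = x0 then \<one>\<^bsub>PSL2Z\<^esub> else if x = t x0 then word_elem [False]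
     else word_elem [False] \<otimes>\<^bsub>PSL2Z\<^esub> word_elem [False])" for x
  have "partial_tree {x0, t x0, t (t x0)} {} p"
    using x0 t_closed[OF x0] t_closed[OF t_closed[OF x0]] t_t_t[OF x0] t_neq[OF x0]
      t_neq[OF t_closed[OF x0]] t_t_neq[OF x0] U_U_U[OF PSL2Z.one_closed]
    by (auto simp: partial_tree_def p_def intro: reach.intros)
  then show ?thesis by blast
qed

text \<open>Y is closed under t; if it were also closed under s, transitivity would make it all of
  K. So some edge leaves Y, and the whole t-orbit of its far end, which is disjoint from Y because t
  has order 3, is added as a new vertex.\<close>

lemma partial_tree_extend:
  assumes tree: "partial_tree Y T p" and Y: "Y \<noteq> K"
  shows "\<exists>Y' T' p'. partial_tree Y' T' p' \<and> card Y < card Y'"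
proof -
  have h: "x0 \<in> Y" "Y \<subseteq> K" "\<And>x. x \<in> Y \<Longrightarrow> t x \<in> Y" "T \<subseteq> Y" "\<And>x. x \<in> T \<Longrightarrow> s x \<in> T"
     "p x0 = \<one>\<^bsub>PSL2Z\<^esub>" "\<And>x. x \<in> Y \<Longrightarrow> p x \<in> carrier PSL2Z"
     "\<And>x. x \<in> Y \<Longrightarrow> p (t x) = p x \<otimes>\<^bsub>PSL2Z\<^esub> word_elem [False]"
     "\<And>x. x \<in> T \<Longrightarrow> p (s x) = p x \<otimes>\<^bsub>PSL2Z\<^esub> word_elem [True]" "Y \<subseteq> reach s t x0 T"
    using tree by (auto simp: partial_tree_def)
  have "\<exists>y\<in>Y. s y \<notin> Y"
  proof (rule ccontr)
    assume *: "\<not> (\<exists>y\<in>Y. s y \<notin> Y)"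
    have "word_act s t w y \<in> Y" if "y \<in> Y" for w y
      using that by (induction w arbitrary: y) (use * h(3) in \<open>auto simp: word_act_Cons\<close>)
    then have "K \<subseteq> Y" using transitive h(1) by blast
    then show False using Y h(2) by blast
  qed
  then obtain y where y: "y \<in> Y" "s y \<notin> Y" by blast
  define z where "z = s y"
  have yK: "y \<in> K" using y h(2) by blast
  then have zK: "z \<in> K" by (simp add: z_def s_closed)
  have sz: "s z = y" using yK by (simp add: z_def s_s)
  have tz: "t z \<notin> Y" using h(3)[OF h(3), of "t z"] y(2) t_t_t[OF zK] z_def by metis
  have ttz: "t (t z) \<notin> Y" using h(3)[of "t (t z)"] y(2) t_t_t[OF zK] z_def by metis
  note dist = t_neq[OF zK] t_neq[OF t_closed[OF zK]] t_t_neq[OF zK]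
  define p' where "p' x = (if x \<in> Y then p x else if x = z then p y \<otimes>\<^bsub>PSL2Z\<^esub> word_elem [True]
     else if x = t z then p y \<otimes>\<^bsub>PSL2Z\<^esub> word_elem [True] \<otimes>\<^bsub>PSL2Z\<^esub> word_elem [False]
     else p y \<otimes>\<^bsub>PSL2Z\<^esub> word_elem [True] \<otimes>\<^bsub>PSL2Z\<^esub> word_elem [False] \<otimes>\<^bsub>PSL2Z\<^esub> word_elem [False])" for x
  define Y' where "Y' = Y \<union> {z, t z, t (t z)}"
  define T' where "T' = T \<union> {y, z}"
  have p'Y: "p' x = p x" if "x \<in> Y" for x using that by (simp add: p'_def)
  have p'z: "p' z = p y \<otimes>\<^bsub>PSL2Z\<^esub> word_elem [True]"
    "p' (t z) = p y \<otimes>\<^bsub>PSL2Z\<^esub> word_elem [True] \<otimes>\<^bsub>PSL2Z\<^esub> word_elem [False]"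
    "p' (t (t z)) = p y \<otimes>\<^bsub>PSL2Z\<^esub> word_elem [True] \<otimes>\<^bsub>PSL2Z\<^esub> word_elem [False] \<otimes>\<^bsub>PSL2Z\<^esub> word_elem [False]"
    using y(2) tz ttz dist by (auto simp: p'_def z_def)
  have py: "p y \<in> carrier PSL2Z" using h(7) y(1) by blast
  have "reach s t x0 T \<subseteq> reach s t x0 T'" by (rule reach_mono) (auto simp: T'_def)
  then have r: "Y \<subseteq> reach s t x0 T'" using h(10) by blast
  have rz: "z \<in> reach s t x0 T'"
    unfolding z_def by (rule reach_s) (use r y(1) in \<open>auto simp: T'_def\<close>)
  have "partial_tree Y' T' p'"
    unfolding partial_tree_def
  proof (intro conjI ballI)
    show "Y' \<subseteq> K" using h(2) zK t_closed by (auto simp: Y'_def)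
    show "t ` Y' \<subseteq> Y'" using h(3) t_t_t[OF zK] by (auto simp: Y'_def)
    show "T' \<subseteq> Y'" using h(4) y(1) by (auto simp: T'_def Y'_def)
    show "s ` T' \<subseteq> T'" using h(5) sz by (auto simp: T'_def z_def)
    show "p' ` Y' \<subseteq> carrier PSL2Z" using h(7) p'Y p'z py by (auto simp: Y'_def)
    show "Y' \<subseteq> reach s t x0 T'" using r rz by (auto simp: Y'_def intro: reach_t)
    show "p' (t x) = p' x \<otimes>\<^bsub>PSL2Z\<^esub> word_elem [False]" if "x \<in> Y'" for x
      using that h(3,8) p'Y p'z t_t_t[OF zK] U_U_U py by (auto simp: Y'_def)
    show "p' (s x) = p' x \<otimes>\<^bsub>PSL2Z\<^esub> word_elem [True]" if "x \<in> T'" for x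
    proof -
      consider "x \<in> T" | "x = y" | "x = z" using \<open>x \<in> T'\<close> by (auto simp: T'_def)
      then show ?thesis
      proof cases
        case 1
        then have "x \<in> Y" "s x \<in> Y" using h(4,5) by auto
        then show ?thesis using 1 h(9) p'Y by simp
      next
        case 2
        then show ?thesis using p'Y[OF y(1)] p'z(1) by (simp add: z_def)
      next
        case 3
        then show ?thesis using p'Y[OF y(1)] p'z(1) sz S_S[OF py] by simp
      qed
    qed
  qed (use h(1,6) p'Y in \<open>auto simp: Y'_def\<close>)
  moreover have "card Y < card Y'"
    using finite_K h(2) y(2) by (intro psubset_card_mono) (auto simp: Y'_def z_def intro: finite_subset)
  ultimately show ?thesis by blast
qed

lemma spanning_tree_exists: "\<exists>T p. partial_tree K T p"
proof -
  define tree where "tree Y \<longleftrightarrow> (\<exists>T p. partial_tree Y T p)" for Y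
  obtain Y0 where "tree Y0"
    using partial_tree_start by (auto simp: tree_def)
  moreover have "\<forall>Y. tree Y \<longrightarrow> card Y < Suc (card K)"
    using finite_K by (auto simp: tree_def partial_tree_def less_Suc_eq_le intro: card_mono)
  ultimately obtain Y where Y: "tree Y" and max: "\<And>Y'. tree Y' \<Longrightarrow> card Y' \<le> card Y"
    using ex_has_greatest_nat[of tree Y0 card "Suc (card K)"] by blast
  have "Y = K"
  proof (rule ccontr)
    assume "Y \<noteq> K"
    then obtain Y' where "tree Y'" "card Y < card Y'"
      using Y partial_tree_extend unfolding tree_def by meson
    then show False using max[of Y'] by simp
  qed
  then show ?thesis using Y by (simp add: tree_def)
qed

end

section \<open>Free reduction of words\<close>

definition cons_reduce :: "'a \<times> bool \<Rightarrow> ('a \<times> bool) list \<Rightarrow> ('a \<times> bool) list" where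
  "cons_reduce l w = (if w \<noteq> [] \<and> \<not> noncancelling l (hd w) then tl w else l # w)"

lemma reduced_words_Nil [simp]: "[] \<in> reduced_words E"
  by (simp add: reduced_words_def)

lemma reduced_words_Cons:
  "l # w \<in> reduced_words E \<longleftrightarrow>
     fst l \<in> E \<and> w \<in> reduced_words E \<and> (w = [] \<or> noncancelling l (hd w))"
  by (auto simp: reduced_words_def successively_Cons)

lemma reduced_words_append:
  "v @ w \<in> reduced_words E \<Longrightarrow> v \<in> reduced_words E \<and> w \<in> reduced_words E"
  by (auto simp: reduced_words_def successively_append_iff)

lemma reduced_words_rev: "rev w \<in> reduced_words E \<longleftrightarrow> w \<in> reduced_words E"
proof -
  have "(\<lambda>x y. noncancelling y x) = (noncancelling :: 'a \<times> bool \<Rightarrow> _)"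
    by (intro ext) auto
  then show ?thesis by (simp only: reduced_words_def successively_rev mem_Collect_eq set_rev)
qed

lemma cons_reduce_closed:
  "fst l \<in> E \<Longrightarrow> w \<in> reduced_words E \<Longrightarrow> cons_reduce l w \<in> reduced_words E"
  by (cases w) (simp_all add: cons_reduce_def reduced_words_Cons)

text \<open>\<open>cons_reduce\<close> is left multiplication by a letter in the free group, carried
  out on reduced words. That a letter and its inverse undo each other makes it a permutation of the
  reduced words, as in van der Waerden's construction of free groups.\<close>

lemma cons_reduce_cancel:
  assumes "w \<in> reduced_words E"
  shows "cons_reduce (x, \<not> e) (cons_reduce (x, e) w) = w"
proof (cases w)
  case (Cons l v)
  show ?thesis
  proof (cases "v = []")
    case True
    then show ?thesis using Cons by (cases l) (auto simp: cons_reduce_def)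
  next
    case False
    then show ?thesis using Cons assms by (cases l; cases "hd v") (auto simp: cons_reduce_def reduced_words_Cons)
  qed
qed (simp add: cons_reduce_def)

text \<open>When nothing cancels, the word can be read off from its effect. It comes out reversed
  because folding pushes the first letter first, in accordance with the right action.\<close>

lemma fold_cons_reduce:
  "rev w @ v \<in> reduced_words E \<Longrightarrow> fold cons_reduce w v = rev w @ v"
proof (induction w arbitrary: v)
  case (Cons l w)
  then have "l # v \<in> reduced_words E"
    using reduced_words_append[of "rev w"] by auto
  then have "cons_reduce l v = l # v"
    by (auto simp: reduced_words_Cons cons_reduce_def)
  then show ?case using Cons by simp
qed simp

section \<open>Schreier generators of the stabiliser\<close>

locale spanning_tree = transitive_pair +
  fixes T :: "'a set" and p :: "'a \<Rightarrow> (int ^ 2 ^ 2) set"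
  assumes tree: "partial_tree K T p"
begin

lemma T_subset: "T \<subseteq> K" and s_T: "x \<in> T \<Longrightarrow> s x \<in> T"
  and p_x0: "p x0 = \<one>\<^bsub>PSL2Z\<^esub>" and p_closed: "x \<in> K \<Longrightarrow> p x \<in> carrier PSL2Z"
  and p_t: "x \<in> K \<Longrightarrow> p (t x) = p x \<otimes>\<^bsub>PSL2Z\<^esub> word_elem [False]"
  and p_s: "x \<in> T \<Longrightarrow> p (s x) = p x \<otimes>\<^bsub>PSL2Z\<^esub> word_elem [True]"
  and reach: "x \<in> K \<Longrightarrow> x \<in> reach s t x0 T"
  using tree by (auto simp: partial_tree_def)

text \<open>Formulated for an arbitrary action and a map \<open>h\<close> compatible with t and with
  the tree edges, so that it serves twice: for the action on K itself, and for the lifted action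
  with \<open>h\<close> pairing a point with a fixed word.\<close>

lemma act_p:
  assumes "modular_action Z f g" and Z: "\<And>y. y \<in> K \<Longrightarrow> h y \<in> Z"
    and t: "\<And>y. y \<in> K \<Longrightarrow> g (h y) = h (t y)" and s: "\<And>y. y \<in> T \<Longrightarrow> f (h y) = h (s y)"
    and x: "x \<in> K"
  shows "modular_action.act f g (p x) (h x0) = h x"
proof -
  interpret A: modular_action Z f g by fact
  have "x \<in> K \<and> A.act (p x) (h x0) = h x"
    using reach[OF x]
  proof induction
    case reach_base
    then show ?case using x0 Z by (simp add: p_x0 A.act_one)
  next
    case (reach_t x)
    then show ?case using x0 Z t by (simp add: t_closed p_t p_closed A.act_mult A.act_U)
  next
    case (reach_s x)
    then show ?case using x0 Z s by (simp add: s_closed p_s p_closed A.act_mult A.act_S)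
  qed
  then show ?thesis by blast
qed

lemma act_p_x0: "x \<in> K \<Longrightarrow> act (p x) x0 = x"
  using act_p[of K s t id] modular_action_axioms by simp

text \<open>The linear order only serves to select one end of each edge outside the tree; the other
  end gives the inverse generator, by \<open>gen_s\<close>.\<close>

definition edges :: "'a set" where
  "edges = {x \<in> K - T. x < s x}"

lemma edge_cases:
  assumes "x \<in> K"
  obtains "x \<in> T" "x \<notin> edges" "s x \<in> T" "s x \<notin> edges"
    | "x \<in> edges" "x \<notin> T" "s x \<notin> edges" "s x \<notin> T"
    | "s x \<in> edges" "x \<notin> edges" "x \<notin> T" "s x \<notin> T"
  using assms s_neq[OF assms] s_closed[OF assms] s_s[OF assms] s_T[of x] s_T[of "s x"]
  by (cases "x \<in> T"; cases x "s x" rule: linorder_cases)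
     (auto simp: edges_def dest: order.asym)

text \<open>The Schreier generator: go through the tree from x0 to x, cross the edge to
  \<open>s x\<close>, return through the tree. It is trivial for tree edges.\<close>

definition gen :: "'a \<Rightarrow> (int ^ 2 ^ 2) set" where
  "gen x = p x \<otimes>\<^bsub>PSL2Z\<^esub> word_elem [True] \<otimes>\<^bsub>PSL2Z\<^esub> inv\<^bsub>PSL2Z\<^esub> (p (s x))"

lemma gen_closed: "x \<in> K \<Longrightarrow> gen x \<in> carrier PSL2Z"
  by (simp add: gen_def p_closed s_closed)

lemma gen_stab: "x \<in> K \<Longrightarrow> gen x \<in> stab"
  using act_inv[OF _ _ _ act_p_x0[of "s x"]]
  by (simp add: stab_def gen_closed)
     (simp add: gen_def act_mult act_S p_closed s_closed x0 act_p_x0)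

lemma gen_s: "x \<in> K \<Longrightarrow> gen (s x) = inv\<^bsub>PSL2Z\<^esub> (gen x)"
proof -
  assume x: "x \<in> K"
  have "word_elem [True] \<otimes>\<^bsub>PSL2Z\<^esub> word_elem [True] = \<one>\<^bsub>PSL2Z\<^esub>"
    by (simp add: word_elem_SS flip: word_elem_append)
  then have "inv\<^bsub>PSL2Z\<^esub> (word_elem [True]) = word_elem [True]"
    by (simp add: PSL2Z.inv_equality)
  then show ?thesis
    using x by (simp add: gen_def p_closed s_closed s_s PSL2Z.inv_mult_group PSL2Z.m_assoc)
qed

lemma gen_T: "x \<in> T \<Longrightarrow> gen x = \<one>\<^bsub>PSL2Z\<^esub>"
  using T_subset by (auto simp: gen_def p_closed p_s s_closed simp flip: p_s)

definition eval_gen :: "('a \<times> bool) list \<Rightarrow> (int ^ 2 ^ 2) set" where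
  "eval_gen w = eval_word PSL2Z (map (apfst gen) w)"

lemma eval_gen_Nil [simp]: "eval_gen [] = \<one>\<^bsub>PSL2Z\<^esub>"
  and eval_gen_Cons: "eval_gen ((x, e) # w) =
     (if e then gen x else inv\<^bsub>PSL2Z\<^esub> (gen x)) \<otimes>\<^bsub>PSL2Z\<^esub> eval_gen w"
  by (simp_all add: eval_gen_def eval_word_Cons)

lemma edges_subset: "edges \<subseteq> K"
  by (auto simp: edges_def)

lemma eval_gen_closed: "fst ` set w \<subseteq> K \<Longrightarrow> eval_gen w \<in> carrier PSL2Z"
  unfolding eval_gen_def using gen_closed by (intro PSL2Z.eval_word_closed) auto

text \<open>Whatever the position of x, \<open>gen x\<close> is 1, a generator or the inverse of
  one, and multiplying by a letter is evaluating the word changed by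
  \<open>cons_reduce\<close>.\<close>

lemma gen_mult_eval_gen:
  assumes x: "x \<in> K" and w: "w \<in> reduced_words edges"
  shows "gen x \<otimes>\<^bsub>PSL2Z\<^esub> eval_gen w \<in> eval_gen ` reduced_words edges"
proof -
  have wK: "fst ` set w \<subseteq> K" using w edges_subset by (auto simp: reduced_words_def)
  have main: "eval_gen [(y, e)] \<otimes>\<^bsub>PSL2Z\<^esub> eval_gen w \<in> eval_gen ` reduced_words edges"
    if y: "y \<in> edges" for y e
  proof -
    have yK: "y \<in> K" using y edges_subset by blast
    have "eval_gen [(y, e)] \<otimes>\<^bsub>PSL2Z\<^esub> eval_gen w = eval_gen (cons_reduce (y, e) w)"
    proof (cases "w \<noteq> [] \<and> \<not> noncancelling (y, e) (hd w)")
      case True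
      then obtain v where v: "w = (y, \<not> e) # v" by (cases w) auto
      have "eval_gen v \<in> carrier PSL2Z" using wK v by (intro eval_gen_closed) auto
      then show ?thesis
        using True gen_closed[OF yK] v
        by (simp add: cons_reduce_def eval_gen_Cons PSL2Z.inv_solve_left flip: PSL2Z.m_assoc)
    next
      case False
      then show ?thesis
        using gen_closed[OF yK] eval_gen_closed[OF wK]
        by (auto simp: cons_reduce_def eval_gen_Cons)
    qed
    then show ?thesis using cons_reduce_closed[of "(y, e)" edges w] y w by simp
  qed
  show ?thesis
  proof (rule edge_cases[OF x])
    assume "x \<in> T"
    then show ?thesis using gen_T eval_gen_closed[OF wK] w by simp
  next
    assume "x \<in> edges"
    then show ?thesis using main[of x True] gen_closed[OF x] by (simp add: eval_gen_Cons)
  next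
    assume "s x \<in> edges"
    moreover have "inv\<^bsub>PSL2Z\<^esub> (gen (s x)) = gen x"
      using x by (simp add: gen_s gen_closed)
    ultimately show ?thesis using main[of "s x" False] gen_closed[OF x] by (simp add: eval_gen_Cons)
  qed
qed

text \<open>Reidemeister-Schreier rewriting. The path prescribed by w is cut into its steps: a step
  by t contributes nothing since p is multiplicative along t, a step by s from x contributes
  \<open>gen x\<close>. For x = x0 and a closed path the conjugating factors are 1.\<close>

lemma word_in_image:
  "x \<in> K \<Longrightarrow> p x \<otimes>\<^bsub>PSL2Z\<^esub> word_elem w \<otimes>\<^bsub>PSL2Z\<^esub> inv\<^bsub>PSL2Z\<^esub> (p (word_act s t w x))
     \<in> eval_gen ` reduced_words edges"
proof (induction w arbitrary: x)
  case Nil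
  then show ?case by (auto simp: p_closed intro!: image_eqI[of _ _ "[]"])
next
  case (Cons b w)
  let ?y = "if b then s x else t x"
  define r where "r = word_elem w \<otimes>\<^bsub>PSL2Z\<^esub> inv\<^bsub>PSL2Z\<^esub> (p (word_act s t w ?y))"
  have r: "r \<in> carrier PSL2Z"
    unfolding r_def using Cons.prems
    by (intro PSL2Z.m_closed PSL2Z.inv_closed p_closed word_act_closed) (auto simp: s_closed t_closed)
  have y: "?y \<in> K" using Cons.prems by (simp add: s_closed t_closed)
  have IH: "p ?y \<otimes>\<^bsub>PSL2Z\<^esub> r \<in> eval_gen ` reduced_words edges"
    using Cons.IH[OF y] y by (simp add: r_def PSL2Z.m_assoc p_closed word_act_closed)
  have eq: "p x \<otimes>\<^bsub>PSL2Z\<^esub> word_elem (b # w) \<otimes>\<^bsub>PSL2Z\<^esub> inv\<^bsub>PSL2Z\<^esub> (p (word_act s t (b # w) x))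
      = p x \<otimes>\<^bsub>PSL2Z\<^esub> word_elem [b] \<otimes>\<^bsub>PSL2Z\<^esub> r"
    using Cons.prems y
    by (simp add: r_def word_elem_Cons[of b w] word_act_Cons PSL2Z.m_assoc p_closed word_act_closed
        del: if_split)
  show ?case
  proof (cases b)
    case False
    then show ?thesis using eq IH Cons.prems by (simp add: p_t)
  next
    case True
    have "p x \<otimes>\<^bsub>PSL2Z\<^esub> word_elem [b] = gen x \<otimes>\<^bsub>PSL2Z\<^esub> p (s x)"
      using True Cons.prems by (simp add: gen_def PSL2Z.m_assoc p_closed s_closed)
    then have "p x \<otimes>\<^bsub>PSL2Z\<^esub> word_elem [b] \<otimes>\<^bsub>PSL2Z\<^esub> r = gen x \<otimes>\<^bsub>PSL2Z\<^esub> (p (s x) \<otimes>\<^bsub>PSL2Z\<^esub> r)"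
      using Cons.prems r by (simp add: gen_closed PSL2Z.m_assoc p_closed s_closed)
    moreover obtain v where "v \<in> reduced_words edges" "p (s x) \<otimes>\<^bsub>PSL2Z\<^esub> r = eval_gen v"
      using IH True by auto
    ultimately show ?thesis
      using eq gen_mult_eval_gen[OF Cons.prems] by simp
  qed
qed

lemma stab_subset_image: "stab \<subseteq> eval_gen ` reduced_words edges"
proof
  fix x assume x: "x \<in> stab"
  then obtain w where w: "x = word_elem w"
    by (auto simp: stab_def carrier_eq_range_word_elem)
  then have "word_act s t w x0 = x0"
    using x by (simp add: stab_def act_word_elem x0)
  then show "x \<in> eval_gen ` reduced_words edges"
    using word_in_image[OF x0, of w] by (simp add: w p_x0)
qed

text \<open>
  The action on \<open>K\<close> is lifted to the product with the reduced words: crossing an edge outside the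
  tree multiplies the word by the corresponding generator.  A product of generators can then be read
  off from its effect on \<open>(x0, [])\<close>, which shows that the generators are free.
\<close>

definition lift_s :: "'a \<times> ('a \<times> bool) list \<Rightarrow> 'a \<times> ('a \<times> bool) list" where
  "lift_s = (\<lambda>(x, w). (s x, if x \<in> T then w else if x \<in> edges then cons_reduce (x, True) w
     else cons_reduce (s x, False) w))"

definition lift_t :: "'a \<times> ('a \<times> bool) list \<Rightarrow> 'a \<times> ('a \<times> bool) list" where
  "lift_t = (\<lambda>(x, w). (t x, w))"

sublocale lift: modular_action "K \<times> reduced_words edges" lift_s lift_t
proof
  fix z assume "z \<in> K \<times> reduced_words edges"
  then obtain x w where z: "z = (x, w)" "x \<in> K" "w \<in> reduced_words edges" by auto
  show "lift_t z \<in> K \<times> reduced_words edges" "lift_t (lift_t (lift_t z)) = z"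
    using z by (auto simp: lift_t_def t_closed t_t_t)
  show "lift_s z \<in> K \<times> reduced_words edges"
    using z(2,3) by (rule_tac edge_cases[OF z(2)]) (auto simp: z(1) lift_s_def s_closed intro!: cons_reduce_closed)
  show "lift_s (lift_s z) = z"
    using cons_reduce_cancel[OF z(3), of x True] cons_reduce_cancel[OF z(3), of "s x" False]
    by (rule_tac edge_cases[OF z(2)]) (auto simp: z(1) lift_s_def s_s z(2))
qed

text \<open>Moving inside the tree does not touch the word, so only the final crossing in
  \<open>gen x\<close> changes it.\<close>

lemma lift_act_p:
  "x \<in> K \<Longrightarrow> w \<in> reduced_words edges \<Longrightarrow> lift.act (p x) (x0, w) = (x, w)"
  using act_p[of "K \<times> reduced_words edges" lift_s lift_t "\<lambda>y. (y, w)" x] lift.modular_action_axioms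
  by (simp add: lift_s_def lift_t_def)

lemma lift_act_gen:
  assumes x: "x \<in> edges" and w: "w \<in> reduced_words edges"
  shows "lift.act (gen x) (x0, w) = (x0, cons_reduce (x, True) w)"
proof -
  have xK: "x \<in> K" using x edges_subset by blast
  have c: "cons_reduce (x, True) w \<in> reduced_words edges"
    using x w by (intro cons_reduce_closed) auto
  have "lift.act (p x \<otimes>\<^bsub>PSL2Z\<^esub> word_elem [True]) (x0, w) = lift_s (x, w)"
    using xK w x0 by (simp add: lift.act_mult p_closed lift_act_p lift.act_S)
  also have "\<dots> = (s x, cons_reduce (x, True) w)"
    using x by (auto simp: lift_s_def edges_def)
  finally have "lift.act (gen x) (x0, w) =
      lift.act (inv\<^bsub>PSL2Z\<^esub> (p (s x))) (s x, cons_reduce (x, True) w)"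
    unfolding gen_def using xK w x0 by (subst lift.act_mult) (simp_all add: p_closed s_closed)
  also have "\<dots> = (x0, cons_reduce (x, True) w)"
    using xK c x0 by (intro lift.act_inv) (auto simp: p_closed s_closed lift_act_p)
  finally show ?thesis .
qed

lemma lift_act_inv_gen:
  assumes x: "x \<in> edges" and w: "w \<in> reduced_words edges"
  shows "lift.act (inv\<^bsub>PSL2Z\<^esub> (gen x)) (x0, w) = (x0, cons_reduce (x, False) w)"
proof -
  have c: "cons_reduce (x, False) w \<in> reduced_words edges"
    using x w by (intro cons_reduce_closed) auto
  have "lift.act (gen x) (x0, cons_reduce (x, False) w) = (x0, w)"
    using cons_reduce_cancel[OF w, of x False] by (simp add: lift_act_gen[OF x c])
  then show ?thesis
    using c w x0 x edges_subset by (intro lift.act_inv) (auto simp: gen_closed)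
qed

lemma lift_act_eval_gen:
  "w \<in> reduced_words edges \<Longrightarrow> v \<in> reduced_words edges \<Longrightarrow>
     lift.act (eval_gen w) (x0, v) = (x0, fold cons_reduce w v)"
proof (induction w arbitrary: v)
  case (Cons l w)
  obtain x e where l: "l = (x, e)" by (cases l)
  have x: "x \<in> edges" "w \<in> reduced_words edges" using Cons.prems by (auto simp: reduced_words_Cons l)
  then have "eval_gen w \<in> carrier PSL2Z"
    using edges_subset by (intro eval_gen_closed) (auto simp: reduced_words_def)
  moreover have "gen x \<in> carrier PSL2Z" using x edges_subset by (auto intro: gen_closed)
  moreover have "cons_reduce (x, e) v \<in> reduced_words edges"
    using x Cons.prems by (intro cons_reduce_closed) auto
  ultimately show ?case
    using x Cons x0 by (cases e) (simp_all add: l eval_gen_Cons lift.act_mult lift_act_gen lift_act_inv_gen)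
qed (simp add: lift.act_one x0)

lemma inj_on_eval_gen: "inj_on eval_gen (reduced_words edges)"
proof (rule inj_onI)
  fix v w assume *: "v \<in> reduced_words edges" "w \<in> reduced_words edges" "eval_gen v = eval_gen w"
  then have "fold cons_reduce v [] = fold cons_reduce w []"
    using lift_act_eval_gen[of v "[]"] lift_act_eval_gen[of w "[]"] by simp
  then show "v = w"
    using * fold_cons_reduce[of v "[]" edges] fold_cons_reduce[of w "[]" edges]
    by (simp add: reduced_words_rev)
qed

lemma eval_gen_eq_stab:
  assumes "fst ` set w \<subseteq> edges"
  shows "eval_gen w \<in> stab \<and> eval_word (PSL2Z\<lparr>carrier := stab\<rparr>) (map (apfst gen) w) = eval_gen w"
  using assms
proof (induction w)
  case Nil
  then show ?case using subgroup.one_closed[OF subgroup_stab] by (simp add: eval_word_def)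
next
  case (Cons l w)
  obtain x e where l: "l = (x, e)" by (cases l)
  have "gen x \<in> stab" using Cons.prems l edges_subset by (auto intro: gen_stab)
  then show ?case
    using Cons subgroup_stab
    by (auto simp: l eval_word_Cons eval_gen_Cons PSL2Z.m_inv_consistent subgroup.m_closed
        subgroup.m_inv_closed)
qed

text \<open>The words so far are over the labels in \<open>edges\<close>, whereas freeness concerns
  words in the generators themselves. The two are identified through \<open>gen\<close>, which is
  injective by the case of one-letter words.\<close>

lemma free_stab: "is_free_group (PSL2Z\<lparr>carrier := stab\<rparr>)"
  unfolding is_free_group_def
proof (intro conjI exI)
  show "group (PSL2Z\<lparr>carrier := stab\<rparr>)"
    by (rule subgroup.subgroup_is_group[OF subgroup_stab group_PSL2Z])
  show "gen ` edges \<subseteq> carrier (PSL2Z\<lparr>carrier := stab\<rparr>)"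
    using gen_stab edges_subset by auto
  have inj: "inj_on gen edges"
  proof (rule inj_onI)
    fix x y assume *: "x \<in> edges" "y \<in> edges" "gen x = gen y"
    then have "eval_gen [(x, True)] = eval_gen [(y, True)]" by (simp add: eval_gen_Cons)
    then have "[(x, True)] = [(y, True)]"
      using * by (intro inj_onD[OF inj_on_eval_gen]) (auto simp: reduced_words_Cons)
    then show "x = y" by simp
  qed
  have img: "reduced_words (gen ` edges) = map (apfst gen) ` reduced_words edges"
  proof (intro equalityI subsetI)
    fix w assume w: "w \<in> reduced_words (gen ` edges)"
    define v where "v = map (apfst (inv_into edges gen)) w"
    have "fst ` set w \<subseteq> gen ` edges" using w by (simp add: reduced_words_def)
    then have wv: "w = map (apfst gen) v"
      unfolding v_def map_map by (intro map_idI[symmetric]) (auto simp: f_inv_into_f image_subset_iff)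
    have v: "fst ` set v \<subseteq> edges"
      using w by (auto simp: v_def reduced_words_def inv_into_into)
    have "successively noncancelling w"
      using w by (simp add: reduced_words_def)
    then have "successively noncancelling v"
      unfolding wv successively_map by (rule successively_mono) auto
    then show "w \<in> map (apfst gen) ` reduced_words edges"
      using v wv by (auto simp: reduced_words_def)
  next
    fix w assume "w \<in> map (apfst gen) ` reduced_words edges"
    then obtain v where v: "w = map (apfst gen) v" "fst ` set v \<subseteq> edges" "successively noncancelling v"
      by (auto simp: reduced_words_def)
    have ve: "a \<in> edges" if "(a, b) \<in> set v" for a b
      using v(2) that by force
    have "successively noncancelling w"
      unfolding v(1) successively_map
      using v(3) by (rule successively_mono) (auto dest!: inj_onD[OF inj] intro: ve)
    then show "w \<in> reduced_words (gen ` edges)"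
      using v by (auto simp: reduced_words_def)
  qed
  have "bij_betw eval_gen (reduced_words edges) stab"
    using inj_on_eval_gen stab_subset_image eval_gen_eq_stab
    by (auto simp: bij_betw_def reduced_words_def)
  then have "bij_betw (eval_word (PSL2Z\<lparr>carrier := stab\<rparr>) \<circ> map (apfst gen)) (reduced_words edges) stab"
    by (rule bij_betw_cong[THEN iffD1, rotated]) (use eval_gen_eq_stab in \<open>auto simp: reduced_words_def\<close>)
  note comp = this
  have "bij_betw (map (apfst gen)) (reduced_words edges) (reduced_words (gen ` edges))"
    unfolding img using bij_betw_imp_inj_on[OF comp] inj_on_imageI2 by (auto simp: bij_betw_def)
  from comp[folded bij_betw_comp_iff[OF this]]
  show "bij_betw (eval_word (PSL2Z\<lparr>carrier := stab\<rparr>)) (reduced_words (gen ` edges))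
      (carrier (PSL2Z\<lparr>carrier := stab\<rparr>))"
    by simp
qed

end

section \<open>Free subgroups and transitive pairs of permutations\<close>

definition fpf_pairs :: "nat \<Rightarrow> nat \<Rightarrow> 'a set \<Rightarrow> (('a \<Rightarrow> 'a) \<times> ('a \<Rightarrow> 'a)) set" where
  "fpf_pairs j k X = fpf_perms j X \<times> fpf_perms k X"

definition orbit :: "('a \<Rightarrow> 'a) \<Rightarrow> ('a \<Rightarrow> 'a) \<Rightarrow> 'a \<Rightarrow> 'a set" where
  "orbit s t x = range (\<lambda>w. word_act s t w x)"

definition transitive_pairs :: "nat \<Rightarrow> nat \<Rightarrow> 'a set \<Rightarrow> 'a \<Rightarrow> (('a \<Rightarrow> 'a) \<times> ('a \<Rightarrow> 'a)) set" where
  "transitive_pairs j k X x = {(s, t) \<in> fpf_pairs j k X. orbit s t x = X}"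

definition free_subgroups :: "nat \<Rightarrow> (int ^ 2 ^ 2) set set set" where
  "free_subgroups n = {H. subgroup H PSL2Z \<and> is_free_group (PSL2Z\<lparr>carrier := H\<rparr>) \<and>
     card (rcosets\<^bsub>PSL2Z\<^esub> H) = n}"

lemma finite_fpf_perms: "finite X \<Longrightarrow> finite (fpf_perms n X)"
  by (rule finite_subset[OF _ finite_permutations[of X]]) (auto simp: fpf_perms_def)

lemma finite_fpf_pairs: "finite X \<Longrightarrow> finite (fpf_pairs j k X)"
  by (simp add: fpf_pairs_def finite_fpf_perms)

lemma finite_transitive_pairs: "finite X \<Longrightarrow> finite (transitive_pairs j k X x)"
  by (rule finite_subset[OF _ finite_fpf_pairs[of X j k]]) (auto simp: transitive_pairs_def)

lemma transitive_pair_iff: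
  assumes "finite K" "x0 \<in> K"
  shows "transitive_pair K s t x0 \<longleftrightarrow> (s, t) \<in> transitive_pairs 2 3 K x0"
proof
  assume "transitive_pair K s t x0"
  then interpret transitive_pair K s t x0 .
  have "orbit s t x0 = K"
    using transitive word_act_closed x0 by (fastforce simp: orbit_def)
  then show "(s, t) \<in> transitive_pairs 2 3 K x0"
    using s t by (simp add: transitive_pairs_def fpf_pairs_def)
next
  assume "(s, t) \<in> transitive_pairs 2 3 K x0"
  then have *: "s \<in> fpf_perms 2 K" "t \<in> fpf_perms 3 K" "K = orbit s t x0"
    by (auto simp: transitive_pairs_def fpf_pairs_def)
  show "transitive_pair K s t x0"
  proof
    show "\<exists>w. word_act s t w x0 = x" if "x \<in> K" for x
      using that unfolding *(3) orbit_def by auto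
  qed (use assms * in auto)
qed

context transitive_pair
begin

lemma act_eq_iff:
  assumes "g \<in> carrier PSL2Z" "h \<in> carrier PSL2Z"
  shows "act g x0 = act h x0 \<longleftrightarrow> g \<otimes>\<^bsub>PSL2Z\<^esub> inv\<^bsub>PSL2Z\<^esub> h \<in> stab"
proof -
  have y: "act g x0 \<in> K" using assms x0 by (simp add: act_closed)
  have "act (g \<otimes>\<^bsub>PSL2Z\<^esub> inv\<^bsub>PSL2Z\<^esub> h) x0 = act (inv\<^bsub>PSL2Z\<^esub> h) (act g x0)"
    using assms x0 by (simp add: act_mult)
  moreover have "act (inv\<^bsub>PSL2Z\<^esub> h) (act g x0) = x0 \<longleftrightarrow> act g x0 = act h x0"
    using act_inv[OF assms(2) x0 y] act_inv[of "inv\<^bsub>PSL2Z\<^esub> h" "act g x0" x0] assms(2) x0 y by auto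
  ultimately show ?thesis using assms by (simp add: stab_def)
qed

lemma word_act_eq_iff:
  "word_act s t v x0 = word_act s t w x0 \<longleftrightarrow>
     word_elem v \<otimes>\<^bsub>PSL2Z\<^esub> inv\<^bsub>PSL2Z\<^esub> (word_elem w) \<in> stab"
  using act_eq_iff[of "word_elem v" "word_elem w"] by (simp add: act_word_elem x0)

text \<open>Orbit-stabiliser: the coset of g corresponds to the point
  \<open>act g x0\<close>.\<close>

lemma card_rcosets_stab: "card (rcosets\<^bsub>PSL2Z\<^esub> stab) = card K"
proof -
  interpret H: subgroup stab PSL2Z by (rule subgroup_stab)
  have eq: "stab #>\<^bsub>PSL2Z\<^esub> g = stab #>\<^bsub>PSL2Z\<^esub> h \<longleftrightarrow> act g x0 = act h x0"
    if "g \<in> carrier PSL2Z" "h \<in> carrier PSL2Z" for g h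
    using that act_eq_iff H.rcos_module[OF group_PSL2Z, of h g] PSL2Z.repr_independence[of g stab h]
      PSL2Z.rcos_self[of g stab] subgroup_stab by blast
  define f where "f C = act (SOME g. g \<in> carrier PSL2Z \<and> C = stab #>\<^bsub>PSL2Z\<^esub> g) x0" for C
  have f: "f (stab #>\<^bsub>PSL2Z\<^esub> g) = act g x0" if "g \<in> carrier PSL2Z" for g
  proof -
    let ?h = "SOME h. h \<in> carrier PSL2Z \<and> stab #>\<^bsub>PSL2Z\<^esub> g = stab #>\<^bsub>PSL2Z\<^esub> h"
    have "?h \<in> carrier PSL2Z \<and> stab #>\<^bsub>PSL2Z\<^esub> g = stab #>\<^bsub>PSL2Z\<^esub> ?h"
      by (rule someI[of _ g]) (use that in simp)
    then show ?thesis using eq[OF that] by (auto simp: f_def)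
  qed
  have "bij_betw f (rcosets\<^bsub>PSL2Z\<^esub> stab) K"
  proof (rule bij_betw_imageI)
    show "inj_on f (rcosets\<^bsub>PSL2Z\<^esub> stab)"
    proof (rule inj_onI)
      fix C D assume "C \<in> rcosets\<^bsub>PSL2Z\<^esub> stab" "D \<in> rcosets\<^bsub>PSL2Z\<^esub> stab" "f C = f D"
      moreover from this obtain g h where "g \<in> carrier PSL2Z" "C = stab #>\<^bsub>PSL2Z\<^esub> g"
        "h \<in> carrier PSL2Z" "D = stab #>\<^bsub>PSL2Z\<^esub> h"
        by (auto simp: RCOSETS_def)
      ultimately show "C = D" using eq f by metis
    qed
    have "f ` (rcosets\<^bsub>PSL2Z\<^esub> stab) = (\<lambda>g. act g x0) ` carrier PSL2Z"
      by (force simp: RCOSETS_def f)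
    also have "\<dots> = K"
      using transitive x0 by (auto simp: act_closed carrier_eq_range_word_elem act_word_elem image_iff
          word_act_closed) metis
    finally show "f ` (rcosets\<^bsub>PSL2Z\<^esub> stab) = K" .
  qed
  then show ?thesis by (rule bij_betw_same_card)
qed

lemma stab_in_free_subgroups: "stab \<in> free_subgroups (card K)"
proof -
  obtain T p where "partial_tree K T p" using spanning_tree_exists by blast
  then interpret spanning_tree K s t x0 T p by unfold_locales
  show ?thesis
    by (simp add: free_subgroups_def subgroup_stab free_stab card_rcosets_stab)
qed

end

text \<open>If u fixed the coset H a, the conjugate of u by a would be an element of finite order in
  H, hence 1, since free groups are torsion-free.\<close>

lemma free_subgroup_conj:
  assumes H: "subgroup H PSL2Z" "is_free_group (PSL2Z\<lparr>carrier := H\<rparr>)"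
    and a: "a \<in> carrier PSL2Z" and u: "u \<in> carrier PSL2Z" "u \<noteq> \<one>\<^bsub>PSL2Z\<^esub>"
    and k: "u [^]\<^bsub>PSL2Z\<^esub> (k::nat) = \<one>\<^bsub>PSL2Z\<^esub>" "k > 0"
  shows "H #>\<^bsub>PSL2Z\<^esub> a #>\<^bsub>PSL2Z\<^esub> u \<noteq> H #>\<^bsub>PSL2Z\<^esub> a"
proof
  assume "H #>\<^bsub>PSL2Z\<^esub> a #>\<^bsub>PSL2Z\<^esub> u = H #>\<^bsub>PSL2Z\<^esub> a"
  then have "H #>\<^bsub>PSL2Z\<^esub> (a \<otimes>\<^bsub>PSL2Z\<^esub> u) = H #>\<^bsub>PSL2Z\<^esub> a"
    using a u H(1) by (simp add: PSL2Z.coset_mult_assoc subgroup.subset)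
  then have "a \<otimes>\<^bsub>PSL2Z\<^esub> u \<in> H #>\<^bsub>PSL2Z\<^esub> a"
    using PSL2Z.rcos_self[of "a \<otimes>\<^bsub>PSL2Z\<^esub> u" H] a u H(1) by auto
  then have inH: "a \<otimes>\<^bsub>PSL2Z\<^esub> u \<otimes>\<^bsub>PSL2Z\<^esub> inv\<^bsub>PSL2Z\<^esub> a \<in> H"
    using subgroup.rcos_module[OF H(1) group_PSL2Z] a u by auto
  interpret HG: group "PSL2Z\<lparr>carrier := H\<rparr>"
    by (rule subgroup.subgroup_is_group[OF H(1) group_PSL2Z])
  have "(a \<otimes>\<^bsub>PSL2Z\<^esub> u \<otimes>\<^bsub>PSL2Z\<^esub> inv\<^bsub>PSL2Z\<^esub> a) [^]\<^bsub>PSL2Z\<lparr>carrier := H\<rparr>\<^esub> k = \<one>\<^bsub>PSL2Z\<^esub>"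
    using a u k by (simp add: PSL2Z.conj_nat_pow flip: PSL2Z.nat_pow_consistent)
  then have "a \<otimes>\<^bsub>PSL2Z\<^esub> u \<otimes>\<^bsub>PSL2Z\<^esub> inv\<^bsub>PSL2Z\<^esub> a = \<one>\<^bsub>PSL2Z\<^esub>"
    using HG.free_group_torsion_free[OF H(2), of _ k] inH k(2) by simp
  then have "a \<otimes>\<^bsub>PSL2Z\<^esub> u = \<one>\<^bsub>PSL2Z\<^esub> \<otimes>\<^bsub>PSL2Z\<^esub> a"
    using a u PSL2Z.inv_solve_right'[of "\<one>\<^bsub>PSL2Z\<^esub>" "a \<otimes>\<^bsub>PSL2Z\<^esub> u" a] by simp
  then have "a \<otimes>\<^bsub>PSL2Z\<^esub> u = a \<otimes>\<^bsub>PSL2Z\<^esub> \<one>\<^bsub>PSL2Z\<^esub>"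
    using a by simp
  then show False
    using a u by (metis PSL2Z.Units_eq PSL2Z.Units_l_cancel PSL2Z.one_closed)
qed

lemma pointed_bij_exists:
  assumes "finite A" "card A = card B" "finite B" "a \<in> A" "b \<in> B"
  shows "\<exists>h. bij_betw h A B \<and> h a = b"
proof -
  obtain h where h: "bij_betw h A B"
    using assms finite_same_card_bij by blast
  have "Transposition.transpose (h a) b permutes B"
    using h assms by (intro permutes_swap_id) (auto simp: bij_betw_def)
  then have "bij_betw (Transposition.transpose (h a) b \<circ> h) A B"
    using h bij_betw_trans permutes_imp_bij by blast
  then show ?thesis by (intro exI[of _ "Transposition.transpose (h a) b \<circ> h"]) simp
qed

text \<open>The points of K are used as labels for the right cosets of H, with x0 labelling H
  itself, and \<open>m b\<close> is right multiplication by the generator named by b. Fixed points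
  are excluded by \<open>free_subgroup_conj\<close>.\<close>

lemma free_subgroup_is_stab:
  fixes K :: "'a :: linorder set"
  assumes "finite K" "x0 \<in> K" and H: "H \<in> free_subgroups (card K)"
  shows "\<exists>s t. transitive_pair K s t x0 \<and> transitive_pair.stab s t x0 = H"
proof -
  have sub: "subgroup H PSL2Z" and free: "is_free_group (PSL2Z\<lparr>carrier := H\<rparr>)"
    and card: "card (rcosets\<^bsub>PSL2Z\<^esub> H) = card K"
    using H by (auto simp: free_subgroups_def)
  interpret H: subgroup H PSL2Z by fact
  let ?R = "rcosets\<^bsub>PSL2Z\<^esub> H"
  have "card K > 0" using assms card_gt_0_iff by blast
  then have fin: "finite ?R" using card card_ge_0_finite by metis
  have "H \<in> ?R" by (rule H.subgroup_in_rcosets[OF group_PSL2Z])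
  then obtain h where h: "bij_betw h ?R K" "h H = x0"
    using pointed_bij_exists[OF fin card assms(1) _ assms(2)] by blast
  define c where "c = inv_into ?R h"
  have c: "c x \<in> ?R" "h (c x) = x" if "x \<in> K" for x
    using that h by (auto simp: c_def bij_betw_def inv_into_into f_inv_into_f)
  have ch: "c (h C) = C" if "C \<in> ?R" for C
    using that h by (auto simp: c_def bij_betw_def)
  have hK: "h C \<in> K" if "C \<in> ?R" for C
    using that h by (auto simp: bij_betw_def)
  have R': "C #>\<^bsub>PSL2Z\<^esub> g \<in> ?R" "C #>\<^bsub>PSL2Z\<^esub> \<one>\<^bsub>PSL2Z\<^esub> = C"
      "C #>\<^bsub>PSL2Z\<^esub> g #>\<^bsub>PSL2Z\<^esub> g' = C #>\<^bsub>PSL2Z\<^esub> (g \<otimes>\<^bsub>PSL2Z\<^esub> g')"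
    if C: "C \<in> ?R" and g: "g \<in> carrier PSL2Z" "g' \<in> carrier PSL2Z" for C g g'
  proof -
    obtain a where a: "a \<in> carrier PSL2Z" "C = H #>\<^bsub>PSL2Z\<^esub> a"
      using C by (auto simp: RCOSETS_def)
    then have "C \<subseteq> carrier PSL2Z" by (simp add: PSL2Z.r_coset_subset_G H.subset)
    then show "C #>\<^bsub>PSL2Z\<^esub> \<one>\<^bsub>PSL2Z\<^esub> = C"
      "C #>\<^bsub>PSL2Z\<^esub> g #>\<^bsub>PSL2Z\<^esub> g' = C #>\<^bsub>PSL2Z\<^esub> (g \<otimes>\<^bsub>PSL2Z\<^esub> g')"
      using g by (simp_all add: PSL2Z.coset_mult_assoc)
    show "C #>\<^bsub>PSL2Z\<^esub> g \<in> ?R"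
      using a g by (simp add: PSL2Z.coset_mult_assoc H.subset PSL2Z.rcosetsI)
  qed
  note R = R'(1)[OF _ _ PSL2Z.one_closed] R'(2)[OF _ PSL2Z.one_closed PSL2Z.one_closed] R'(3)
  define m where "m b x = (if x \<in> K then h (c x #>\<^bsub>PSL2Z\<^esub> word_elem [b]) else x)" for b x
  have m: "h (c x #>\<^bsub>PSL2Z\<^esub> word_elem [b]) \<in> K" if "x \<in> K" for b x
    using that c R hK by simp
  have act: "word_act (m True) (m False) w x = h (c x #>\<^bsub>PSL2Z\<^esub> word_elem w) \<and>
      h (c x #>\<^bsub>PSL2Z\<^esub> word_elem w) \<in> K" if "x \<in> K" for w x
    using that
  proof (induction w arbitrary: x)
    case Nil
    then show ?case using c R(2)[OF c(1)] by simp
  next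
    case (Cons b w)
    have "(if b then m True x else m False x) = m b x" by simp
    then show ?case
      using Cons.IH[of "m b x"] Cons.prems m[OF Cons.prems, of b] c[OF Cons.prems]
      by (cases b) (simp_all add: word_act_Cons m_def ch R word_elem_Cons[of True w] word_elem_Cons[of False w])
  qed
  have pow: "(m b ^^ n) x = word_act (m True) (m False) (replicate n b) x" for b n x
    by (induction n arbitrary: x)
      (simp_all add: word_act_Cons funpow_Suc_right del: funpow.simps(2))
  have m_pow: "(m True ^^ 2) x = x" "(m False ^^ 3) x = x" if "x \<in> K" for x
  proof -
    have "replicate 2 True = [True, True]" "replicate 3 False = [False, False, False]"
      by (simp_all add: eval_nat_numeral)
    then show "(m True ^^ 2) x = x" "(m False ^^ 3) x = x"
      using act[OF that] c[OF that] R(2)[OF c(1)] that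
      by (simp_all add: pow word_elem_SS word_elem_UUU)
  qed
  have m_neq: "m b x \<noteq> x" if x: "x \<in> K" for b x
  proof
    assume "m b x = x"
    then have "h (c x #>\<^bsub>PSL2Z\<^esub> word_elem [b]) = h (c x)"
      using that c by (simp add: m_def)
    then have eq: "c x #>\<^bsub>PSL2Z\<^esub> word_elem [b] = c x"
      using h(1) c(1)[OF that] R(1)[OF c(1)] that
      by (meson PSL2Z.one_closed bij_betw_def inj_onD word_elem_closed)
    obtain a where a: "a \<in> carrier PSL2Z" "c x = H #>\<^bsub>PSL2Z\<^esub> a"
      using c(1)[OF x] by (auto simp: RCOSETS_def)
    have 6: "word_elem [b] [^]\<^bsub>PSL2Z\<^esub> (if b then 2 else 3 :: nat) = \<one>\<^bsub>PSL2Z\<^esub>"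
      by (simp add: eval_nat_numeral word_elem_SS word_elem_UUU flip: word_elem_append)
    show False
      using free_subgroup_conj[OF sub free a(1) _ _ 6] eq a(2) word_elem_neq_one by (cases b) auto
  qed
  have perm: "m b permutes K" for b
  proof (rule bij_imp_permutes)
    show "m b x = x" if "x \<notin> K" for x using that by (simp add: m_def)
    \<comment> \<open>One less than the order of the generator: this power of \<open>m b\<close> is
      its inverse.\<close>
    define n :: nat where "n = (if b then 1 else 2)"
    have "(m b ^^ n) (m b x) = x" "m b ((m b ^^ n) x) = x" if "x \<in> K" for x
      using m_pow[OF that] by (cases b; simp add: n_def eval_nat_numeral)+
    moreover have "m b x \<in> K" if "x \<in> K" for x using that m by (simp add: m_def)
    moreover from this have "(m b ^^ n) x \<in> K" if "x \<in> K" for x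
      using that by (induction n) auto
    ultimately show "bij_betw (m b) K K"
      by (intro bij_betwI[of _ _ _ "m b ^^ n"]) auto
  qed
  have pair: "transitive_pair K (m True) (m False) x0"
  proof
    show "m True \<in> fpf_perms 2 K" "m False \<in> fpf_perms 3 K"
      using perm m_pow m_neq by (simp_all add: fpf_perms_def)
    show "\<exists>w. word_act (m True) (m False) w x0 = x" if x: "x \<in> K" for x
    proof -
      obtain a where a: "a \<in> carrier PSL2Z" "c x = H #>\<^bsub>PSL2Z\<^esub> a"
        using c(1)[OF x] by (auto simp: RCOSETS_def)
      moreover obtain w where "a = word_elem w"
        using a(1) by (auto simp: carrier_eq_range_word_elem)
      ultimately have "word_act (m True) (m False) w x0 = h (c x)"
        using act[OF assms(2)] ch[OF \<open>H \<in> ?R\<close>] h(2) by auto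
      then show ?thesis using c that by auto
    qed
  qed (use assms in auto)
  interpret P: transitive_pair K "m True" "m False" x0 by (rule pair)
  have "P.stab = H"
  proof (intro equalityI subsetI)
    fix g assume "g \<in> P.stab"
    then obtain w where w: "g = word_elem w" "word_act (m True) (m False) w x0 = x0"
      by (auto simp: P.stab_def carrier_eq_range_word_elem P.act_word_elem assms(2))
    then have "h (H #>\<^bsub>PSL2Z\<^esub> g) = h H"
      using act[OF assms(2), of w] ch[OF \<open>H \<in> ?R\<close>] h(2) by auto
    then have "H #>\<^bsub>PSL2Z\<^esub> g = H"
      using h(1) \<open>H \<in> ?R\<close> R(1)[OF \<open>H \<in> ?R\<close>] w(1)
      by (meson PSL2Z.one_closed bij_betw_def inj_onD word_elem_closed)
    then show "g \<in> H" using PSL2Z.rcos_self[of g H] sub w(1) by auto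
  next
    fix g assume g: "g \<in> H"
    then obtain w where w: "g = word_elem w" using H.subset by (auto simp: carrier_eq_range_word_elem)
    have "H #>\<^bsub>PSL2Z\<^esub> g = H" using g by (rule H.rcos_const[OF group_PSL2Z])
    then have "word_act (m True) (m False) w x0 = x0"
      using act[OF assms(2), of w] ch[OF \<open>H \<in> ?R\<close>] h(2) w by auto
    then show "g \<in> P.stab"
      by (simp add: P.stab_def w P.act_word_elem assms(2))
  qed
  then show ?thesis using pair by blast
qed

section \<open>Pairs with the same stabiliser differ by a relabelling of the points\<close>

lemma fpf_perms_conj:
  assumes p: "p \<in> fpf_perms n X" and q: "q permutes X"
  shows "q \<circ> p \<circ> inv_into UNIV q \<in> fpf_perms n X"
proof -
  have pow: "((q \<circ> p \<circ> inv_into UNIV q) ^^ k) x = q ((p ^^ k) (inv_into UNIV q x))" for k x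
    using permutes_inverses[OF q] by (induction k arbitrary: x) simp_all
  have "q \<circ> p \<circ> inv_into UNIV q permutes X"
    using p q by (auto simp: fpf_perms_def intro!: permutes_compose permutes_inv)
  moreover have "q (p (inv_into UNIV q x)) \<noteq> x" if "x \<in> X" "n \<noteq> 1" for x
  proof
    assume "q (p (inv_into UNIV q x)) = x"
    then have "p (inv_into UNIV q x) = inv_into UNIV q x"
      using permutes_inv_eq[OF q] by metis
    moreover have "inv_into UNIV q x \<in> X"
      using that permutes_in_image[OF permutes_inv[OF q]] by simp
    ultimately show False using that p by (auto simp: fpf_perms_def)
  qed
  ultimately show ?thesis
    using p permutes_in_image[OF permutes_inv[OF q]] permutes_inverses[OF q]
    by (auto simp: fpf_perms_def pow simp del: funpow.simps)
qed

lemma word_act_conj: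
  assumes "q permutes X"
  shows "word_act (q \<circ> s \<circ> inv_into UNIV q) (q \<circ> t \<circ> inv_into UNIV q) w (q x) = q (word_act s t w x)"
  using permutes_inverses[OF assms] by (induction w arbitrary: x) (simp_all add: word_act_Cons)

context transitive_pair
begin

lemma transitive_pair_conj:
  assumes q: "q permutes K - {x0}"
  shows "transitive_pair K (q \<circ> s \<circ> inv_into UNIV q) (q \<circ> t \<circ> inv_into UNIV q) x0"
    and "transitive_pair.stab (q \<circ> s \<circ> inv_into UNIV q) (q \<circ> t \<circ> inv_into UNIV q) x0 = stab"
proof -
  have qK: "q permutes K" using q by (rule permutes_subset) auto
  have qx: "q x0 = x0" using q by (auto simp: permutes_def)
  show pair: "transitive_pair K (q \<circ> s \<circ> inv_into UNIV q) (q \<circ> t \<circ> inv_into UNIV q) x0"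
  proof
    show "\<exists>w. word_act (q \<circ> s \<circ> inv_into UNIV q) (q \<circ> t \<circ> inv_into UNIV q) w x0 = x" if "x \<in> K" for x
    proof -
      have "inv_into UNIV q x \<in> K" using that permutes_in_image[OF permutes_inv[OF qK]] by simp
      then obtain w where "word_act s t w x0 = inv_into UNIV q x" using transitive by blast
      then show ?thesis
        using word_act_conj[OF qK, of s t w x0] qx permutes_inverses(1)[OF qK] by auto
    qed
  qed (use finite_K x0 s t fpf_perms_conj[OF _ qK] in auto)
  interpret Q: transitive_pair K "q \<circ> s \<circ> inv_into UNIV q" "q \<circ> t \<circ> inv_into UNIV q" x0 by (rule pair)
  have "word_act (q \<circ> s \<circ> inv_into UNIV q) (q \<circ> t \<circ> inv_into UNIV q) w x0 = x0 \<longleftrightarrow> word_act s t w x0 = x0" for w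
    using word_act_conj[OF qK, of s t w x0] qx permutes_inj[OF qK] by (metis injD)
  then show "Q.stab = stab"
    by (auto simp: Q.stab_def stab_def carrier_eq_range_word_elem Q.act_word_elem act_word_elem x0)
qed

text \<open>The stabiliser determines which words lead x0 to the same point. With equal stabilisers,
  sending the endpoint of w in one action to its endpoint in the other is therefore a well-defined
  bijection; it commutes with the actions and fixes x0.\<close>

lemma conj_if_stab_eq:
  assumes pair': "transitive_pair K s' t' x0" and eq: "transitive_pair.stab s' t' x0 = stab"
  shows "\<exists>q. q permutes K - {x0} \<and> s' = q \<circ> s \<circ> inv_into UNIV q \<and> t' = q \<circ> t \<circ> inv_into UNIV q"
proof -
  interpret Q: transitive_pair K s' t' x0 by (rule pair')
  obtain W where W: "\<And>x. x \<in> K \<Longrightarrow> word_act s t (W x) x0 = x"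
    using transitive by metis
  define q where "q x = (if x \<in> K then word_act s' t' (W x) x0 else x)" for x
  have iff: "word_act s' t' v x0 = word_act s' t' w x0 \<longleftrightarrow> word_act s t v x0 = word_act s t w x0" for v w
    by (simp add: word_act_eq_iff Q.word_act_eq_iff eq)
  have q: "q (word_act s t w x0) = word_act s' t' w x0" for w
    using W[of "word_act s t w x0"] iff[of "W (word_act s t w x0)" w]
    by (simp add: q_def word_act_closed x0)
  have "bij_betw q K K"
  proof (rule bij_betw_imageI)
    show "inj_on q K"
      by (rule inj_onI) (metis W iff q)
    have "x \<in> q ` K" if "x \<in> K" for x
    proof -
      obtain w where "word_act s' t' w x0 = x" using Q.transitive \<open>x \<in> K\<close> by blast
      then have "q (word_act s t w x0) = x" by (simp add: q)
      then show ?thesis using word_act_closed[OF x0, of w] by blast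
    qed
    moreover have "q x \<in> K" if "x \<in> K" for x
      using that x0 by (simp add: q_def Q.word_act_closed)
    ultimately show "q ` K = K" by blast
  qed
  then have qK: "q permutes K"
    by (rule bij_imp_permutes) (simp add: q_def)
  have qx: "q x0 = x0" using q[of "[]"] by simp
  have qK': "q permutes K - {x0}"
    using qK qx by (auto intro: permutes_superset)
  have "s' y = (q \<circ> s \<circ> inv_into UNIV q) y \<and> t' y = (q \<circ> t \<circ> inv_into UNIV q) y" for y
  proof (cases "y \<in> K")
    case True
    then obtain w where w: "word_act s' t' w x0 = y" using Q.transitive by blast
    then have "inv_into UNIV q y = word_act s t w x0"
      using q[of w] permutes_inverses(2)[OF qK] by metis
    moreover have "q (s (word_act s t w x0)) = s' y" "q (t (word_act s t w x0)) = t' y"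
      using q[of "w @ [True]"] q[of "w @ [False]"] w by (simp_all add: word_act_append word_act_Cons)
    ultimately show ?thesis by simp
  next
    case False
    then have "inv_into UNIV q y = y" using qK permutes_inv permutes_not_in by metis
    moreover have "s y = y" "t y = y" "s' y = y" "t' y = y" "q y = y"
      using False s t Q.s Q.t qK by (auto simp: fpf_perms_def permutes_def)
    ultimately show ?thesis by simp
  qed
  then show ?thesis using qK' by blast
qed

text \<open>Distinct relabellings fixing x0 give distinct pairs, since by transitivity the images of
  all points are determined by that of x0.\<close>

lemma card_pairs_same_stab:
  "card {(s', t'). transitive_pair K s' t' x0 \<and> transitive_pair.stab s' t' x0 = stab} =
    fact (card K - 1)"
proof -
  have "bij_betw (\<lambda>q. (q \<circ> s \<circ> inv_into UNIV q, q \<circ> t \<circ> inv_into UNIV q)) {q. q permutes K - {x0}}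
      {(s', t'). transitive_pair K s' t' x0 \<and> transitive_pair.stab s' t' x0 = stab}"
  proof (rule bij_betw_imageI)
    show "inj_on (\<lambda>q. (q \<circ> s \<circ> inv_into UNIV q, q \<circ> t \<circ> inv_into UNIV q)) {q. q permutes K - {x0}}"
    proof (rule inj_onI; clarify)
      fix q r assume q: "q permutes K - {x0}" and r: "r permutes K - {x0}"
        and eq: "q \<circ> s \<circ> inv_into UNIV q = r \<circ> s \<circ> inv_into UNIV r" "q \<circ> t \<circ> inv_into UNIV q = r \<circ> t \<circ> inv_into UNIV r"
      have "q x0 = x0" "r x0 = x0" using q r by (auto simp: permutes_def)
      then have *: "q (word_act s t w x0) = r (word_act s t w x0)" for w
        using word_act_conj[OF q, of s t w x0] word_act_conj[OF r, of s t w x0] eq by simp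
      show "q = r"
      proof
        fix x
        show "q x = r x"
        proof (cases "x \<in> K")
          case True
          then show ?thesis using * transitive by metis
        next
          case False
          then show ?thesis using q r by (auto simp: permutes_def)
        qed
      qed
    qed
    show "(\<lambda>q. (q \<circ> s \<circ> inv_into UNIV q, q \<circ> t \<circ> inv_into UNIV q)) ` {q. q permutes K - {x0}} =
        {(s', t'). transitive_pair K s' t' x0 \<and> transitive_pair.stab s' t' x0 = stab}"
      using transitive_pair_conj by (auto simp: image_iff dest!: conj_if_stab_eq)
  qed
  then have "card {(s', t'). transitive_pair K s' t' x0 \<and> transitive_pair.stab s' t' x0 = stab} =
      card {q. q permutes K - {x0}}"
    by (rule bij_betw_same_card[symmetric])
  also have "\<dots> = fact (card K - 1)"
    using finite_K x0 by (intro card_permutations) auto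
  finally show ?thesis .
qed

end

theorem card_transitive_pairs:
  fixes K :: "'a :: linorder set"
  assumes K: "finite K" "x0 \<in> K"
  shows "card (transitive_pairs 2 3 K x0) = fact (card K - 1) * card (free_subgroups (card K))"
proof -
  let ?P = "transitive_pairs 2 3 K x0"
  let ?f = "\<lambda>(s, t). transitive_pair.stab s t x0"
  note iff = transitive_pair_iff[OF K]
  have img: "?f ` ?P = free_subgroups (card K)"
  proof (intro equalityI subsetI)
    fix H assume "H \<in> ?f ` ?P"
    then show "H \<in> free_subgroups (card K)"
      using transitive_pair.stab_in_free_subgroups by (auto simp flip: iff)
  next
    fix H assume "H \<in> free_subgroups (card K)"
    then show "H \<in> ?f ` ?P"
      using free_subgroup_is_stab[OF K] by (force simp: iff)
  qed
  have "card ?P = (\<Sum>H\<in>?f ` ?P. card {x \<in> ?P. ?f x = H})"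
    using sum.image_gen[OF finite_transitive_pairs[OF K(1)], of "\<lambda>_. 1 :: nat" 2 3 x0 ?f] by simp
  also have "\<dots> = (\<Sum>H\<in>?f ` ?P. fact (card K - 1))"
  proof (rule sum.cong)
    fix H assume "H \<in> ?f ` ?P"
    then obtain s t where st: "transitive_pair K s t x0" "H = transitive_pair.stab s t x0"
      by (auto simp flip: iff)
    have "{x \<in> ?P. ?f x = H} =
        {(s', t'). transitive_pair K s' t' x0 \<and> transitive_pair.stab s' t' x0 = H}"
      by (auto simp: iff)
    then show "card {x \<in> ?P. ?f x = H} = fact (card K - 1)"
      using transitive_pair.card_pairs_same_stab[OF st(1)] st(2) by simp
  qed simp
  finally show ?thesis by (simp add: img)
qed

section \<open>Orbit decomposition\<close>

definition restr :: "'a set \<Rightarrow> ('a \<Rightarrow> 'a) \<Rightarrow> 'a \<Rightarrow> 'a" where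
  "restr A p y = (if y \<in> A then p y else y)"

lemma restr_fpf_perms:
  assumes p: "p \<in> fpf_perms n X" and A: "A \<subseteq> X" "p ` A = A"
  shows "restr A p \<in> fpf_perms n A"
proof -
  have "inj_on p A"
    using p permutes_inj by (auto simp: fpf_perms_def intro: inj_on_subset)
  then have "bij_betw (restr A p) A A"
    using A by (auto simp: bij_betw_def restr_def inj_on_def image_def)
  then have "restr A p permutes A"
    by (rule bij_imp_permutes) (simp add: restr_def)
  moreover have "(restr A p ^^ k) y = (p ^^ k) y \<and> (p ^^ k) y \<in> A" if "y \<in> A" for k y
    using that A(2) by (induction k) (auto simp: restr_def)
  ultimately show ?thesis
    using p A by (auto simp: fpf_perms_def restr_def)
qed

lemma fpf_perms_comp_eq:
  assumes p: "p \<in> fpf_perms n K" and q: "q \<in> fpf_perms n (X - K)"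
  shows "(p \<circ> q) y = (if y \<in> K then p y else q y)"
proof -
  have "q y \<notin> K" if "y \<notin> K"
    using that permutes_in_image[of q "X - K" y] permutes_not_in[of q "X - K" y] q
    by (cases "y \<in> X") (auto simp: fpf_perms_def)
  then show ?thesis
    using p q by (auto simp: fpf_perms_def permutes_not_in)
qed

lemma fpf_perms_comp:
  assumes p: "p \<in> fpf_perms n K" and q: "q \<in> fpf_perms n (X - K)" and K: "K \<subseteq> X"
  shows "p \<circ> q \<in> fpf_perms n X"
proof -
  note eq = fpf_perms_comp_eq[OF p q]
  have "p permutes X" "q permutes X"
    using p q K by (auto simp: fpf_perms_def intro: permutes_subset)
  then have "p \<circ> q permutes X" by (rule permutes_compose[rotated])
  moreover have "((p \<circ> q) ^^ k) y = (p ^^ k) y \<and> (p ^^ k) y \<in> K" if "y \<in> K" for k y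
    using that p by (induction k) (auto simp: eq[unfolded comp_def] fpf_perms_def permutes_in_image)
  moreover have "((p \<circ> q) ^^ k) y = (q ^^ k) y \<and> (q ^^ k) y \<in> X - K" if "y \<in> X - K" for k y
  proof (induction k)
    case (Suc k)
    then show ?case
      using permutes_in_image[of q "X - K" "(q ^^ k) y"] q
      by (auto simp: eq[unfolded comp_def] fpf_perms_def)
  qed (use that in simp)
  ultimately show ?thesis
    using p q eq by (auto simp: fpf_perms_def)
qed

lemma orbit_subset:
  assumes "x \<in> A" "\<And>y. y \<in> A \<Longrightarrow> s y \<in> A" "\<And>y. y \<in> A \<Longrightarrow> t y \<in> A"
  shows "orbit s t x \<subseteq> A"
proof -
  have "word_act s t w y \<in> A" if "y \<in> A" for w y
    using that by (induction w arbitrary: y) (auto simp: word_act_Cons assms)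
  then show ?thesis using assms(1) by (auto simp: orbit_def)
qed

lemma self_in_orbit: "x \<in> orbit s t x"
  unfolding orbit_def by (rule range_eqI[of _ _ "[]"]) simp

lemma orbit_closed:
  assumes "y \<in> orbit s t x"
  shows "s y \<in> orbit s t x" "t y \<in> orbit s t x"
proof -
  obtain w where w: "y = word_act s t w x" using assms by (auto simp: orbit_def)
  show "s y \<in> orbit s t x" unfolding orbit_def
    by (rule range_eqI[of _ _ "w @ [True]"]) (simp add: w word_act_append word_act_Cons)
  show "t y \<in> orbit s t x" unfolding orbit_def
    by (rule range_eqI[of _ _ "w @ [False]"]) (simp add: w word_act_append word_act_Cons)
qed

lemma orbit_cong:
  assumes "\<And>y. y \<in> A \<Longrightarrow> s y = s' y \<and> s y \<in> A" "\<And>y. y \<in> A \<Longrightarrow> t y = t' y \<and> t y \<in> A" "x \<in> A"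
  shows "orbit s t x = orbit s' t' x"
proof -
  have "word_act s t w y = word_act s' t' w y" if "y \<in> A" for w y
    using that
  proof (induction w arbitrary: y)
    case (Cons b w)
    then show ?case using assms(1,2)[of y] by (auto simp: word_act_Cons)
  qed simp
  then show ?thesis using assms(3) by (simp add: orbit_def)
qed

text \<open>Both the orbit K and its complement are invariant, so a pair splits into one on K that
  is transitive from x and an arbitrary one on the complement. Parts are extended by the identity,
  so composition joins them again.\<close>

lemma card_pairs_with_orbit:
  assumes X: "finite X" and K: "K \<subseteq> X" "x \<in> K"
  shows "card {(s, t) \<in> fpf_pairs j k X. orbit s t x = K} =
    card (transitive_pairs j k K x) * card (fpf_pairs j k (X - K))"
proof -
  have img: "p ` A = A" if "p permutes X" "A \<subseteq> X" "\<And>y. y \<in> A \<Longrightarrow> p y \<in> A" for p A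
    using that X permutes_inj[OF that(1)] finite_subset[of A X]
    by (intro endo_inj_surj) (auto intro: inj_on_subset)
  have img': "p ` (X - K) = X - K" if "p permutes X" "p ` K = K" for p
    using that permutes_inj[OF that(1)] by (simp add: image_set_diff permutes_image)
  let ?f = "\<lambda>(s, t). ((restr K s, restr K t), (restr (X - K) s, restr (X - K) t))"
  let ?g = "\<lambda>((s, t), (s', t')). (s \<circ> s', t \<circ> t')"
  have "bij_betw ?f {(s, t) \<in> fpf_pairs j k X. orbit s t x = K}
      (transitive_pairs j k K x \<times> fpf_pairs j k (X - K))"
  proof (rule bij_betw_byWitness[where f' = ?g])
    have join: "restr K p \<circ> restr (X - K) p = p" if "p permutes X" "p ` K = K" for p
      using that img'[OF that] K(1) by (intro ext) (auto simp: restr_def permutes_def)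
    have restr_comp: "restr K (p \<circ> q) = p \<and> restr (X - K) (p \<circ> q) = q"
      if "p \<in> fpf_perms n K" "q \<in> fpf_perms n (X - K)" for p q n
      using that fpf_perms_comp_eq[OF that] K(1)
      by (intro conjI ext) (auto simp: restr_def fpf_perms_def permutes_not_in)
    have perm: "s permutes X \<and> t permutes X \<and> s ` K = K \<and> t ` K = K \<and> s \<in> fpf_perms j X \<and> t \<in> fpf_perms k X"
      if "(s, t) \<in> fpf_pairs j k X" "orbit s t x = K" for s t
      using that img[OF _ K(1)] orbit_closed[of _ s t x] by (auto simp: fpf_pairs_def fpf_perms_def)
    show "\<forall>p\<in>{(s, t) \<in> fpf_pairs j k X. orbit s t x = K}. ?g (?f p) = p"
      using perm join by auto
    show "\<forall>p\<in>transitive_pairs j k K x \<times> fpf_pairs j k (X - K). ?f (?g p) = p"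
      using restr_comp by (auto simp: transitive_pairs_def fpf_pairs_def)
    show "?f ` {(s, t) \<in> fpf_pairs j k X. orbit s t x = K} \<subseteq>
        transitive_pairs j k K x \<times> fpf_pairs j k (X - K)"
    proof (rule image_subsetI)
      fix r assume "r \<in> {(s, t) \<in> fpf_pairs j k X. orbit s t x = K}"
      then obtain s t where r: "r = (s, t)" and st: "(s, t) \<in> fpf_pairs j k X" "orbit s t x = K"
        by auto
      note p = perm[OF st]
      have "orbit (restr K s) (restr K t) x = orbit s t x"
        by (rule orbit_cong[of K]) (use p K in \<open>auto simp: restr_def\<close>)
      moreover have "restr K s \<in> fpf_perms j K" "restr K t \<in> fpf_perms k K"
        "restr (X - K) s \<in> fpf_perms j (X - K)" "restr (X - K) t \<in> fpf_perms k (X - K)"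
        using p K img' by (auto intro!: restr_fpf_perms)
      ultimately show "?f r \<in> transitive_pairs j k K x \<times> fpf_pairs j k (X - K)"
        using st(2) by (simp add: r transitive_pairs_def fpf_pairs_def)
    qed
    show "?g ` (transitive_pairs j k K x \<times> fpf_pairs j k (X - K)) \<subseteq>
        {(s, t) \<in> fpf_pairs j k X. orbit s t x = K}"
    proof (rule image_subsetI)
      fix r assume "r \<in> transitive_pairs j k K x \<times> fpf_pairs j k (X - K)"
      then obtain s t s' t' where r: "r = ((s, t), (s', t'))"
        and 1: "(s, t) \<in> transitive_pairs j k K x" and 2: "(s', t') \<in> fpf_pairs j k (X - K)"
        by auto
      have s: "s \<in> fpf_perms j K" "t \<in> fpf_perms k K" "orbit s t x = K"
        using 1 by (auto simp: transitive_pairs_def fpf_pairs_def)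
      have s': "s' \<in> fpf_perms j (X - K)" "t' \<in> fpf_perms k (X - K)"
        using 2 by (auto simp: fpf_pairs_def)
      have "orbit s t x = orbit (s \<circ> s') (t \<circ> t') x"
        using fpf_perms_comp_eq[OF s(1) s'(1)] fpf_perms_comp_eq[OF s(2) s'(2)] K(2) s
        by (intro orbit_cong[of K]) (auto simp: fpf_perms_def permutes_in_image)
      then show "?g r \<in> {(s, t) \<in> fpf_pairs j k X. orbit s t x = K}"
        using s s' K fpf_perms_comp[of s j K s' X] fpf_perms_comp[of t k K t' X]
        by (simp add: r fpf_pairs_def)
    qed
  qed
  then show ?thesis
    by (simp add: bij_betw_same_card card_cartesian_product)
qed

lemma card_fpf_pairs_orbit_sum:
  assumes X: "finite X" "x \<in> X"
  shows "card (fpf_pairs j k X) =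
    (\<Sum>K | K \<subseteq> X \<and> x \<in> K. card (transitive_pairs j k K x) * card (fpf_pairs j k (X - K)))"
proof -
  let ?orb = "\<lambda>(s, t). orbit s t x"
  have "orbit s t x \<subseteq> X" if "(s, t) \<in> fpf_pairs j k X" for s t
    using that X(2) by (intro orbit_subset) (auto simp: fpf_pairs_def fpf_perms_def permutes_in_image)
  then have "?orb ` fpf_pairs j k X \<subseteq> {K. K \<subseteq> X \<and> x \<in> K}"
    using self_in_orbit[of x] by (intro image_subsetI) auto
  then have "card (fpf_pairs j k X) =
      (\<Sum>K | K \<subseteq> X \<and> x \<in> K. card {p \<in> fpf_pairs j k X. ?orb p = K})"
    using sum.group[OF finite_fpf_pairs[OF X(1), of j k], of "{K. K \<subseteq> X \<and> x \<in> K}" ?orb "\<lambda>_. 1 :: nat"] X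
    by simp
  also have "\<dots> = (\<Sum>K | K \<subseteq> X \<and> x \<in> K. card (transitive_pairs j k K x) * card (fpf_pairs j k (X - K)))"
  proof (rule sum.cong)
    fix K assume "K \<in> {K. K \<subseteq> X \<and> x \<in> K}"
    moreover have "{p \<in> fpf_pairs j k X. ?orb p = K} = {(s, t) \<in> fpf_pairs j k X. orbit s t x = K}"
      by auto
    ultimately show "card {p \<in> fpf_pairs j k X. ?orb p = K} =
        card (transitive_pairs j k K x) * card (fpf_pairs j k (X - K))"
      using card_pairs_with_orbit[OF X(1)] by simp
  qed simp
  finally show ?thesis .
qed

lemma sum_pointed_subsets:
  fixes F :: "nat \<Rightarrow> nat"
  assumes X: "finite X" "x \<in> X"
  shows "(\<Sum>K | K \<subseteq> X \<and> x \<in> K. F (card K)) =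
    (\<Sum>k = 1..card X. ((card X - 1) choose (k - 1)) * F k)"
proof -
  define Y where "Y = X - {x}"
  have Y: "finite Y" "x \<notin> Y" "X = insert x Y" "card X = Suc (card Y)"
    using X card.remove[OF X] by (auto simp: Y_def)
  have "(\<Sum>K | K \<subseteq> X \<and> x \<in> K. F (card K)) = (\<Sum>L\<in>Pow Y. F (Suc (card L)))"
  proof (rule sum.reindex_bij_witness[of _ "insert x" "\<lambda>K. K - {x}"])
    fix L assume "L \<in> Pow Y"
    then show "insert x L - {x} = L" using Y by auto
  next
    fix K assume "K \<in> {K. K \<subseteq> X \<and> x \<in> K}"
    then have "finite K" "x \<in> K" using X(1) finite_subset by auto
    then show "F (Suc (card (K - {x}))) = F (card K)" by (simp only: card.remove)
  qed (use Y in auto)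
  also have "\<dots> = (\<Sum>l\<in>{0..card Y}. \<Sum>L | L \<in> Pow Y \<and> card L = l. F (Suc (card L)))"
    using Y(1) by (subst sum.group) (auto intro: card_mono)
  also have "\<dots> = (\<Sum>l\<in>{0..card Y}. (card Y choose l) * F (Suc l))"
  proof (rule sum.cong)
    fix l
    have "(\<Sum>L | L \<in> Pow Y \<and> card L = l. F (Suc (card L))) = (\<Sum>L | L \<subseteq> Y \<and> card L = l. F (Suc l))"
      by (rule sum.cong) auto
    then show "(\<Sum>L | L \<in> Pow Y \<and> card L = l. F (Suc (card L))) = (card Y choose l) * F (Suc l)"
      by (simp add: n_subsets[OF Y(1)])
  qed simp
  also have "\<dots> = (\<Sum>k = 1..card X. ((card X - 1) choose (k - 1)) * F k)"
    using sum.shift_bounds_cl_Suc_ivl[of "\<lambda>k. (card Y choose (k - 1)) * F k" 0 "card Y"]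
    by (simp add: Y(4))
  finally show ?thesis .
qed

section \<open>Numbers of fixed-point free permutations of orders 2 and 3\<close>

lemma fpf_perms_one: "fpf_perms 1 X = {id}"
proof -
  have "p = id" if "p permutes X" "\<forall>x\<in>X. p x = x" for p
    using that permutes_not_in by fastforce
  then show ?thesis by (auto simp: fpf_perms_def permutes_id)
qed

lemma card_fpf_pairs_one: "card (fpf_pairs j 1 X) = card (fpf_perms j X)"
  by (simp only: fpf_pairs_def fpf_perms_one card_cartesian_product) simp

lemma fpf_perms_empty: "fpf_perms n {} = {id}"
  by (auto simp: fpf_perms_def)

lemma transitive_pairs_one:
  "transitive_pairs j 1 K x = (\<lambda>s. (s, id)) ` {s \<in> fpf_perms j K. orbit s id x = K}"
  unfolding transitive_pairs_def fpf_pairs_def fpf_perms_one by auto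

lemma card_transitive_pairs_one:
  "card (transitive_pairs j 1 K x) = card {s \<in> fpf_perms j K. orbit s id x = K}"
  unfolding transitive_pairs_one by (rule card_image) (auto simp: inj_on_def)

lemma card_transitive_pairs_2:
  assumes "x \<in> K"
  shows "card (transitive_pairs 2 1 K x) = (if card K = 2 then 1 else 0)"
proof -
  have val: "s x \<in> K" "s x \<noteq> x" "s (s x) = x" if "s \<in> fpf_perms 2 K" for s
    using that assms by (auto simp: fpf_perms_def permutes_in_image eval_nat_numeral)
  have orb: "orbit s id x = {x, s x}" if "s \<in> fpf_perms 2 K" for s
  proof
    show "orbit s id x \<subseteq> {x, s x}"
      by (rule orbit_subset) (use val[OF that] in auto)
    show "{x, s x} \<subseteq> orbit s id x"
      using self_in_orbit[of x s id] orbit_closed(1)[OF self_in_orbit, of s x id] by simp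
  qed
  show ?thesis
  proof (cases "card K = 2")
    case True
    then obtain y where y: "K = {x, y}" "x \<noteq> y"
      using assms by (auto simp: card_2_iff)
    have "{s \<in> fpf_perms 2 K. orbit s id x = K} = {Transposition.transpose x y}"
    proof (intro equalityI subsetI)
      fix s assume s: "s \<in> {s \<in> fpf_perms 2 K. orbit s id x = K}"
      then have "s x = y" "s y = x" using val[of s] y by auto
      moreover have "s z = z" if "z \<notin> {x, y}" for z
        using s permutes_not_in[of s K z] that y by (simp add: fpf_perms_def)
      ultimately have "s z = Transposition.transpose x y z" for z
        by (simp add: Transposition.transpose_def)
      then have "s = Transposition.transpose x y" by (rule ext)
      then show "s \<in> {Transposition.transpose x y}" by simp
    next
      fix s assume "s \<in> {Transposition.transpose x y}"
      then have s: "s = Transposition.transpose x y" by simp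
      have "s \<in> fpf_perms 2 K"
        using y by (auto simp: s fpf_perms_def eval_nat_numeral intro: permutes_swap_id)
      then show "s \<in> {s \<in> fpf_perms 2 K. orbit s id x = K}"
        using orb y by (simp add: s)
    qed
    then show ?thesis by (simp only: card_transitive_pairs_one True) simp
  next
    case False
    have "{s \<in> fpf_perms 2 K. orbit s id x = K} = {}"
    proof (rule ccontr)
      assume "{s \<in> fpf_perms 2 K. orbit s id x = K} \<noteq> {}"
      then obtain s where "s \<in> fpf_perms 2 K" "K = {x, s x}" using orb by auto
      moreover from this have "s x \<noteq> x" using val(2) by blast
      ultimately have "card K = 2" by (simp add: card_insert_if)
      then show False using False by simp
    qed
    then show ?thesis using False by (simp only: card_transitive_pairs_one) simp
  qed
qed

lemma three_cycle_fpf: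
  assumes "distinct [x, y, z]"
  shows "Transposition.transpose x y \<circ> Transposition.transpose y z \<in> fpf_perms 3 {x, y, z}"
proof -
  have "Transposition.transpose x y \<circ> Transposition.transpose y z permutes {x, y, z}"
    by (intro permutes_compose permutes_swap_id) auto
  then show ?thesis
    using assms by (auto simp: fpf_perms_def eval_nat_numeral Transposition.transpose_def)
qed

text \<open>The image of x decides the cycle, whence exactly two of them on three points.\<close>

lemma three_cycle_unique:
  assumes d: "distinct [x, y, z]" and s: "s \<in> fpf_perms 3 {x, y, z}" "s x = y"
  shows "s = Transposition.transpose x y \<circ> Transposition.transpose y z"
proof -
  have "\<forall>w\<in>{x, y, z}. s w \<in> {x, y, z} \<and> s w \<noteq> w \<and> s (s (s w)) = w"
    using s(1) permutes_in_image[of s "{x, y, z}"] by (auto simp: fpf_perms_def eval_nat_numeral)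
  then have v: "s w \<in> {x, y, z}" "s w \<noteq> w" "s (s (s w)) = w" if "w \<in> {x, y, z}" for w
    using that by blast+
  have sy: "s y = z"
    using v(1,2)[of y] v(3)[of x] d s(2) by auto
  have sz: "s z = x"
    using v(3)[of x] s(2) sy by auto
  show ?thesis
  proof
    fix w
    consider "w = x" | "w = y" | "w = z" | "w \<notin> {x, y, z}" by blast
    then show "s w = (Transposition.transpose x y \<circ> Transposition.transpose y z) w"
    proof cases
      case 4
      then have "s w = w" using s(1) permutes_not_in[of s "{x, y, z}" w] by (simp add: fpf_perms_def)
      then show ?thesis using 4 by (simp add: Transposition.transpose_def)
    qed (use sy sz s(2) d in \<open>auto simp: Transposition.transpose_def\<close>)
  qed
qed

lemma card_transitive_pairs_3:
  assumes "x \<in> K"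
  shows "card (transitive_pairs 3 1 K x) = (if card K = 3 then 2 else 0)"
proof -
  have val: "s x \<in> K" "s (s x) \<in> K" "s x \<noteq> x" "s (s x) \<noteq> s x" "s (s x) \<noteq> x" "s (s (s x)) = x"
    if "s \<in> fpf_perms 3 K" for s
  proof -
    show 1: "s x \<in> K" "s (s x) \<in> K" "s x \<noteq> x" "s (s x) \<noteq> s x" "s (s (s x)) = x"
      using that assms by (auto simp: fpf_perms_def permutes_in_image eval_nat_numeral)
    then show "s (s x) \<noteq> x" by metis
  qed
  have orb: "orbit s id x = {x, s x, s (s x)}" if "s \<in> fpf_perms 3 K" for s
  proof
    show "orbit s id x \<subseteq> {x, s x, s (s x)}"
      by (rule orbit_subset) (use val[OF that] in auto)
    show "{x, s x, s (s x)} \<subseteq> orbit s id x"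
      using self_in_orbit[of x s id] orbit_closed(1)[of _ s id x] by simp
  qed
  show ?thesis
  proof (cases "card K = 3")
    case True
    then have "card (K - {x}) = 2" using assms by (simp add: card_Diff_singleton)
    then obtain y z where "K - {x} = {y, z}" "y \<noteq> z" by (auto simp: card_2_iff)
    then have K: "K = {x, y, z}" "distinct [x, y, z]" using assms by auto
    let ?c = "Transposition.transpose x y \<circ> Transposition.transpose y z"
    let ?d = "Transposition.transpose x z \<circ> Transposition.transpose z y"
    have cd: "?c x = y" "?d x = z" using K(2) by auto
    have "{s \<in> fpf_perms 3 K. orbit s id x = K} = {?c, ?d}"
    proof (intro equalityI subsetI)
      fix s assume "s \<in> {s \<in> fpf_perms 3 K. orbit s id x = K}"
      then have s: "s \<in> fpf_perms 3 {x, y, z}" using K by simp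
      then consider "s x = y" | "s x = z" using val[of s] K by auto
      then show "s \<in> {?c, ?d}"
      proof cases
        case 1
        then show ?thesis using three_cycle_unique[OF K(2) s] by simp
      next
        case 2
        have "{x, z, y} = {x, y, z}" by auto
        then show ?thesis using 2 three_cycle_unique[of x z y s] s K(2) by auto
      qed
    next
      fix s assume "s \<in> {?c, ?d}"
      moreover have "{x, z, y} = {x, y, z}" by auto
      ultimately have s: "s \<in> fpf_perms 3 K"
        using three_cycle_fpf[OF K(2)] three_cycle_fpf[of x z y] K by auto
      have "{x, s x, s (s x)} = K"
        by (rule card_subset_eq) (use val[OF s] assms True in \<open>auto simp: K(1)\<close>)
      then show "s \<in> {s \<in> fpf_perms 3 K. orbit s id x = K}"
        using orb s by simp
    qed
    moreover have "?c \<noteq> ?d" using cd K(2) by (metis distinct_length_2_or_more)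
    ultimately show ?thesis by (simp only: card_transitive_pairs_one True) simp
  next
    case False
    have "{s \<in> fpf_perms 3 K. orbit s id x = K} = {}"
    proof (rule ccontr)
      assume "{s \<in> fpf_perms 3 K. orbit s id x = K} \<noteq> {}"
      then obtain s where "s \<in> fpf_perms 3 K" "K = {x, s x, s (s x)}" using orb by auto
      moreover from this have "s x \<noteq> x" "s (s x) \<noteq> s x" "s (s x) \<noteq> x" using val(3-5) by blast+
      ultimately have "card K = 3" by (simp add: card_insert_if)
      then show False using False by simp
    qed
    then show ?thesis using False by (simp only: card_transitive_pairs_one) simp
  qed
qed

text \<open>The recursion removes the cycle through one chosen point, here by choosing its partner
  and below by choosing its two successors in order.\<close>

fun involution_count :: "nat \<Rightarrow> nat" where
  "involution_count 0 = 1"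
| "involution_count (Suc 0) = 0"
| "involution_count (Suc (Suc n)) = Suc n * involution_count n"

fun three_cycle_count :: "nat \<Rightarrow> nat" where
  "three_cycle_count 0 = 1"
| "three_cycle_count (Suc 0) = 0"
| "three_cycle_count (Suc (Suc 0)) = 0"
| "three_cycle_count (Suc (Suc (Suc n))) = Suc (Suc n) * Suc n * three_cycle_count n"

text \<open>Orbit decomposition with trivial second permutation: only orbits of size 2 contribute,
  which is the recursion of \<open>involution_count\<close>. The case of order 3 is
  analogous.\<close>

lemma card_fpf_perms_2:
  "finite X \<Longrightarrow> card (fpf_perms 2 X) = involution_count (card X)"
proof (induction "card X" arbitrary: X rule: less_induct)
  case less
  show ?case
  proof (cases "X = {}")
    case False
    then obtain x where x: "x \<in> X" by blast
    let ?n = "card X"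
    have n: "?n > 0" using x less.prems card_gt_0_iff by blast
    have "card (fpf_perms 2 X) = (\<Sum>K | K \<subseteq> X \<and> x \<in> K.
        card (transitive_pairs 2 1 K x) * card (fpf_perms 2 (X - K)))"
      using card_fpf_pairs_orbit_sum[OF less.prems x, of 2 1] by (simp only: card_fpf_pairs_one)
    also have "\<dots> = (\<Sum>K | K \<subseteq> X \<and> x \<in> K. (if card K = 2 then 1 else 0) * involution_count (?n - card K))"
    proof (rule sum.cong)
      fix K assume K: "K \<in> {K. K \<subseteq> X \<and> x \<in> K}"
      then have "X - K \<subset> X" "card (X - K) = ?n - card K"
        using x less.prems by (auto simp: card_Diff_subset finite_subset)
      moreover from this have "card (X - K) < ?n" using less.prems psubset_card_mono by metis
      ultimately have "card (fpf_perms 2 (X - K)) = involution_count (?n - card K)"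
        using less.hyps[of "X - K"] less.prems by simp
      then show "card (transitive_pairs 2 1 K x) * card (fpf_perms 2 (X - K)) =
          (if card K = 2 then 1 else 0) * involution_count (?n - card K)"
        using K by (simp only: card_transitive_pairs_2 mem_Collect_eq)
    qed simp
    also have "\<dots> = (\<Sum>k = 1..?n. ((?n - 1) choose (k - 1)) * ((if k = 2 then 1 else 0) * involution_count (?n - k)))"
      by (rule sum_pointed_subsets[OF less.prems x])
    also have "\<dots> = (\<Sum>k = 1..?n. if k = 2 then (?n - 1) * involution_count (?n - 2) else 0)"
      by (rule sum.cong) auto
    also have "\<dots> = involution_count ?n"
      using n by (cases ?n rule: involution_count.cases) (simp_all add: sum.delta)
    finally show ?thesis .
  qed (simp add: fpf_perms_empty)
qed

lemma card_fpf_perms_3: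
  "finite X \<Longrightarrow> card (fpf_perms 3 X) = three_cycle_count (card X)"
proof (induction "card X" arbitrary: X rule: less_induct)
  case less
  show ?case
  proof (cases "X = {}")
    case False
    then obtain x where x: "x \<in> X" by blast
    let ?n = "card X"
    have n: "?n > 0" using x less.prems card_gt_0_iff by blast
    have "card (fpf_perms 3 X) = (\<Sum>K | K \<subseteq> X \<and> x \<in> K.
        card (transitive_pairs 3 1 K x) * card (fpf_perms 3 (X - K)))"
      using card_fpf_pairs_orbit_sum[OF less.prems x, of 3 1] by (simp only: card_fpf_pairs_one)
    also have "\<dots> = (\<Sum>K | K \<subseteq> X \<and> x \<in> K. (if card K = 3 then 2 else 0) * three_cycle_count (?n - card K))"
    proof (rule sum.cong)
      fix K assume K: "K \<in> {K. K \<subseteq> X \<and> x \<in> K}"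
      then have "X - K \<subset> X" "card (X - K) = ?n - card K"
        using x less.prems by (auto simp: card_Diff_subset finite_subset)
      moreover from this have "card (X - K) < ?n" using less.prems psubset_card_mono by metis
      ultimately have "card (fpf_perms 3 (X - K)) = three_cycle_count (?n - card K)"
        using less.hyps[of "X - K"] less.prems by simp
      then show "card (transitive_pairs 3 1 K x) * card (fpf_perms 3 (X - K)) =
          (if card K = 3 then 2 else 0) * three_cycle_count (?n - card K)"
        using K by (simp only: card_transitive_pairs_3 mem_Collect_eq)
    qed simp
    also have "\<dots> = (\<Sum>k = 1..?n. ((?n - 1) choose (k - 1)) * ((if k = 3 then 2 else 0) * three_cycle_count (?n - k)))"
      by (rule sum_pointed_subsets[OF less.prems x])
    also have "\<dots> = (\<Sum>k = 1..?n. if k = 3 then (?n - 1) * (?n - 2) * three_cycle_count (?n - 3) else 0)"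
    proof (rule sum.cong)
      have "(m choose 2) * 2 = m * (m - 1)" for m :: nat
      proof -
        have "even (m * (m - 1))" by (cases m) auto
        then show ?thesis by (simp add: choose_two)
      qed
      from this[of "?n - 1"] have c: "((?n - 1) choose 2) * 2 = (?n - 1) * (?n - 2)"
        by (simp add: numeral_2_eq_2)
      show "((?n - 1) choose (k - 1)) * ((if k = 3 then 2 else 0) * three_cycle_count (?n - k)) =
          (if k = 3 then (?n - 1) * (?n - 2) * three_cycle_count (?n - 3) else 0)" for k
        unfolding c[symmetric] by simp
    qed simp
    also have "\<dots> = three_cycle_count ?n"
      using n by (cases ?n rule: three_cycle_count.cases) (simp_all add: sum.delta)
    finally show ?thesis .
  qed (simp add: fpf_perms_empty)
qed

lemma involution_count_even: "involution_count (2 * m) * (2 ^ m * fact m) = fact (2 * m)"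
proof (induction m)
  case (Suc m)
  have "involution_count (2 * Suc m) * (2 ^ Suc m * fact (Suc m)) =
      (2 * m + 1) * (2 * m + 2) * (involution_count (2 * m) * (2 ^ m * fact m))"
    by (simp add: algebra_simps)
  then show ?case by (simp only: Suc) (simp add: algebra_simps)
qed simp

lemma three_cycle_count_mult_3: "three_cycle_count (3 * m) * (3 ^ m * fact m) = fact (3 * m)"
proof (induction m)
  case (Suc m)
  have eq: "3 * Suc m = Suc (Suc (Suc (3 * m)))" by simp
  have "three_cycle_count (3 * Suc m) * (3 ^ Suc m * fact (Suc m)) =
      (3 * m + 3) * (3 * m + 2) * (3 * m + 1) * (three_cycle_count (3 * m) * (3 ^ m * fact m))"
    unfolding eq by (simp add: algebra_simps)
  also have "\<dots> = fact (3 * Suc m)"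
    unfolding Suc eq fact_Suc by (simp add: algebra_simps)
  finally show ?case .
qed simp

lemma involution_count_odd: "odd n \<Longrightarrow> involution_count n = 0"
  by (induction n rule: involution_count.induct) auto

lemma three_cycle_count_not_dvd: "\<not> 3 dvd n \<Longrightarrow> three_cycle_count n = 0"
proof (induction n rule: three_cycle_count.induct)
  case (4 n)
  have "Suc (Suc (Suc n)) = n + 3" by simp
  then have "\<not> 3 dvd n" using 4 by (metis dvd_add_triv_right_iff)
  then show ?case using 4 by simp
qed auto

lemma card_fpf_pairs_2_3:
  "finite X \<Longrightarrow> card (fpf_pairs 2 3 X) = involution_count (card X) * three_cycle_count (card X)"
  by (simp add: fpf_pairs_def card_cartesian_product card_fpf_perms_2 card_fpf_perms_3)

text \<open>
  The number of pairs of fixed-point free permutations of orders 2 and 3 on \<open>6 l\<close> points is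
  \<open>(6 l)!\<close> times \<open>e_coeff l / 72 ^ l\<close>; the division in the definition is exact.
\<close>

definition e_coeff :: "nat \<Rightarrow> nat" where
  "e_coeff l = fact (6 * l) div (fact (3 * l) * fact (2 * l))"

text \<open>(6 l)! / (l! (2 l)! (3 l)!) is a multinomial coefficient, so even the additional factor
  l! divides out.\<close>

lemma e_coeff_mult: "e_coeff l * (fact (3 * l) * fact (2 * l)) = fact (6 * l)"
  and fact_dvd_e_coeff: "fact l dvd e_coeff l"
proof -
  have "(fact (3 * l) * fact (2 * l) :: nat) dvd fact (5 * l)"
    using fact_fact_dvd_fact[of "3 * l" "2 * l", where 'a = nat]
    by (simp only: flip: distrib_right) simp
  moreover have "(fact l * fact (5 * l) :: nat) dvd fact (6 * l)"
    using fact_fact_dvd_fact[of l "5 * l"] by simp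
  ultimately have "(fact l * (fact (3 * l) * fact (2 * l)) :: nat) dvd fact (6 * l)"
    by (meson dvd_trans mult_dvd_mono dvd_refl)
  then obtain c :: nat where c: "fact (6 * l) = fact l * (fact (3 * l) * fact (2 * l)) * c"
    by (auto elim: dvdE)
  then have "e_coeff l = fact l * c" by (simp add: e_coeff_def)
  then show "e_coeff l * (fact (3 * l) * fact (2 * l)) = fact (6 * l)" "fact l dvd e_coeff l"
    using c by (simp_all add: ac_simps)
qed

text \<open>72 = 8 * 9, where 8^l = 2^(3 l) stems from the 3 l transpositions and 9^l = 3^(2 l) from
  the 2 l three-cycles.\<close>

lemma fpf_count_eq_e_coeff:
  "involution_count (6 * l) * three_cycle_count (6 * l) * 72 ^ l = fact (6 * l) * e_coeff l"
proof -
  let ?F = "fact (3 * l) * fact (2 * l) :: nat"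
  have 1: "involution_count (6 * l) * (8 ^ l * fact (3 * l)) = fact (6 * l)"
    using involution_count_even[of "3 * l"] by (simp add: power_mult)
  have 2: "three_cycle_count (6 * l) * (9 ^ l * fact (2 * l)) = fact (6 * l)"
    using three_cycle_count_mult_3[of "2 * l"] by (simp add: power_mult)
  have "(72 :: nat) ^ l = 8 ^ l * 9 ^ l" by (simp flip: power_mult_distrib)
  then have "involution_count (6 * l) * three_cycle_count (6 * l) * 72 ^ l * ?F =
      (involution_count (6 * l) * (8 ^ l * fact (3 * l))) * (three_cycle_count (6 * l) * (9 ^ l * fact (2 * l)))"
    by (simp only: ac_simps)
  also have "\<dots> = fact (6 * l) * (e_coeff l * ?F)"
    by (simp only: 1 2 e_coeff_mult)
  finally have "involution_count (6 * l) * three_cycle_count (6 * l) * 72 ^ l * ?F =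
      fact (6 * l) * e_coeff l * ?F" by (simp only: ac_simps)
  moreover have "?F \<noteq> 0" by simp
  ultimately show ?thesis using mult_right_cancel by blast
qed

text \<open>The coefficient at l of (F - 1) E = 6 z E', multiplied by 72^l. In the decomposition of
  all pairs on 6 l points, the binomial coefficient times (6 k - 1)! (6 (l - k))! is (6 l - 1)!;
  this cancels against the (6 l)! on the left and leaves the factor 6 l.\<close>

theorem free_subgroup_number_recurrence:
  assumes "l > 0"
  shows "6 * l * e_coeff l = (\<Sum>k = 1..l. free_subgroup_number k * 72 ^ k * e_coeff (l - k))"
proof -
  define f where "f k = card (free_subgroups k)" for k
  define h where "h n = involution_count n * three_cycle_count n" for n
  have f: "f (6 * k) = free_subgroup_number k" for k
    by (simp add: f_def free_subgroups_def free_subgroup_number_def)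
  let ?X = "{..<6 * l}"
  have tr: "card (transitive_pairs 2 3 K 0) = fact (card K - 1) * f (card K)"
    if "K \<subseteq> ?X" "0 \<in> K" for K :: "nat set"
    using that card_transitive_pairs[of K 0] finite_subset[of K ?X] by (simp add: f_def)
  have "h (6 * l) = card (fpf_pairs 2 3 ?X)"
    by (simp add: card_fpf_pairs_2_3 h_def)
  also have "\<dots> = (\<Sum>K | K \<subseteq> ?X \<and> 0 \<in> K. card (transitive_pairs 2 3 K 0) * card (fpf_pairs 2 3 (?X - K)))"
    using assms by (intro card_fpf_pairs_orbit_sum) auto
  also have "\<dots> = (\<Sum>K | K \<subseteq> ?X \<and> 0 \<in> K. fact (card K - 1) * f (card K) * h (6 * l - card K))"
  proof (rule sum.cong)
    fix K assume "K \<in> {K. K \<subseteq> ?X \<and> 0 \<in> K}"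
    then show "card (transitive_pairs 2 3 K 0) * card (fpf_pairs 2 3 (?X - K)) =
        fact (card K - 1) * f (card K) * h (6 * l - card K)"
      by (auto simp: tr card_fpf_pairs_2_3 h_def card_Diff_subset finite_subset)
  qed simp
  also have "\<dots> = (\<Sum>k = 1..6 * l. ((6 * l - 1) choose (k - 1)) * (fact (k - 1) * f k * h (6 * l - k)))"
    using assms by (subst sum_pointed_subsets) auto
  also have "\<dots> = (\<Sum>k\<in>(*) 6 ` {1..l}. ((6 * l - 1) choose (k - 1)) * (fact (k - 1) * f k * h (6 * l - k)))"
  proof (rule sum.mono_neutral_right)
    show "\<forall>k\<in>{1..6 * l} - (*) 6 ` {1..l}. ((6 * l - 1) choose (k - 1)) * (fact (k - 1) * f k * h (6 * l - k)) = 0"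
    proof
      \<comment> \<open>For k not divisible by 6 there are no pairs at all on k points, hence no
        transitive ones, and so no free subgroup of index k.\<close>
      fix k assume k: "k \<in> {1..6 * l} - (*) 6 ` {1..l}"
      have "\<not> 6 dvd k"
        using k by (auto simp: image_iff elim!: dvdE)
      then have "\<not> 2 dvd k \<or> \<not> 3 dvd k" by presburger
      then have "h k = 0" by (auto simp: h_def involution_count_odd three_cycle_count_not_dvd)
      then have "card (fpf_pairs 2 3 {..<k}) = 0" by (simp add: card_fpf_pairs_2_3 h_def)
      then have "fpf_pairs 2 3 {..<k} = {}" using finite_fpf_pairs[of "{..<k}" 2 3] by simp
      then have "transitive_pairs 2 3 {..<k} 0 = {}" by (auto simp: transitive_pairs_def)
      then have "f k = 0"
        using tr[of "{..<k}"] k by auto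
      then show "((6 * l - 1) choose (k - 1)) * (fact (k - 1) * f k * h (6 * l - k)) = 0" by simp
    qed
  qed auto
  also have "\<dots> = (\<Sum>k = 1..l. ((6 * l - 1) choose (6 * k - 1)) *
      (fact (6 * k - 1) * free_subgroup_number k * h (6 * (l - k))))"
    by (subst sum.reindex) (auto simp: inj_on_def f diff_mult_distrib2)
  finally have H: "h (6 * l) = \<dots>" .
  have hl: "h (6 * j) * 72 ^ j = fact (6 * j) * e_coeff j" for j
    using fpf_count_eq_e_coeff[of j] by (simp add: h_def)
  have "fact (6 * l - 1) * (6 * l * e_coeff l) = h (6 * l) * 72 ^ l"
    using assms by (simp add: hl fact_reduce[of "6 * l"])
  also have "\<dots> = (\<Sum>k = 1..l. fact (6 * l - 1) * (free_subgroup_number k * 72 ^ k * e_coeff (l - k)))"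
    unfolding H sum_distrib_right
  proof (rule sum.cong)
    fix k assume k: "k \<in> {1..l}"
    have "6 * l - 1 - (6 * k - 1) = 6 * (l - k)" using k by auto
    then have c: "fact (6 * k - 1) * fact (6 * (l - k)) * ((6 * l - 1) choose (6 * k - 1)) = fact (6 * l - 1)"
      using binomial_fact_lemma[of "6 * k - 1" "6 * l - 1"] k by auto
    have "(72 :: nat) ^ l = 72 ^ k * 72 ^ (l - k)" using k by (simp flip: power_add)
    then have "((6 * l - 1) choose (6 * k - 1)) * (fact (6 * k - 1) * free_subgroup_number k * h (6 * (l - k))) * 72 ^ l
      = ((6 * l - 1) choose (6 * k - 1)) * fact (6 * k - 1) * free_subgroup_number k * 72 ^ k * (h (6 * (l - k)) * 72 ^ (l - k))"
      by (simp only: ac_simps)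
    also have "\<dots> = (fact (6 * k - 1) * fact (6 * (l - k)) * ((6 * l - 1) choose (6 * k - 1))) *
        (free_subgroup_number k * 72 ^ k * e_coeff (l - k))"
      unfolding hl by (simp only: ac_simps)
    finally show "((6 * l - 1) choose (6 * k - 1)) * (fact (6 * k - 1) * free_subgroup_number k * h (6 * (l - k))) * 72 ^ l
      = fact (6 * l - 1) * (free_subgroup_number k * 72 ^ k * e_coeff (l - k))"
      unfolding c .
  qed simp
  finally show ?thesis
    by (simp flip: sum_distrib_left)
qed

section \<open>Logarithmic derivatives modulo prime powers\<close>

unbundle no vec_syntax
unbundle fps_syntax
hide_const (open) up_ring.coeff up_ring.monom Module.smult

lemma fps_const_dvd_iff:
  fixes F :: "int fps"
  shows "fps_const m dvd F \<longleftrightarrow> (\<forall>n. m dvd F $ n)"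
proof
  assume "\<forall>n. m dvd F $ n"
  then have "F = fps_const m * Abs_fps (\<lambda>n. F $ n div m)"
    by (intro fps_ext) simp
  then show "fps_const m dvd F" by (metis dvd_triv_left)
qed (auto elim!: dvdE)

lemma fps_cong_iff: "fps_cong F G m \<longleftrightarrow> fps_const m dvd F - G"
  by (simp add: fps_cong_def fps_const_dvd_iff cong_iff_dvd_diff)

lemma dvd_diff_mult_cancel:
  fixes F :: "'a :: comm_ring_1"
  assumes "m dvd F * X - G * X" "X * Y = 1"
  shows "m dvd F - G"
proof -
  have "F - G = (F * X - G * X) * Y"
    using assms(2) by (simp add: left_diff_distrib mult.assoc)
  then show ?thesis using assms(1) by simp
qed

abbreviation geom :: "int \<Rightarrow> int fps" where
  "geom r \<equiv> Abs_fps (\<lambda>n. r ^ n)"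

lemma geom_mult: "(1 - fps_const r * fps_X) * geom r = 1"
proof (rule fps_ext)
  show "((1 - fps_const r * fps_X) * geom r) $ n = (1 :: int fps) $ n" for n
    by (cases n) (simp_all add: left_diff_distrib mult.assoc)
qed

section \<open>Lifting simple roots\<close>

lemma poly_add_Taylor:
  fixes h :: "int poly"
  shows "\<exists>k. poly h (x + t) = poly h x + t * poly (pderiv h) x + t ^ 2 * k"
proof (induction h)
  case (pCons c h)
  then obtain k where k: "poly h (x + t) = poly h x + t * poly (pderiv h) x + t ^ 2 * k" by blast
  show ?case
    by (rule exI[of _ "poly (pderiv h) x + x * k + t * k"])
       (simp only: poly_pCons pderiv_pCons poly_add k, simp add: algebra_simps power2_eq_square)
qed simp

lemma poly_int_cong:
  fixes h :: "int poly"
  shows "[x = y] (mod m) \<Longrightarrow> [poly h x = poly h y] (mod m)"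
  by (induction h) (auto intro: cong_add cong_mult)

text \<open>Newton's step: with h(x) = p^n c, the correction p^n d is chosen such that h'(x) d = -c
  modulo p. The quadratic error contains p^(2 n), which p^(n + 1) divides because n > 0, and h'(x)
  stays a unit because x does not change modulo p.\<close>

lemma hensel_simple_root:
  fixes h :: "int poly" and p x0 :: int
  assumes p: "prime p" and root: "p dvd poly h x0" and simple: "\<not> p dvd poly (pderiv h) x0"
  shows "n > 0 \<Longrightarrow> \<exists>x. [x = x0] (mod p) \<and> p ^ n dvd poly h x"
proof (induction n)
  case (Suc n)
  show ?case
  proof (cases "n = 0")
    case True
    then show ?thesis using root by (intro exI[of _ x0]) auto
  next
    case False
    then obtain x where x: "[x = x0] (mod p)" "p ^ n dvd poly h x" using Suc by blast
    then obtain c where c: "poly h x = p ^ n * c" by (auto elim: dvdE)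
    have "[poly (pderiv h) x = poly (pderiv h) x0] (mod p)"
      using x(1) by (rule poly_int_cong)
    then have "coprime (poly (pderiv h) x) p"
      using simple p by (metis cong_dvd_iff coprime_commute prime_imp_coprime)
    then obtain d where d: "[poly (pderiv h) x * d = - c] (mod p)"
      by (metis cong_solve_coprime_int cong_scalar_right mult.assoc mult_1 mult.commute)
    obtain k where k: "poly h (x + p ^ n * d) =
        poly h x + p ^ n * d * poly (pderiv h) x + (p ^ n * d) ^ 2 * k"
      using poly_add_Taylor by blast
    have "poly h (x + p ^ n * d) = p ^ n * (poly (pderiv h) x * d - (- c)) + p ^ (2 * n) * (d ^ 2 * k)"
    proof -
      have "(p ^ n * d) ^ 2 = p ^ (2 * n) * d ^ 2"
        by (simp add: power_mult_distrib mult.commute[of 2] flip: power_mult)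
      then show ?thesis by (simp add: k c distrib_left mult.assoc mult.left_commute)
    qed
    moreover have "p ^ Suc n dvd p ^ n * (poly (pderiv h) x * d - (- c))"
      using d unfolding cong_iff_dvd_diff by (simp add: mult.commute)
    moreover have "p ^ Suc n dvd p ^ (2 * n)"
      using False by (intro le_imp_power_dvd) auto
    ultimately have "p ^ Suc n dvd poly h (x + p ^ n * d)"
      by (metis dvd_add dvd_mult2)
    moreover have "[x + p ^ n * d = x0] (mod p)"
    proof -
      have "p dvd (x - x0) + p ^ n * d"
        using x(1) False by (intro dvd_add) (auto simp: cong_iff_dvd_diff)
      then show ?thesis by (simp add: cong_iff_dvd_diff algebra_simps)
    qed
    ultimately show ?thesis by blast
  qed
qed simp

text \<open>Says that the series is a polynomial modulo m.\<close>

definition eventually_dvd :: "int \<Rightarrow> int fps \<Rightarrow> bool" where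
  "eventually_dvd m F \<longleftrightarrow> (\<exists>N. \<forall>n\<ge>N. m dvd F $ n)"

lemma eventually_dvd_add: "eventually_dvd m F \<Longrightarrow> eventually_dvd m G \<Longrightarrow> eventually_dvd m (F + G)"
  unfolding eventually_dvd_def by (metis dvd_add fps_add_nth le_cases order_trans)

lemma eventually_dvd_mult:
  assumes "eventually_dvd m F" "eventually_dvd m G"
  shows "eventually_dvd m (F * G)"
proof -
  obtain M N where M: "\<And>n. n \<ge> M \<Longrightarrow> m dvd F $ n" and N: "\<And>n. n \<ge> N \<Longrightarrow> m dvd G $ n"
    using assms by (auto simp: eventually_dvd_def)
  have "m dvd (F * G) $ n" if "n \<ge> M + N" for n
    unfolding fps_mult_nth
  proof (rule dvd_sum)
    fix i assume "i \<in> {0..n}"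
    then have "i \<ge> M \<or> n - i \<ge> N" using that by auto
    then show "m dvd F $ i * G $ (n - i)" using M N by auto
  qed
  then show ?thesis by (auto simp: eventually_dvd_def)
qed

lemma eventually_dvd_one: "eventually_dvd m 1"
  by (auto simp: eventually_dvd_def intro!: exI[of _ 1])

lemma eventually_dvd_power: "eventually_dvd m F \<Longrightarrow> eventually_dvd m (F ^ k)"
  by (induction k) (auto intro: eventually_dvd_mult eventually_dvd_one)

lemma eventually_dvd_sum:
  fixes k :: nat
  shows "(\<And>i. i < k \<Longrightarrow> eventually_dvd m (F i)) \<Longrightarrow> eventually_dvd m (\<Sum>i<k. F i)"
proof (induction k)
  case 0
  then show ?case by (auto simp: eventually_dvd_def)
qed (auto intro: eventually_dvd_add)

text \<open>\<open>log_deriv\<close> states F - 1 = c z b' / b without a division. The conditions in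
  \<open>units\<close> make \<alpha> and \<beta> simple roots modulo p of x^k (x - \<alpha>) (x -
  \<beta>) for every k.\<close>

locale log_derivative_mod =
  fixes p \<alpha> \<beta> c :: int and a :: nat and F :: "int fps" and b :: "int poly"
  assumes p: "prime p" and a: "a > 0"
    and units: "\<not> p dvd \<alpha>" "\<not> p dvd \<beta>" "\<not> p dvd \<alpha> - \<beta>"
    and b_cong: "[:p:] dvd [:1, -\<alpha>:] * [:1, -\<beta>:] - b"
    and log_deriv: "fps_const (p ^ a) dvd
      (F - 1) * fps_of_poly b - fps_const c * (fps_X * fps_deriv (fps_of_poly b))"
begin

text \<open>As q - b is a multiple of p, its a-th power vanishes modulo p^a; and q^a - (q - b)^a is
  a multiple b C of b. So q^a is b C modulo p^a, and multiplying \<open>log_deriv\<close> by C turns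
  the denominator b into q^a.\<close>

theorem rational_form:
  "\<exists>P. fps_cong F (fps_poly_quotient P ([:1, -\<alpha>:] * [:1, -\<beta>:]) a) (p ^ a)"
proof -
  define q where "q = [:1, -\<alpha>:] * [:1, -\<beta>:]"
  obtain g where g: "q - b = smult p g" using b_cong by (auto simp: q_def elim: dvdE)
  obtain C where "q ^ a - (q - b) ^ a = b * C"
    using power_diff_sumr2[of q a "q - b"] by (metis diff_diff_eq2 add_diff_cancel_left')
  then have C: "q ^ a = b * C + smult (p ^ a) (g ^ a)"
    by (simp add: g smult_power algebra_simps)
  define P where "P = C * (b + smult c (pCons 0 (pderiv b)))"
  let ?B = "fps_of_poly b" and ?C = "fps_of_poly C" and ?q = "fps_of_poly q"
  let ?R = "fps_poly_quotient P q a"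
  have "F * ?q ^ a = F * (?B * ?C + fps_const (p ^ a) * fps_of_poly (g ^ a))"
    by (simp add: C fps_of_poly_add fps_of_poly_mult fps_of_poly_smult flip: fps_of_poly_power)
  moreover have "?R * ?q ^ a = ?C * (?B + fps_const c * (fps_X * fps_deriv ?B))"
  proof -
    have "?R * ?q ^ a = fps_of_poly P"
      by (rule fps_poly_quotient_mult) (simp add: q_def)
    then show ?thesis
      by (simp add: P_def fps_of_poly_mult fps_of_poly_add fps_of_poly_smult fps_of_poly_pCons
          fps_of_poly_pderiv mult.commute)
  qed
  ultimately have eq: "F * ?q ^ a - ?R * ?q ^ a =
      ?C * ((F - 1) * ?B - fps_const c * (fps_X * fps_deriv ?B)) + fps_const (p ^ a) * (F * fps_of_poly (g ^ a))"
    by (simp add: algebra_simps)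
  have "fps_const (p ^ a) dvd F * ?q ^ a - ?R * ?q ^ a"
    unfolding eq by (intro dvd_add dvd_mult[OF log_deriv] dvd_triv_left)
  moreover have "?q * fps_right_inverse ?q 1 = 1"
    by (intro fps_right_inverse) (simp add: q_def)
  then have "?q ^ a * fps_right_inverse ?q 1 ^ a = 1"
    by (simp flip: power_mult_distrib)
  ultimately have "fps_const (p ^ a) dvd F - ?R"
    by (rule dvd_diff_mult_cancel)
  then show ?thesis by (auto simp: fps_cong_iff q_def)
qed

section \<open>Roots of the reversed polynomial and the tail of the coefficients\<close>

definition D :: nat where
  "D = max 2 (degree b)"

text \<open>x^D g(1/x), so that a root r corresponds to a factor 1 - r z of g. The reversal is at a
  fixed \<open>D\<close> rather than at the degree of g, which makes it additive; the maximum with 2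
  in \<open>D\<close> lets it apply to the quadratic (1 - \<alpha> z) (1 - \<beta> z) as
  well.\<close>

definition rev_poly :: "int poly \<Rightarrow> int poly" where
  "rev_poly g = (\<Sum>l\<le>D. monom (coeff g l) (D - l))"

lemma poly_rev_poly: "poly (rev_poly g) x = (\<Sum>l\<le>D. coeff g l * x ^ (D - l))"
  by (simp add: rev_poly_def poly_sum poly_monom)

lemma rev_poly_b:
  "\<exists>k. rev_poly b = monom 1 (D - 2) * ([:-\<alpha>, 1:] * [:-\<beta>, 1:]) + smult p k"
proof -
  define q where "q = [:1, -\<alpha>:] * [:1, -\<beta>:]"
  obtain g where g: "q - b = [:p:] * g" using b_cong by (auto simp: q_def elim: dvdE)
  then have b: "b = q - smult p g" by (simp add: algebra_simps)
  have "monom (coeff b l) k = monom (coeff q l) k - [:p:] * monom (coeff g l) k" for k l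
    by (subst b) (simp add: diff_monom smult_monom)
  then have "rev_poly b = rev_poly q - [:p:] * rev_poly g"
    by (simp only: rev_poly_def sum_subtractf sum_distrib_left)
  moreover have "rev_poly q = monom 1 (D - 2) * ([:-\<alpha>, 1:] * [:-\<beta>, 1:])"
  proof -
    have "D \<ge> 2" by (simp add: D_def)
    then obtain d where d: "D = d + 2" by (metis add.commute le_Suc_ex)
    have "(\<Sum>l\<le>D. monom (coeff q l) (D - l)) = (\<Sum>l\<le>2. monom (coeff q l) (D - l))"
    proof (rule sum.mono_neutral_right)
      show "\<forall>l\<in>{..D} - {..2}. monom (coeff q l) (D - l) = 0"
        by (auto simp: q_def coeff_pCons split: nat.split)
    qed (use d in auto)
    also have "\<dots> = monom 1 (d + 2) + monom (- \<alpha> - \<beta>) (d + 1) + monom (\<alpha> * \<beta>) d"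
      by (simp add: q_def d numeral_2_eq_2 algebra_simps)
    also have "\<dots> = monom 1 d * ([:-\<alpha>, 1:] * [:-\<beta>, 1:])"
      by (intro poly_eqI) (auto simp: coeff_monom_mult coeff_pCons split: nat.split)
    finally show ?thesis by (simp add: rev_poly_def d)
  qed
  ultimately have "rev_poly b = monom 1 (D - 2) * ([:-\<alpha>, 1:] * [:-\<beta>, 1:]) + smult p (- rev_poly g)"
    by simp
  then show ?thesis by blast
qed

text \<open>The derivative at \<alpha> is \<alpha>^(D - 2) (\<alpha> - \<beta>) modulo p, a unit,
  and likewise at \<beta>; so both roots are simple.\<close>

lemma roots_exist:
  obtains r s where "[r = \<alpha>] (mod p)" "[s = \<beta>] (mod p)"
    "p ^ a dvd poly (rev_poly b) r" "p ^ a dvd poly (rev_poly b) s"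
proof -
  obtain k where k: "rev_poly b = monom 1 (D - 2) * ([:-\<alpha>, 1:] * [:-\<beta>, 1:]) + smult p k"
    using rev_poly_b by blast
  have val: "poly (rev_poly b) \<alpha> = p * poly k \<alpha>" "poly (rev_poly b) \<beta> = p * poly k \<beta>"
    by (simp_all add: k poly_monom algebra_simps)
  have der: "poly (pderiv (rev_poly b)) \<alpha> = \<alpha> ^ (D - 2) * (\<alpha> - \<beta>) + p * poly (pderiv k) \<alpha>"
       "poly (pderiv (rev_poly b)) \<beta> = \<beta> ^ (D - 2) * (\<beta> - \<alpha>) + p * poly (pderiv k) \<beta>"
    by (simp_all add: k poly_monom pderiv_add pderiv_mult pderiv_smult pderiv_pCons algebra_simps)
  have "\<not> p dvd \<beta> - \<alpha>" using units(3) by (metis dvd_minus_iff minus_diff_eq)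
  then have "\<not> p dvd \<alpha> ^ (D - 2) * (\<alpha> - \<beta>)" "\<not> p dvd \<beta> ^ (D - 2) * (\<beta> - \<alpha>)"
    using units p by (auto simp: prime_dvd_mult_iff dest: prime_dvd_power)
  then have "\<not> p dvd poly (pderiv (rev_poly b)) \<alpha>" "\<not> p dvd poly (pderiv (rev_poly b)) \<beta>"
    unfolding der by (simp_all add: dvd_add_left_iff)
  then show ?thesis
    using hensel_simple_root[OF p, of "rev_poly b" \<alpha> a] hensel_simple_root[OF p, of "rev_poly b" \<beta> a] a
      val that by auto
qed

text \<open>
  Modulo \<open>p\<^sup>a\<close>, \<open>b\<close> factors as \<open>(1 - r z) (1 - s z) N\<close> with \<open>N \<equiv> 1\<close> modulo \<open>p\<close>; as \<open>N\<close> and its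
  inverse are polynomials modulo \<open>p\<^sup>a\<close>, only \<open>r\<close> and \<open>s\<close> contribute to the tail of the logarithmic
  derivative.
\<close>
theorem coeff_eventually_power_sum:
  assumes r: "[r = \<alpha>] (mod p)" "p ^ a dvd poly (rev_poly b) r"
    and s: "[s = \<beta>] (mod p)" "p ^ a dvd poly (rev_poly b) s"
  shows "\<exists>N. \<forall>n\<ge>N. [F $ n = - c * (r ^ n + s ^ n)] (mod p ^ a)"
proof -
  let ?B = "fps_of_poly b" and ?M = "fps_const (p ^ a)"
  define Lr where "Lr = 1 - fps_const r * (fps_X :: int fps)"
  define Ls where "Ls = 1 - fps_const s * (fps_X :: int fps)"
  have Lr: "Lr * geom r = 1" and Ls: "Ls * geom s = 1"
    using geom_mult by (simp_all add: Lr_def Ls_def)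
  define N where "N = ?B * geom r * geom s"
  have B: "?B = Lr * Ls * N"
  proof -
    have "Lr * Ls * N = ?B * (Lr * geom r) * (Ls * geom s)" by (simp add: N_def ac_simps)
    then show ?thesis by (simp add: Lr Ls)
  qed
  have rs: "[r - s = \<alpha> - \<beta>] (mod p)" using r(1) s(1) by (rule cong_diff)
  have "coprime (p ^ a) (r - s)"
    using rs units(3) p by (metis cong_dvd_iff coprime_power_left_iff prime_imp_coprime)
  \<comment> \<open>From degree \<open>D\<close> on, the coefficients of b / (1 - x z) are powers of
    x times the value of the reversed polynomial at x, so dividing b by one of the linear factors
    leaves a polynomial modulo p^a.\<close>
  have tail: "p ^ a dvd (?B * geom x) $ m" if "m \<ge> D" "p ^ a dvd poly (rev_poly b) x" for m x
  proof -
    have "(?B * geom x) $ m = (\<Sum>l=0..m. coeff b l * x ^ (m - l))"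
      by (simp add: fps_mult_nth)
    also have "\<dots> = (\<Sum>l\<le>D. coeff b l * x ^ (m - l))"
      using that(1) by (intro sum.mono_neutral_right) (auto simp: D_def coeff_eq_0)
    also have "\<dots> = x ^ (m - D) * poly (rev_poly b) x"
      unfolding poly_rev_poly sum_distrib_left
    proof (rule sum.cong)
      fix l assume "l \<in> {..D}"
      then have "m - l = (m - D) + (D - l)" using that(1) by auto
      then show "coeff b l * x ^ (m - l) = x ^ (m - D) * (coeff b l * x ^ (D - l))"
        by (simp add: power_add)
    qed simp
    finally show ?thesis using that(2) by simp
  qed
  have N_tail: "eventually_dvd (p ^ a) N"
    unfolding eventually_dvd_def
  proof (intro exI allI impI)
    fix m assume "m \<ge> D"
    \<comment> \<open>Partial fractions: Ls - Lr is (r - s) z, so dividing by both factors at once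
      reduces to dividing by each of them; r - s is a unit modulo p^a.\<close>
    have "fps_const (r - s) * (fps_X * N) = ?B * ((Ls - Lr) * geom r * geom s)"
      by (simp add: N_def Lr_def Ls_def algebra_simps flip: fps_const_sub)
    also have "(Ls - Lr) * geom r * geom s = geom r - geom s"
    proof -
      have "(Ls - Lr) * geom r * geom s = (Ls * geom s) * geom r - (Lr * geom r) * geom s"
        by (simp add: left_diff_distrib right_diff_distrib ac_simps)
      then show ?thesis by (simp add: Lr Ls)
    qed
    finally have "(fps_const (r - s) * (fps_X * N)) $ Suc m = (?B * geom r - ?B * geom s) $ Suc m"
      by (simp add: right_diff_distrib)
    then have "(r - s) * N $ m = (?B * geom r) $ Suc m - (?B * geom s) $ Suc m"
      by simp
    then have "p ^ a dvd (r - s) * N $ m"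
      using tail[of "Suc m"] r(2) s(2) \<open>m \<ge> D\<close> by (simp add: dvd_diff)
    then show "p ^ a dvd N $ m"
      using \<open>coprime (p ^ a) (r - s)\<close> by (simp add: coprime_dvd_mult_right_iff)
  qed
  have "fps_const p dvd N - 1"
  proof (rule dvd_diff_mult_cancel)
    define qr qs where "qr = fps_of_poly [:1, -\<alpha>:]" and "qs = fps_of_poly [:1, -\<beta>:]"
    obtain k where "[:1, -\<alpha>:] * [:1, -\<beta>:] - b = [:p:] * k" using b_cong by (auto elim: dvdE)
    then have "qr * qs - ?B = fps_const p * fps_of_poly k"
      unfolding qr_def qs_def by (metis fps_of_poly_diff fps_of_poly_mult fps_of_poly_const)
    then have q: "fps_const p dvd qr * qs - ?B"
      by (simp only: dvd_triv_left)
    have x: "fps_const p dvd Lr - qr" "fps_const p dvd Ls - qs"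
      unfolding fps_const_dvd_iff qr_def qs_def Lr_def Ls_def using r(1) s(1)
      by (auto simp: cong_iff_dvd_diff coeff_pCons dvd_diff_commute split: nat.split)
    have "N * (Lr * Ls) - 1 * (Lr * Ls) = - (qr * qs - ?B) - (Lr - qr) * Ls - qr * (Ls - qs)"
      by (simp add: B algebra_simps)
    then show "fps_const p dvd N * (Lr * Ls) - 1 * (Lr * Ls)"
      using q x by (metis dvd_diff dvd_minus_iff dvd_mult dvd_mult2)
    show "Lr * Ls * (geom r * geom s) = 1"
    proof -
      have "Lr * Ls * (geom r * geom s) = (Lr * geom r) * (Ls * geom s)" by (simp only: ac_simps)
      then show ?thesis by (simp add: Lr Ls)
    qed
  qed
  then obtain K where K: "N - 1 = fps_const p * K" by (auto elim: dvdE)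
  \<comment> \<open>The geometric series for 1 / N, cut off at a because (1 - N)^a vanishes modulo
    p^a.\<close>
  define N' where "N' = (\<Sum>i<a. (1 - N) ^ i)"
  have "?M dvd 1 - N * N'"
  proof -
    have "(1 - N) ^ a - 1 = (1 - N - 1) * N'"
      unfolding N'_def by (rule power_diff_1_eq)
    then have "1 - N * N' = (1 - N) ^ a" by (simp add: algebra_simps)
    also have "\<dots> = ?M * (- K) ^ a"
    proof -
      have "1 - N = fps_const p * (- K)" using K by (simp add: algebra_simps)
      then show ?thesis by (simp only: power_mult_distrib fps_const_power)
    qed
    finally show ?thesis by simp
  qed
  have "fps_X * fps_deriv ?B = (fps_X * fps_deriv Lr) * Ls * N + Lr * (fps_X * fps_deriv Ls) * N
      + Lr * Ls * (fps_X * fps_deriv N)"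
    unfolding B by (simp add: algebra_simps)
  \<comment> \<open>The logarithmic derivative of (1 - r z) (1 - s z) times z; multiplying by a
    geometric series is dividing by the corresponding factor.\<close>
  define E where "E = (fps_X * fps_deriv Lr) * geom r + (fps_X * fps_deriv Ls) * geom s"
  have deriv: "fps_X * fps_deriv ?B = E * ?B + Lr * Ls * (fps_X * fps_deriv N)"
  proof -
    have 1: "(fps_X * fps_deriv Lr) * geom r * ?B = (fps_X * fps_deriv Lr) * Ls * N * (Lr * geom r)"
      unfolding B by (simp only: ac_simps)
    have 2: "(fps_X * fps_deriv Ls) * geom s * ?B = Lr * (fps_X * fps_deriv Ls) * N * (Ls * geom s)"
      unfolding B by (simp only: ac_simps)
    show ?thesis
      unfolding E_def distrib_right 1 2 Lr Ls by (simp add: B algebra_simps)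
  qed
  let ?X = "fps_const c * (fps_X * fps_deriv N) * N'"
  have "?M dvd (F - 1) - fps_const c * E - ?X"
  proof -
    have "?M dvd ((F - 1) * ?B - fps_const c * (fps_X * fps_deriv ?B)) * (geom r * geom s * N')"
      using log_deriv by (rule dvd_mult2)
    also have "((F - 1) * ?B - fps_const c * (fps_X * fps_deriv ?B)) * (geom r * geom s * N') =
        (F - 1 - fps_const c * E) * (N * N') * (Lr * geom r) * (Ls * geom s)
          - ?X * (Lr * geom r) * (Ls * geom s)"
      unfolding deriv by (simp add: B algebra_simps)
    finally have "?M dvd (F - 1 - fps_const c * E) * (N * N') - ?X" by (simp add: Lr Ls)
    then have "?M dvd ((F - 1 - fps_const c * E) * (N * N') - ?X)
        + (F - 1 - fps_const c * E) * (1 - N * N')"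
      using \<open>?M dvd 1 - N * N'\<close> by (intro dvd_add dvd_mult)
    then show ?thesis by (simp add: algebra_simps)
  qed
  then have cong: "p ^ a dvd F $ n - (1 :: int fps) $ n - c * E $ n - ?X $ n" for n
    by (simp add: fps_const_dvd_iff mult.assoc)
  have E_nth: "E $ n = - (r ^ n + s ^ n)" if "n > 0" for n
    using that by (cases n) (simp_all add: E_def Lr_def Ls_def mult.assoc)
  have "eventually_dvd (p ^ a) (fps_X * fps_deriv N)"
  proof -
    obtain n0 where "\<And>n. n \<ge> n0 \<Longrightarrow> p ^ a dvd N $ n" using N_tail by (auto simp: eventually_dvd_def)
    then have "p ^ a dvd (fps_X * fps_deriv N) $ n" if "n \<ge> n0" for n
      using that by (cases n) auto
    then show ?thesis unfolding eventually_dvd_def by blast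
  qed
  moreover have "eventually_dvd (p ^ a) (1 - N)"
  proof -
    obtain n0 where "\<And>n. n \<ge> n0 \<Longrightarrow> p ^ a dvd N $ n" using N_tail by (auto simp: eventually_dvd_def)
    then have "p ^ a dvd (1 - N) $ n" if "n \<ge> Suc n0" for n
      using that by simp
    then show ?thesis unfolding eventually_dvd_def by blast
  qed
  then have "eventually_dvd (p ^ a) N'"
    unfolding N'_def by (intro eventually_dvd_sum eventually_dvd_power)
  ultimately have "eventually_dvd (p ^ a) ((fps_X * fps_deriv N) * N')"
    by (rule eventually_dvd_mult)
  then obtain n0 where n0: "\<And>n. n \<ge> n0 \<Longrightarrow> p ^ a dvd ((fps_X * fps_deriv N) * N') $ n"
    by (auto simp: eventually_dvd_def)
  \<comment> \<open>Starting at \<open>Suc n0\<close> keeps n positive: this removes the constant 1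
    from F - 1, and the power sum formula for E fails at n = 0.\<close>
  have "[F $ n = - c * (r ^ n + s ^ n)] (mod p ^ a)" if "n \<ge> Suc n0" for n
  proof -
    have "p ^ a dvd c * ((fps_X * fps_deriv N) * N') $ n"
      using n0[of n] that by simp
    then have "p ^ a dvd (F $ n - c * E $ n - ?X $ n) + ?X $ n"
      using cong[of n] that by (intro dvd_add) (simp_all add: mult.assoc)
    then show ?thesis
      using that by (simp add: cong_iff_dvd_diff E_nth algebra_simps)
  qed
  then show ?thesis by blast
qed

end

section \<open>The coefficients modulo powers of 13\<close>

text \<open>The common factor \<open>?G\<close> of both factorial quotients cancels. The recursion
  makes the values computable without factorials and shows where factors 13 enter and leave.\<close>

lemma e_coeff_Suc: "e_coeff (Suc l) * Suc l = 12 * (6 * l + 1) * (6 * l + 5) * e_coeff l"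
proof -
  let ?F = "fact (3 * l) * fact (2 * l) :: nat"
  have r: "fact (n + 6) = (n + 6) * (fact (n + 5) :: nat)" "fact (n + 5) = (n + 5) * (fact (n + 4) :: nat)"
      "fact (n + 4) = (n + 4) * (fact (n + 3) :: nat)" "fact (n + 3) = (n + 3) * (fact (n + 2) :: nat)"
      "fact (n + 2) = (n + 2) * (fact (n + 1) :: nat)" "fact (n + 1) = (n + 1) * (fact n :: nat)" for n
    by (subst fact_reduce; simp)+
  have f6: "fact (6 * Suc l) = (6 * l + 6) * (6 * l + 5) * (6 * l + 4) * (6 * l + 3) * (6 * l + 2) *
      (6 * l + 1) * (fact (6 * l) :: nat)"
    by (simp only: mult_Suc_right add.commute[of 6] r mult.assoc)
  have f3: "fact (3 * Suc l) = (3 * l + 3) * (3 * l + 2) * (3 * l + 1) * (fact (3 * l) :: nat)"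
    by (simp only: mult_Suc_right add.commute[of 3] r mult.assoc)
  have f2: "fact (2 * Suc l) = (2 * l + 2) * (2 * l + 1) * (fact (2 * l) :: nat)"
    by (simp only: mult_Suc_right add.commute[of 2] r mult.assoc)
  let ?c = "(3 * l + 3) * (3 * l + 2) * (3 * l + 1) * ((2 * l + 2) * (2 * l + 1)) :: nat"
  have "e_coeff (Suc l) * ?c * ?F = fact (6 * Suc l)"
    using e_coeff_mult[of "Suc l"] unfolding f3 f2 by (simp only: ac_simps)
  also have "\<dots> = (6 * l + 6) * (6 * l + 5) * (6 * l + 4) * (6 * l + 3) * (6 * l + 2) * (6 * l + 1) *
      e_coeff l * ?F"
    unfolding f6 e_coeff_mult[symmetric, of l] by (simp only: ac_simps)
  finally have e: "e_coeff (Suc l) * ?c = (6 * l + 6) * (6 * l + 5) * (6 * l + 4) * (6 * l + 3) *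
      (6 * l + 2) * (6 * l + 1) * e_coeff l"
    by (rule mult_right_cancel[THEN iffD1, rotated]) simp
  let ?G = "(6 * l + 6) * (6 * l + 4) * (6 * l + 3) * (6 * l + 2)"
  have c: "12 * ?c = Suc l * ?G"
    by (simp add: algebra_simps)
  have "(e_coeff (Suc l) * Suc l) * ?G = 12 * (e_coeff (Suc l) * ?c)"
    using c by (simp only: mult.assoc mult.left_commute)
  also have "\<dots> = (12 * (6 * l + 1) * (6 * l + 5) * e_coeff l) * ?G"
    unfolding e by (simp only: ac_simps)
  finally show ?thesis
    by (rule mult_right_cancel[THEN iffD1, rotated]) simp
qed

lemma e_coeff_0: "e_coeff 0 = 1"
  by (simp add: e_coeff_def)

lemma e_coeff_numeral:
  "e_coeff (numeral k) = 12 * (6 * pred_numeral k + 1) * (6 * pred_numeral k + 5) *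
     e_coeff (pred_numeral k) div numeral k"
proof -
  have "numeral k = Suc (pred_numeral k)" by simp
  then show ?thesis
    using e_coeff_Suc[of "pred_numeral k"] by (metis nonzero_mult_div_cancel_right nat.distinct(2))
qed

lemma e_coeff_1: "e_coeff (Suc 0) = 60"
  using e_coeff_Suc[of 0] by (simp add: e_coeff_0)

lemma power_13_dvd_fact: "13 ^ k dvd (fact (13 * k) :: nat)"
proof (induction k)
  case (Suc k)
  have "fact (13 * Suc k) = 13 * Suc k * (fact (13 * k + 12) :: nat)"
    using fact_Suc[of "13 * k + 12", where 'a = nat] by (simp add: algebra_simps)
  moreover have "13 ^ k dvd (fact (13 * k + 12) :: nat)"
    using Suc by (rule dvd_trans) (simp add: fact_dvd)
  ultimately show ?case
    by (simp only: power_Suc) (intro mult_dvd_mono, auto)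
qed simp

lemma power_13_dvd_e_coeff: "l \<ge> 13 * k \<Longrightarrow> 13 ^ k dvd e_coeff l"
  using power_13_dvd_fact[of k] fact_dvd[of "13 * k" l] fact_dvd_e_coeff[of l] dvd_trans by metis

text \<open>Although l! is prime to 13 below 13, a factor 13 already enters in the step from 2 to 3,
  where 6 * 2 + 1 = 13.\<close>

lemma dvd_13_e_coeff:
  assumes "l \<ge> 3"
  shows "13 dvd e_coeff l"
proof (cases "l \<ge> 13")
  case False
  then have "l \<in> {3, 4, 5, 6, 7, 8, 9, 10, 11, 12}" using assms False unfolding insert_iff empty_iff by presburger
  then show ?thesis
    by (elim insertE; simp add: e_coeff_numeral e_coeff_1)
qed (use power_13_dvd_e_coeff[of 1 l] in simp)

text \<open>A second factor 13 enters in the step from 15 to 16, where 6 * 15 + 1 = 7 * 13. It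
  persists up to 25 since the denominators of the steps in between are prime to 13, and from 26 on
  l! contains 169.\<close>

lemma dvd_169_e_coeff:
  assumes "l \<ge> 16"
  shows "169 dvd e_coeff l"
proof (cases "l \<ge> 26")
  case False
  have "l < 26 \<longrightarrow> 169 dvd e_coeff l"
    using assms
  proof (induction l rule: nat_induct_at_least)
    case base
    show ?case by (simp add: e_coeff_numeral e_coeff_1)
  next
    case (Suc l)
    show ?case
    proof
      assume "Suc l < 26"
      then have "169 dvd e_coeff (Suc l) * Suc l"
        using Suc.IH unfolding e_coeff_Suc by (intro dvd_mult) simp
      moreover have "\<not> 13 dvd Suc l" using \<open>Suc l < 26\<close> Suc.hyps by presburger
      then have "coprime (13 ^ 2) (Suc l)"
        by (simp only: coprime_power_left_iff) (simp add: prime_imp_coprime)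
      then have "coprime 169 (Suc l)" by simp
      ultimately show "169 dvd e_coeff (Suc l)"
        using coprime_dvd_mult_left_iff by blast
    qed
  qed
  then show ?thesis using False by simp
qed (use power_13_dvd_e_coeff[of 2 l] in simp)

text \<open>Here y stands for 72 r: as 72 * 2 = 11 * 13 + 1, y = 1 modulo 13 corresponds to r = 2,
  and y = 66 to r = 15 modulo 169. Only the 13 lifts 13 q + 1 have to be tried.\<close>

lemma root_mod_169:
  fixes y :: int
  assumes y: "[y = 1] (mod 13)" and root: "169 dvd (\<Sum>l\<le>15. int (e_coeff l) * y ^ (15 - l))"
  shows "[y = 66] (mod 169)"
proof -
  have sum_15: "(\<Sum>l\<le>15. f l) = f 0 + f 1 + f 2 + f 3 + f 4 + f 5 + f 6 + f 7 + f 8 + f 9 + f 10 + f 11 + f 12 + f 13 + f 14 + f 15" for f :: "nat \<Rightarrow> int"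
    by (simp add: numeral_eq_Suc)
  have e: "int (e_coeff 0) mod 169 = 1" "int (e_coeff 1) mod 169 = 60" "int (e_coeff 2) mod 169 = 4"
      "int (e_coeff 3) mod 169 = 156" "int (e_coeff 4) mod 169 = 26" "int (e_coeff 5) mod 169 = 117"
      "int (e_coeff 6) mod 169 = 52" "int (e_coeff 7) mod 169 = 78" "int (e_coeff 8) mod 169 = 26"
      "int (e_coeff 9) mod 169 = 65" "int (e_coeff 10) mod 169 = 117" "int (e_coeff 11) mod 169 = 0"
      "int (e_coeff 12) mod 169 = 0" "int (e_coeff 13) mod 169 = 65" "int (e_coeff 14) mod 169 = 13"
      "int (e_coeff 15) mod 169 = 91"
    by (simp_all add: e_coeff_numeral e_coeff_1 e_coeff_0)
  have "[(\<Sum>l\<le>15. (int (e_coeff l) mod 169) * (y mod 169) ^ (15 - l)) =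
      (\<Sum>l\<le>15. int (e_coeff l) * y ^ (15 - l))] (mod 169)"
    by (intro cong_sum cong_mult cong_pow) (simp_all add: cong_def)
  then have 1: "169 dvd (\<Sum>l\<le>15. (int (e_coeff l) mod 169) * (y mod 169) ^ (15 - l))"
    using root cong_dvd_iff by blast
  define q where "q = y mod 169 div 13"
  have "y mod 169 mod 13 = 1" using y by (simp add: cong_def mod_mod_cancel)
  then have q: "y mod 169 = 13 * q + 1"
    unfolding q_def by (metis mult_div_mod_eq)
  have "0 \<le> y mod 169" "y mod 169 < 169" by simp_all
  then have "q \<ge> 0" "q < 13" unfolding q by linarith+
  then have "q \<in> {0, 1, 2, 3, 4, 5, 6, 7, 8, 9, 10, 11, 12}"
    unfolding insert_iff empty_iff by presburger
  then have "y mod 169 = 66"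
    using 1 unfolding sum_15 e q by (elim insertE; simp)
  then show ?thesis by (simp add: cong_def)
qed

text \<open>Every proper divisor of 12 divides 4 or 6, so it suffices to exclude these two.\<close>

lemma residue_primroot_13_2: "residue_primroot 13 2"
proof -
  have c: "coprime 13 (2 :: nat)" by (simp add: coprime_iff_gcd_eq_1 gcd_non_0_nat)
  have "totient 13 = (12 :: nat)" by (simp add: totient_prime)
  moreover have "ord 13 (2 :: nat) = 12"
  proof -
    have "ord 13 (2 :: nat) dvd 12" "\<not> ord 13 (2 :: nat) dvd 4" "\<not> ord 13 (2 :: nat) dvd 6"
      unfolding ord_divides[symmetric] by (simp_all add: cong_def)
    moreover from this have "ord 13 (2 :: nat) \<le> 12" by (simp add: dvd_imp_le)
    then have "ord 13 (2 :: nat) \<in> {0, 1, 2, 3, 4, 5, 6, 7, 8, 9, 10, 11, 12}"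
      unfolding insert_iff empty_iff by presburger
    ultimately show ?thesis by (elim insertE) simp_all
  qed
  ultimately show ?thesis using c by (simp add: residue_primroot_def)
qed

text \<open>\<open>u\<close> replaces \<open>1 / 72\<close>, so that all power series have integer coefficients.\<close>

locale free_subgroup_log_derivative =
  fixes a :: nat and u :: int
  assumes a: "a > 0" and u: "[72 * u = 1] (mod 13 ^ a)"
begin

text \<open>The bound is where l!, and with it e_l, becomes divisible by 13^a.\<close>

definition b :: "int poly" where
  "b = (\<Sum>l<13 * a. monom (u ^ l * int (e_coeff l)) l)"

lemma coeff_b: "coeff b l = (if l < 13 * a then u ^ l * int (e_coeff l) else 0)"
  by (simp add: b_def coeff_sum)

lemma u_mod: "k \<le> a \<Longrightarrow> [72 * u = 1] (mod 13 ^ k)"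
  using u by (rule cong_dvd_modulus) (simp add: le_imp_power_dvd)

lemma b_cong_Q: "[:13:] dvd [:1, -2:] * [:1, 5:] - b"
proof -
  have "[72 * u = 1] (mod 13)" using u_mod[of 1] a by simp
  then have "[2 * (72 * u) = 2 * 1] (mod 13)" by (rule cong_scalar_left)
  \<comment> \<open>144 = 1 + 11 * 13, so 2 is the inverse of 72 modulo 13.\<close>
  moreover have "2 * (72 * u) = u + 13 * (11 * u)" by simp
  ultimately have u2: "[u = 2] (mod 13)" unfolding cong_def by (metis mod_mult_self2 mult_1_right)
  have "13 dvd coeff ([:1, -2:] * [:1, 5:] - b) n" for n
  proof -
    consider "n = 0" | "n = 1" | "n = 2" | "n \<ge> 3" by linarith
    then show ?thesis
    proof cases
      case 2
      have "[3 - u * 60 = 3 - 2 * 60] (mod 13)" using u2 by (intro cong_diff cong_mult) auto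
      then have "13 dvd 3 - u * 60" by (simp add: cong_def dvd_eq_mod_eq_0)
      then show ?thesis using 2 a by (simp add: coeff_b e_coeff_1)
    next
      case 3
      have "[- 10 - u ^ 2 * 27720 = - 10 - 2 ^ 2 * 27720] (mod 13)"
        using u2 by (intro cong_diff cong_mult cong_pow) auto
      then have "13 dvd - 10 - u ^ 2 * 27720" by (simp add: cong_def dvd_eq_mod_eq_0)
      moreover have "e_coeff 2 = 27720" by (simp add: e_coeff_numeral e_coeff_1)
      moreover have "coeff ([:1, -2:] * [:1, 5:]) 2 = (-10 :: int)"
        by (simp add: coeff_pCons numeral_2_eq_2)
      ultimately show ?thesis using a unfolding 3 coeff_diff coeff_b by simp
    next
      case 4
      then have "13 dvd int (e_coeff n)" using dvd_13_e_coeff by (metis int_dvd_int_iff of_nat_numeral)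
      then show ?thesis using 4 by (auto simp: coeff_b coeff_pCons split: nat.split)
    qed (use a in \<open>simp add: coeff_b e_coeff_0\<close>)
  qed
  then show ?thesis unfolding const_poly_dvd_iff by blast
qed

definition E :: "int fps" where
  "E = Abs_fps (\<lambda>l. u ^ l * int (e_coeff l))"

lemma E_cong_b: "fps_const (13 ^ a) dvd E - fps_of_poly b"
proof -
  have "13 ^ a dvd int (e_coeff l)" if "l \<ge> 13 * a" for l
    using power_13_dvd_e_coeff[OF that] by (metis int_dvd_int_iff of_nat_numeral of_nat_power)
  then show ?thesis by (simp add: fps_const_dvd_iff E_def coeff_b)
qed

text \<open>The recurrence multiplied by u^n: each summand acquires the factor (72 u)^k, which is 1
  modulo 13^a.\<close>

lemma log_deriv_E:
  "fps_const (13 ^ a) dvd (free_subgroup_gf - 1) * E - fps_const 6 * (fps_X * fps_deriv E)"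
  unfolding fps_const_dvd_iff
proof
  fix n
  show "13 ^ a dvd ((free_subgroup_gf - 1) * E - fps_const 6 * (fps_X * fps_deriv E)) $ n"
  proof (cases "n = 0")
    case True
    then show ?thesis by (simp add: free_subgroup_gf_def)
  next
    case False
    let ?f = "\<lambda>k. int (free_subgroup_number k)" and ?e = "\<lambda>k. int (e_coeff k)"
    have "((free_subgroup_gf - 1) * E) $ n = (\<Sum>k=0..n. (free_subgroup_gf - 1) $ k * E $ (n - k))"
      by (rule fps_mult_nth)
    also have "\<dots> = (\<Sum>k=1..n. ?f k * (u ^ (n - k) * ?e (n - k)))"
      by (simp add: sum.atLeast_Suc_atMost free_subgroup_gf_def E_def)
    finally have 1: "((free_subgroup_gf - 1) * E) $ n = \<dots>" .
    have "(fps_const 6 * (fps_X * fps_deriv E)) $ n = u ^ n * int (6 * n * e_coeff n)"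
      using False by (simp add: E_def)
    also have "\<dots> = (\<Sum>k=1..n. (72 * u) ^ k * (?f k * (u ^ (n - k) * ?e (n - k))))"
      unfolding free_subgroup_number_recurrence[OF False[unfolded neq0_conv]] of_nat_sum sum_distrib_left
    proof (rule sum.cong)
      fix k assume "k \<in> {1..n}"
      then have "u ^ n = u ^ k * u ^ (n - k)" by (simp flip: power_add)
      then show "u ^ n * int (free_subgroup_number k * 72 ^ k * e_coeff (n - k)) =
          (72 * u) ^ k * (?f k * (u ^ (n - k) * ?e (n - k)))"
        by (simp add: power_mult_distrib)
    qed simp
    finally have 2: "(fps_const 6 * (fps_X * fps_deriv E)) $ n = \<dots>" .
    have "[(\<Sum>k=1..n. (72 * u) ^ k * (?f k * (u ^ (n - k) * ?e (n - k)))) =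
        (\<Sum>k=1..n. 1 ^ k * (?f k * (u ^ (n - k) * ?e (n - k))))] (mod 13 ^ a)"
      using u by (intro cong_sum cong_mult cong_pow) auto
    then have "[(\<Sum>k=1..n. ?f k * (u ^ (n - k) * ?e (n - k))) =
        (\<Sum>k=1..n. (72 * u) ^ k * (?f k * (u ^ (n - k) * ?e (n - k))))] (mod 13 ^ a)"
      by (simp add: cong_sym)
    then show ?thesis
      by (simp only: fps_sub_nth 1 2 cong_iff_dvd_diff)
  qed
qed

lemma log_deriv_b:
  "fps_const (13 ^ a) dvd
    (free_subgroup_gf - 1) * fps_of_poly b - fps_const 6 * (fps_X * fps_deriv (fps_of_poly b))"
proof -
  obtain K where K: "E - fps_of_poly b = fps_const (13 ^ a) * K" using E_cong_b by (auto elim: dvdE)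
  then have b: "fps_of_poly b = E - fps_const (13 ^ a) * K" by (simp add: algebra_simps)
  have "(free_subgroup_gf - 1) * fps_of_poly b - fps_const 6 * (fps_X * fps_deriv (fps_of_poly b)) =
      ((free_subgroup_gf - 1) * E - fps_const 6 * (fps_X * fps_deriv E))
      - fps_const (13 ^ a) * ((free_subgroup_gf - 1) * K - fps_const 6 * (fps_X * fps_deriv K))"
    unfolding b by (simp add: algebra_simps)
  then show ?thesis
    using log_deriv_E by (simp only: dvd_diff dvd_triv_left)
qed

sublocale log_derivative_mod 13 2 "-5" 6 a free_subgroup_gf b
  using a b_cong_Q log_deriv_b by unfold_locales simp_all

text \<open>By \<open>root_mod_169\<close>, 72 r would be 66 modulo 169, so r^12 = 1 would give
  66^12 = 72^12 modulo 169, which is false.\<close>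

lemma root_order:
  assumes a2: "a \<ge> 2" and r2: "[r = 2] (mod 13)" and root: "13 ^ a dvd poly (rev_poly b) r"
  shows "\<not> [r ^ 12 = 1] (mod 169)"
proof
  assume r12: "[r ^ 12 = 1] (mod 169)"
  have u169: "[72 * u = 1] (mod 169)" using u_mod[of 2] a2 by simp
  have "u \<noteq> 0" using u169 by (auto simp: cong_def)
  \<comment> \<open>25 = 13 * 2 - 1 lies below the truncation bound for every a >= 2, so a nonzero
    coefficient there forces D >= 25, leaving room to split off r^(D - 15).\<close>
  have "e_coeff 25 \<noteq> 0"
    using e_coeff_mult[of 25] by (metis fact_nonzero mult_zero_left)
  then have "coeff b 25 \<noteq> 0" using a2 \<open>u \<noteq> 0\<close> by (simp add: coeff_b)
  then have D: "D \<ge> 25" using le_degree by (fastforce simp: D_def)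
  have "(169 :: int) dvd 13 ^ a" using le_imp_power_dvd[OF a2, of "13 :: int"] by simp
  then have "169 dvd (\<Sum>l\<le>D. coeff b l * r ^ (D - l))"
    using root unfolding poly_rev_poly by (rule dvd_trans)
  also have "(\<Sum>l\<le>D. coeff b l * r ^ (D - l)) =
      (\<Sum>l\<in>{..D} - {..15}. coeff b l * r ^ (D - l)) + (\<Sum>l\<le>15. coeff b l * r ^ (D - l))"
    using D by (intro sum.subset_diff) auto
  finally have "169 dvd (\<Sum>l\<in>{..D} - {..15}. coeff b l * r ^ (D - l)) + (\<Sum>l\<le>15. coeff b l * r ^ (D - l))" .
  moreover have "169 dvd (\<Sum>l\<in>{..D} - {..15}. coeff b l * r ^ (D - l))"
  proof (rule dvd_sum)
    fix l assume "l \<in> {..D} - {..15}"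
    then have "169 dvd e_coeff l"
      by (intro dvd_169_e_coeff) auto
    then have "int 169 dvd int (e_coeff l)"
      by (simp only: int_dvd_int_iff)
    then show "169 dvd coeff b l * r ^ (D - l)" by (simp add: coeff_b)
  qed
  ultimately have "169 dvd (\<Sum>l\<le>15. coeff b l * r ^ (D - l))"
    by (simp add: dvd_add_right_iff)
  also have "(\<Sum>l\<le>15. coeff b l * r ^ (D - l)) =
      r ^ (D - 15) * (\<Sum>l\<le>15. u ^ l * int (e_coeff l) * r ^ (15 - l))"
    unfolding sum_distrib_left
  proof (rule sum.cong)
    fix l :: nat assume "l \<in> {..15}"
    then have "D - l = (D - 15) + (15 - l)" "l < 13 * a" using D a2 by auto
    then show "coeff b l * r ^ (D - l) = r ^ (D - 15) * (u ^ l * int (e_coeff l) * r ^ (15 - l))"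
      by (simp add: coeff_b power_add)
  qed simp
  finally have "169 dvd r ^ (D - 15) * (\<Sum>l\<le>15. u ^ l * int (e_coeff l) * r ^ (15 - l))" .
  moreover have "coprime 169 (r ^ (D - 15))"
  proof -
    have "\<not> 13 dvd r" using r2 by (auto simp: cong_def dvd_eq_mod_eq_0)
    then have "coprime 13 r" by (intro prime_imp_coprime) auto
    then have "coprime (13 ^ 2) r" by (simp only: coprime_power_left_iff simp_thms)
    then show ?thesis by simp
  qed
  ultimately have "169 dvd (\<Sum>l\<le>15. u ^ l * int (e_coeff l) * r ^ (15 - l))"
    by (simp only: coprime_dvd_mult_right_iff)
  \<comment> \<open>Multiplying by 72^15 pairs u^l with 72^l, which cancel modulo 169, and leaves
    powers of 72 r.\<close>
  then have "169 dvd 72 ^ 15 * (\<Sum>l\<le>15. u ^ l * int (e_coeff l) * r ^ (15 - l))"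
    by (rule dvd_mult)
  also have "72 ^ 15 * (\<Sum>l\<le>15. u ^ l * int (e_coeff l) * r ^ (15 - l)) =
      (\<Sum>l\<le>15. (72 * u) ^ l * (int (e_coeff l) * (72 * r) ^ (15 - l)))"
    unfolding sum_distrib_left
  proof (rule sum.cong)
    fix l :: nat assume "l \<in> {..15}"
    then have "(72 :: int) ^ 15 = 72 ^ l * 72 ^ (15 - l)" by (simp flip: power_add)
    then show "72 ^ 15 * (u ^ l * int (e_coeff l) * r ^ (15 - l)) =
        (72 * u) ^ l * (int (e_coeff l) * (72 * r) ^ (15 - l))"
      by (simp only: power_mult_distrib ac_simps)
  qed simp
  finally have "169 dvd (\<Sum>l\<le>15. (72 * u) ^ l * (int (e_coeff l) * (72 * r) ^ (15 - l)))" .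
  moreover have "[(\<Sum>l\<le>15. (72 * u) ^ l * (int (e_coeff l) * (72 * r) ^ (15 - l))) =
      (\<Sum>l\<le>15. 1 ^ l * (int (e_coeff l) * (72 * r) ^ (15 - l)))] (mod 169)"
    using u169 by (intro cong_sum cong_mult cong_pow) auto
  ultimately have "169 dvd (\<Sum>l\<le>15. int (e_coeff l) * (72 * r) ^ (15 - l))"
    by (simp add: cong_dvd_iff)
  moreover have "[72 * r = 1] (mod 13)"
    using cong_mult[OF cong_refl[of 72] r2] by (simp add: cong_def)
  ultimately have "[72 * r = 66] (mod 169)"
    by (intro root_mod_169)
  then have "[(72 * r) ^ 12 = 66 ^ 12] (mod 169)" by (rule cong_pow)
  moreover have "[(72 * r) ^ 12 = 72 ^ 12 * 1] (mod 169)"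
    unfolding power_mult_distrib using r12 by (intro cong_mult) auto
  ultimately have "[66 ^ 12 = (72 ^ 12 * 1 :: int)] (mod 169)"
    using cong_sym cong_trans by blast
  then show False by (simp add: cong_def)
qed

section \<open>The order of the root and the period\<close>

lemma ord_root:
  fixes R :: nat
  assumes r2: "[int R = 2] (mod 13)" and root: "13 ^ a dvd poly (rev_poly b) (int R)"
  shows "ord (13 ^ a) R = 12 * 13 ^ (a - 1)"
proof -
  have "[R = 2] (mod 13)" using r2 by (simp flip: cong_int_iff)
  then have R13: "residue_primroot 13 R"
    using residue_primroot_13_2 residue_primroot_cong by blast
  have tot: "totient (13 ^ a) = 12 * 13 ^ (a - 1)"
    using a by (simp add: totient_prime_power)
  show ?thesis
  proof (cases "a = 1")
    case True
    then show ?thesis using R13 tot by (simp add: residue_primroot_def)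
  next
    case False
    then have "\<not> [int R ^ 12 = 1] (mod 169)"
      using root_order[OF _ r2 root] a by simp
    then have "[R ^ (13 - 1) \<noteq> 1] (mod 13\<^sup>2)"
      by (simp flip: cong_int_iff)
    then have "residue_primroot (13 ^ a) R"
      using residue_primroot_prime_lift_iff[of 13 R] R13 a by simp
    then show ?thesis using tot by (simp add: residue_primroot_def)
  qed
qed

text \<open>Both r and s have orders dividing the totient of 13^a, which gives the period.
  Conversely, a period forces r^t = 1 once the contribution of s is eliminated.\<close>

lemma periods:
  "eventual_period (\<lambda>n. free_subgroup_number (Suc n) mod 13 ^ a) (12 * 13 ^ (a - 1))"
  "eventual_period (\<lambda>n. free_subgroup_number (Suc n) mod 13 ^ a) t \<Longrightarrow> 12 * 13 ^ (a - 1) \<le> t"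
proof -
  let ?M = "13 ^ a :: int"
  obtain r s where rs: "[r = 2] (mod 13)" "[s = -5] (mod 13)"
    "?M dvd poly (rev_poly b) r" "?M dvd poly (rev_poly b) s"
    by (rule roots_exist)
  obtain N where N: "\<And>n. n \<ge> N \<Longrightarrow> [free_subgroup_gf $ n = - 6 * (r ^ n + s ^ n)] (mod ?M)"
    using coeff_eventually_power_sum[OF rs(1,3,2,4)] by blast
  have f: "[int (free_subgroup_number (Suc n)) = - 6 * (r ^ Suc n + s ^ Suc n)] (mod ?M)" if "n \<ge> N" for n
    using N[of "Suc n"] that by (simp add: free_subgroup_gf_def)
  have per: "free_subgroup_number (Suc m) mod 13 ^ a = free_subgroup_number (Suc n) mod 13 ^ a \<longleftrightarrow>
      [- 6 * (r ^ Suc m + s ^ Suc m) = - 6 * (r ^ Suc n + s ^ Suc n)] (mod ?M)"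
    if "m \<ge> N" "n \<ge> N" for m n
  proof -
    have "free_subgroup_number (Suc m) mod 13 ^ a = free_subgroup_number (Suc n) mod 13 ^ a \<longleftrightarrow>
        [int (free_subgroup_number (Suc m)) = int (free_subgroup_number (Suc n))] (mod ?M)"
      using cong_int_iff[of "free_subgroup_number (Suc m)" "free_subgroup_number (Suc n)" "13 ^ a"]
      by (simp add: cong_def)
    then show ?thesis using f[OF that(1)] f[OF that(2)] cong_sym cong_trans by meson
  qed
  \<comment> \<open>Orders and Euler's theorem are applied to natural numbers, so r and later s are
    replaced by their nonnegative residues.\<close>
  define R where "R = nat (r mod ?M)"
  have R: "[int R = r] (mod ?M)" by (simp add: R_def cong_def)
  have M13: "13 dvd ?M" using a by simp
  have ordR: "ord (13 ^ a) R = 12 * 13 ^ (a - 1)"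
  proof (rule ord_root)
    show "[int R = 2] (mod 13)" using cong_dvd_modulus[OF R M13] rs(1) cong_trans by blast
    show "?M dvd poly (rev_poly b) (int R)"
      using rs(3) poly_int_cong[OF R, of "rev_poly b"] by (simp add: cong_dvd_iff)
  qed
  have pow: "[r ^ t = 1] (mod ?M) \<longleftrightarrow> 12 * 13 ^ (a - 1) dvd t" for t
  proof -
    have "[r ^ t = 1] (mod ?M) \<longleftrightarrow> [int R ^ t = 1] (mod ?M)"
      using cong_pow[OF R, of t] cong_sym cong_trans by meson
    also have "\<dots> \<longleftrightarrow> [R ^ t = 1] (mod 13 ^ a)"
      using cong_int_iff[of "R ^ t" 1 "13 ^ a"] by simp
    finally show ?thesis unfolding ord_divides ordR .
  qed
  define S where "S = nat (s mod ?M)"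
  have S: "[int S = s] (mod ?M)" by (simp add: S_def cong_def)
  have "[int S = -5] (mod 13)" using cong_dvd_modulus[OF S M13] rs(2) cong_trans by blast
  then have "\<not> 13 dvd int S" by (auto simp: cong_dvd_iff)
  then have "\<not> int 13 dvd int S" by simp
  then have "\<not> 13 dvd S" by (simp only: int_dvd_int_iff simp_thms)
  then have "coprime 13 S" by (intro prime_imp_coprime) simp_all
  then have "coprime S (13 ^ a)" by (simp add: coprime_commute)
  then have "[S ^ totient (13 ^ a) = 1] (mod 13 ^ a)" by (rule euler_theorem)
  then have "[int S ^ (12 * 13 ^ (a - 1)) = 1] (mod ?M)"
    using cong_int_iff[of "S ^ (12 * 13 ^ (a - 1))" 1 "13 ^ a"] a by (simp add: totient_prime_power mult.commute)
  then have s_pow: "[s ^ (12 * 13 ^ (a - 1)) = 1] (mod ?M)"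
    using cong_pow[OF S] cong_sym cong_trans by meson
  have r_pow: "[r ^ (12 * 13 ^ (a - 1)) = 1] (mod ?M)" by (simp add: pow)
  show "eventual_period (\<lambda>n. free_subgroup_number (Suc n) mod 13 ^ a) (12 * 13 ^ (a - 1))"
    unfolding eventual_period_def
  proof (intro conjI exI allI impI)
    fix n assume n: "n \<ge> N"
    let ?T = "12 * 13 ^ (a - 1) :: nat"
    have "[- 6 * (r ^ Suc n * r ^ ?T + s ^ Suc n * s ^ ?T) = - 6 * (r ^ Suc n * 1 + s ^ Suc n * 1)] (mod ?M)"
      using r_pow s_pow by (intro cong_mult cong_add) auto
    moreover have "Suc (n + ?T) = Suc n + ?T" by simp
    ultimately show "free_subgroup_number (Suc (n + ?T)) mod 13 ^ a = free_subgroup_number (Suc n) mod 13 ^ a"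
      using per[of "n + ?T" n] n by (simp only: power_add mult_1_right)
  qed simp
  assume "eventual_period (\<lambda>n. free_subgroup_number (Suc n) mod 13 ^ a) t"
  then obtain N' where t: "t > 0"
    and N': "\<And>n. n \<ge> N' \<Longrightarrow> free_subgroup_number (Suc (n + t)) mod 13 ^ a = free_subgroup_number (Suc n) mod 13 ^ a"
    by (auto simp: eventual_period_def)
  define d where "d n = r ^ n * (r ^ t - 1) + s ^ n * (s ^ t - 1)" for n
  have d: "?M dvd d (Suc n)" if "n \<ge> max N N'" for n
  proof -
    have "[- 6 * (r ^ Suc (n + t) + s ^ Suc (n + t)) = - 6 * (r ^ Suc n + s ^ Suc n)] (mod ?M)"
      using per[of "n + t" n] N'[of n] that by simp
    then have "?M dvd - 6 * (r ^ Suc (n + t) + s ^ Suc (n + t)) - (- 6 * (r ^ Suc n + s ^ Suc n))"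
      by (simp only: cong_iff_dvd_diff)
    also have "\<dots> = - 6 * d (Suc n)"
      by (simp add: d_def power_add algebra_simps)
    finally have "?M dvd 6 * d (Suc n)" by simp
    moreover have "coprime (13 :: int) 6" by (rule prime_imp_coprime) simp_all
    then have "coprime ?M 6" by simp
    ultimately show ?thesis by (simp only: coprime_dvd_mult_right_iff)
  qed
  define m where "m = Suc (max N N')"
  \<comment> \<open>Subtracting s times one value of \<open>d\<close> from the next removes the
    powers of s; what remains is r^t - 1 times r^m (r - s), a unit since r - s is 7 modulo
    13.\<close>
  have "?M dvd d (Suc m) - s * d m"
  proof -
    have "?M dvd d m" "?M dvd d (Suc m)"
      unfolding m_def by (intro d le_SucI order.refl)+
    then show ?thesis by (intro dvd_diff dvd_mult)
  qed
  also have "d (Suc m) - s * d m = (r - s) * (r ^ m * (r ^ t - 1))"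
    by (simp add: d_def algebra_simps)
  finally have "?M dvd ((r - s) * r ^ m) * (r ^ t - 1)" by (simp add: mult.assoc)
  moreover have "coprime ?M ((r - s) * r ^ m)"
  proof -
    have "[r - s = 2 - (-5)] (mod 13)" using rs by (intro cong_diff)
    then have "\<not> 13 dvd r - s" "\<not> 13 dvd r" using rs(1) by (simp_all add: cong_dvd_iff)
    then have "coprime 13 (r - s)" "coprime 13 r" by (auto intro!: prime_imp_coprime)
    then show ?thesis by simp
  qed
  ultimately have "?M dvd r ^ t - 1" by (simp only: coprime_dvd_mult_right_iff)
  then have "12 * 13 ^ (a - 1) dvd t" unfolding pow[symmetric] cong_iff_dvd_diff .
  then show "12 * 13 ^ (a - 1) \<le> t" using t by (rule dvd_imp_le)
qed

end

theorem theorem16: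
  fixes a :: nat
  assumes "a > 0"
  shows "(\<exists>P :: int poly.
            fps_cong free_subgroup_gf (fps_poly_quotient P ([:1, -2:] * [:1, 5:]) a) (13 ^ a)) \<and>
         ultimately_periodic (\<lambda>n. free_subgroup_number (Suc n) mod 13 ^ a) \<and>
         minimal_period (\<lambda>n. free_subgroup_number (Suc n) mod 13 ^ a) = 12 * 13 ^ (a - 1)"
proof -
  have "coprime (13 :: int) 72" by (rule prime_imp_coprime) simp_all
  then have "coprime (72 :: int) 13" by (simp only: coprime_commute)
  then have "coprime (72 :: int) (13 ^ a)" by simp
  then obtain u :: int where "[72 * u = 1] (mod 13 ^ a)" using cong_solve_coprime_int by blast
  then interpret free_subgroup_log_derivative a u using assms by unfold_locales
  have "minimal_period (\<lambda>n. free_subgroup_number (Suc n) mod 13 ^ a) = 12 * 13 ^ (a - 1)"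
    unfolding minimal_period_def by (rule Least_equality) (use periods in auto)
  then show ?thesis
    using rational_form periods(1) by (auto simp: ultimately_periodic_def)
qed

end
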